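(* Let $X$ be a finite CW-complex of dimension $d>1$. Then for every $(d-1)$-cobase $S$ of $X$, $$h_{d-1}(X)=\frac{t_{d-2}(X)^2}{t_{d-2}(S^c)^2\,t'_{d-1}(S)^2}\,\det\big(\partial_{S,\Xi_dX}\,\partial_{S,\Xi_dX}^*\big),$$ and the product of the non-zero eigenvalues (with multiplicity) of $\partial_d\partial_d^*$ equals $$\frac{h_{d-1}(X)\,h'_{d-2}(X)}{t_{d-2}(X)^2}.$$
   Context: Cells are oriented; $\Xi_kX$ is the set of $k$-cells of $X$; $\partial_k$ is the cellular boundary map, identified with its matrix of incidence numbers, and $\partial_{S,T}$ is the submatrix of $\partial_k$ with rows indexed by $S\subseteq\Xi_{k-1}X$ and columns indexed by $T\subseteq\Xi_kX$. The superscript $*$ denotes adjoint. For $T\subseteq\Xi_kX$, $X_T$ is the subcomplex consisting of $T$ and all cells of dimension at most $k-1$. $T\subseteq\Xi_kX$ is a $k$-base if it is maximal such that the columns of $\partial_k$ indexed by $T$ are linearly independent (equivalently, maximal with $Z_k(X_T;\mathbb C)=0$). $S\subseteq\Xi_kX$ is a $k$-cobase if it is maximal such that the coboundary map $\delta_k=\partial_{k+1}^*$ is injective on complex $k$-cochains supported on $S$, i.e., such that the rows of $\partial_{k+1}$ indexed by $S$ are linearly independent. For $S\subseteq\Xi_kX$, $S^c=\Xi_kX\setminus S$. For an abelian group $G$, $[G]$ is its torsion subgroup. For $L\subseteq\Xi_kX$, $t_j(L)=|[H_j(X_L;\mathbb Z)]|$, and $t_j(X)=|[H_j(X;\mathbb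 Z)]|$. For $S\subseteq\Xi_kX$, $t'_k(S)$ is the order of the quotient of $Z_k(X;\mathbb Z)$ by $\big(Z_k(X;\mathbb Z)\cap B_k(X;\mathbb Q)\big)+Z_k(X_{S^c};\mathbb Z)$, where $Z_k$ and $B_k$ denote cellular cycles and boundaries. $h_{d-1}(X)=\sum_T t_{d-1}(T)^2$, the sum being over all $d$-bases $T$ of $X$, and $h'_{d-2}(X)=\sum_S t_{d-2}(S^c)^2\,t'_{d-1}(S)^2$, the sum being over all $(d-1)$-cobases $S$ of $X$. *)

theory Defs
  imports
    "HOL-Homology.Homology"
    "Jordan_Normal_Form.Schur_Decomposition"
begin

definition disc :: "nat \<Rightarrow> (nat \<Rightarrow> real) topology" where
  "disc n = subtopology (Euclidean_space n) {x. (\<Sum>i<n. x i ^ 2) \<le> 1}"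

definition disc_boundary :: "nat \<Rightarrow> (nat \<Rightarrow> real) set" where
  "disc_boundary n = {x \<in> topspace (disc n). (\<Sum>i<n. x i ^ 2) = 1}"

definition disc_interior :: "nat \<Rightarrow> (nat \<Rightarrow> real) set" where
  "disc_interior n = {x \<in> topspace (disc n). (\<Sum>i<n. x i ^ 2) < 1}"

text \<open>
  \<open>cw_cells\<close> is a set of names for the cells, with dimensions \<open>cw_dim\<close> and characteristic maps
  \<open>cw_map\<close>. An orientation \<open>cw_orient\<close> of an \<open>n\<close>-cell is a generator of the infinite cyclic group
  \<open>H_n(D^n, S^(n-1))\<close>.
\<close>

record ('a, 'c) cw_complex =
  cw_space :: "'a topology"
  cw_cells :: "'c set"
  cw_dim :: "'c \<Rightarrow> nat"
  cw_map :: "'c \<Rightarrow> (nat \<Rightarrow> real) \<Rightarrow> 'a"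
  cw_orient :: "'c \<Rightarrow> (nat \<Rightarrow> real) chain set"

definition open_cell :: "('a, 'c) cw_complex \<Rightarrow> 'c \<Rightarrow> 'a set" where
  "open_cell X e = cw_map X e ` disc_interior (cw_dim X e)"

text \<open>The index is an integer so that the (-1)-skeleton is available; it is empty.\<close>

definition skeleton :: "('a, 'c) cw_complex \<Rightarrow> int \<Rightarrow> 'a set" where
  "skeleton X n = (\<Union>e \<in> {e \<in> cw_cells X. int (cw_dim X e) \<le> n}. open_cell X e)"

text \<open>
  Since there are only finitely many cells, closure-finiteness and the weak topology condition
  follow from the conditions below.
\<close>

definition finite_cw_complex :: "('a, 'c) cw_complex \<Rightarrow> bool" where
  "finite_cw_complex X \<longleftrightarrow>
     Hausdorff_space (cw_space X) \<and>
     finite (cw_cells X) \<and>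
     (\<forall>e \<in> cw_cells X.
        continuous_map (disc (cw_dim X e)) (cw_space X) (cw_map X e) \<and>
        inj_on (cw_map X e) (disc_interior (cw_dim X e)) \<and>
        cw_map X e ` disc_boundary (cw_dim X e) \<subseteq> skeleton X (int (cw_dim X e) - 1)) \<and>
     disjoint_family_on (open_cell X) (cw_cells X) \<and>
     (\<Union>e \<in> cw_cells X. open_cell X e) = topspace (cw_space X) \<and>
     (\<forall>e \<in> cw_cells X.
        let G = relative_homology_group (int (cw_dim X e)) (disc (cw_dim X e))
                  (disc_boundary (cw_dim X e))
        in cw_orient X e \<in> carrier G \<and> generate G {cw_orient X e} = carrier G)"

definition cells :: "('a, 'c) cw_complex \<Rightarrow> nat \<Rightarrow> 'c set" where
  "cells X k = {e \<in> cw_cells X. cw_dim X e = k}"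

definition has_dimension :: "('a, 'c) cw_complex \<Rightarrow> nat \<Rightarrow> bool" where
  "has_dimension X d \<longleftrightarrow> cells X d \<noteq> {} \<and> (\<forall>e \<in> cw_cells X. cw_dim X e \<le> d)"

text \<open>
  \<open>X_T\<close> for a set \<open>T\<close> of \<open>k\<close>-cells. The parameter \<open>k\<close> is needed because \<open>T\<close> may be empty.
\<close>

definition subcomplex :: "('a, 'c) cw_complex \<Rightarrow> nat \<Rightarrow> 'c set \<Rightarrow> ('a, 'c) cw_complex" where
  "subcomplex X k T =
     (let C = T \<union> {e \<in> cw_cells X. cw_dim X e < k}
      in X\<lparr>cw_space := subtopology (cw_space X) (\<Union>e \<in> C. open_cell X e), cw_cells := C\<rparr>)"

text \<open>The cellular chain group \<open>H_n(X^n, X^(n-1))\<close>.\<close>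

definition cellular_group :: "('a, 'c) cw_complex \<Rightarrow> nat \<Rightarrow> 'a chain set monoid" where
  "cellular_group X n =
     relative_homology_group (int n) (subtopology (cw_space X) (skeleton X (int n)))
       (skeleton X (int n - 1))"

text \<open>The basis element of the cellular chain group given by an oriented cell.\<close>

definition cell_class :: "('a, 'c) cw_complex \<Rightarrow> 'c \<Rightarrow> 'a chain set" where
  "cell_class X e =
     (let n = cw_dim X e
      in hom_induced (int n) (disc n) (disc_boundary n)
           (subtopology (cw_space X) (skeleton X (int n))) (skeleton X (int n - 1))
           (cw_map X e) (cw_orient X e))"

text \<open>The map \<open>H_n(X^n, X^(n-1)) \<rightarrow> H_(n-1)(X^(n-1), X^(n-2))\<close>.\<close>

definition cellular_boundary_hom ::
  "('a, 'c) cw_complex \<Rightarrow> nat \<Rightarrow> 'a chain set \<Rightarrow> 'a chain set" where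
  "cellular_boundary_hom X n =
     hom_relboundary (int n) (subtopology (cw_space X) (skeleton X (int n)))
       (skeleton X (int n - 1)) (skeleton X (int n - 2))"

text \<open>
  The incidence number of \<open>f\<close> in the boundary of \<open>e\<close>: the coefficient at \<open>f\<close> of the boundary of
  the class of \<open>e\<close> in the basis of oriented cells (homology groups are written multiplicatively).
\<close>

definition incidence :: "('a, 'c) cw_complex \<Rightarrow> 'c \<Rightarrow> 'c \<Rightarrow> int" where
  "incidence X f e =
     (if e \<in> cw_cells X \<and> f \<in> cw_cells X \<and> cw_dim X e = Suc (cw_dim X f)
      then THE m. \<exists>c :: 'c \<Rightarrow> int. c f = m \<and>
             cellular_boundary_hom X (cw_dim X e) (cell_class X e) =
             finprod (cellular_group X (cw_dim X f))
               (\<lambda>g. cell_class X g [^]\<^bsub>cellular_group X (cw_dim X f)\<^esub> c g)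
               (cells X (cw_dim X f))
      else 0)"

definition boundary_mat :: "('a, 'c) cw_complex \<Rightarrow> 'c list \<Rightarrow> 'c list \<Rightarrow> complex mat" where
  "boundary_mat X rs cs =
     Matrix.mat (length rs) (length cs) (\<lambda>(i, j). of_int (incidence X (rs ! i) (cs ! j)))"

definition enumerates :: "'c list \<Rightarrow> 'c set \<Rightarrow> bool" where
  "enumerates xs A \<longleftrightarrow> distinct xs \<and> set xs = A"

text \<open>Chains are functions on all cell names that vanish outside the cells in question.\<close>

definition chains :: "('a, 'c) cw_complex \<Rightarrow> nat \<Rightarrow> ('c \<Rightarrow> 'r::comm_ring_1) set" where
  "chains X k = {c. \<forall>e. e \<notin> cells X k \<longrightarrow> c e = 0}"

definition bd :: "('a, 'c) cw_complex \<Rightarrow> ('c \<Rightarrow> 'r::comm_ring_1) \<Rightarrow> 'c \<Rightarrow> 'r" where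
  "bd X c = (\<lambda>f. \<Sum>e \<in> cw_cells X. of_int (incidence X f e) * c e)"

definition cycles :: "('a, 'c) cw_complex \<Rightarrow> nat \<Rightarrow> ('c \<Rightarrow> 'r::comm_ring_1) set" where
  "cycles X k = {c \<in> chains X k. bd X c = (\<lambda>_. 0)}"

definition boundaries :: "('a, 'c) cw_complex \<Rightarrow> nat \<Rightarrow> ('c \<Rightarrow> 'r::comm_ring_1) set" where
  "boundaries X k = bd X ` chains X (Suc k)"

definition additive_group :: "('c \<Rightarrow> 'r::comm_ring_1) set \<Rightarrow> ('c \<Rightarrow> 'r) monoid" where
  "additive_group A = \<lparr>carrier = A, monoid.mult = (\<lambda>a b. \<lambda>e. a e + b e), one = (\<lambda>_. 0)\<rparr>"

definition cw_homology :: "('a, 'c) cw_complex \<Rightarrow> nat \<Rightarrow> ('c \<Rightarrow> int) set monoid" where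
  "cw_homology X j = additive_group (cycles X j) Mod boundaries X j"

definition torsion_subgroup :: "('g, 'm) monoid_scheme \<Rightarrow> 'g set" where
  "torsion_subgroup G = {x \<in> carrier G. \<exists>n::nat. n > 0 \<and> x [^]\<^bsub>G\<^esub> n = \<one>\<^bsub>G\<^esub>}"

definition tors :: "nat \<Rightarrow> ('a, 'c) cw_complex \<Rightarrow> nat" where
  "tors j X = card (torsion_subgroup (cw_homology X j))"

definition tors' :: "nat \<Rightarrow> ('a, 'c) cw_complex \<Rightarrow> 'c set \<Rightarrow> nat" where
  "tors' k X S = Coset.order
     (additive_group (cycles X k :: ('c \<Rightarrow> int) set) Mod
      {\<lambda>e. a e + b e | a b.
         a \<in> cycles X k \<and> (\<lambda>e. rat_of_int (a e)) \<in> boundaries X k \<and>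
         b \<in> cycles (subcomplex X k (cells X k - S)) k})"

definition indep_columns :: "('a, 'c) cw_complex \<Rightarrow> nat \<Rightarrow> 'c set \<Rightarrow> bool" where
  "indep_columns X k T \<longleftrightarrow> T \<subseteq> cells X k \<and>
     (\<forall>c :: 'c \<Rightarrow> complex.
        (\<forall>f \<in> cw_cells X. (\<Sum>e\<in>T. of_int (incidence X f e) * c e) = 0) \<longrightarrow> (\<forall>e\<in>T. c e = 0))"

definition is_base :: "('a, 'c) cw_complex \<Rightarrow> nat \<Rightarrow> 'c set \<Rightarrow> bool" where
  "is_base X k T \<longleftrightarrow> indep_columns X k T \<and> (\<forall>T'. indep_columns X k T' \<and> T \<subseteq> T' \<longrightarrow> T' = T)"

text \<open>Independence of rows of the boundary map from dimension \<open>k + 1\<close> to dimension \<open>k\<close>.\<close>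

definition indep_rows :: "('a, 'c) cw_complex \<Rightarrow> nat \<Rightarrow> 'c set \<Rightarrow> bool" where
  "indep_rows X k S \<longleftrightarrow> S \<subseteq> cells X k \<and>
     (\<forall>c :: 'c \<Rightarrow> complex.
        (\<forall>e \<in> cw_cells X. (\<Sum>f\<in>S. of_int (incidence X f e) * c f) = 0) \<longrightarrow> (\<forall>f\<in>S. c f = 0))"

definition is_cobase :: "('a, 'c) cw_complex \<Rightarrow> nat \<Rightarrow> 'c set \<Rightarrow> bool" where
  "is_cobase X k S \<longleftrightarrow> indep_rows X k S \<and> (\<forall>S'. indep_rows X k S' \<and> S \<subseteq> S' \<longrightarrow> S' = S)"

definition h :: "('a, 'c) cw_complex \<Rightarrow> nat \<Rightarrow> nat" where
  "h X k = (\<Sum>T | is_base X (Suc k) T. (tors k (subcomplex X (Suc k) T))\<^sup>2)"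

definition h' :: "('a, 'c) cw_complex \<Rightarrow> nat \<Rightarrow> nat" where
  "h' X k = (\<Sum>S | is_cobase X (Suc k) S.
     (tors k (subcomplex X (Suc k) (cells X (Suc k) - S)))\<^sup>2 * (tors' (Suc k) X S)\<^sup>2)"

text \<open>
  Multiplicities are algebraic; for the Hermitian matrices of interest they agree with the
  geometric ones.
\<close>

definition prod_nonzero_eigenvalues :: "complex mat \<Rightarrow> complex" where
  "prod_nonzero_eigenvalues A =
     (\<Prod>l | eigenvalue A l \<and> l \<noteq> 0. l ^ Polynomial.order l (char_poly A))"

end

theory Submission
  imports
    Defs
    "HOL-Library.Function_Algebras"
    "HOL-Computational_Algebra.Fundamental_Theorem_Algebra"
begin

text \<open>
  A cell attached along its boundary induces an isomorphism from the homology of the pair of disc and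
  sphere, by pushing a collar radially onto the boundary and excising. Hence the cellular group
  is free on the cells: attaching the cells one at a time shows generation, and collapsing all cells
  but one shows independence. So the incidence numbers are genuine coefficients, the boundary maps
  compose to zero, and they restrict to subcomplexes.

  For a cobase \<open>S\<close> and a base \<open>T\<close>, the absolute value of \<open>det \<partial>_{S,T}\<close> is the index in \<open>\<int>^S\<close> of the
  projection of the lattice spanned by the columns \<open>T\<close>. Computing this index through the chain
  of lattices between the boundaries of \<open>X_T\<close> and the cycles of \<open>X\<close> gives
  \<open>\<bar>det \<partial>_{S,T}\<bar> t_{d-2}(X) = t_{d-1}(T) t'_{d-1}(S) t_{d-2}(S^c)\<close>. Summing the squares over \<open>T\<close> with
  the Cauchy-Binet formula yields the first claim. The product of the non-zero eigenvalues is, up to sign, the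
  lowest non-zero coefficient of the characteristic polynomial, which is a sum of principal
  minors indexed by the cobases \<open>S\<close>; summing the first claim over \<open>S\<close> yields the second one.
\<close>

section \<open>Discs and attached cells\<close>

text \<open>\<open>incidence\<close> is a definite description, so it says nothing until the
  cellular group is known to be free on the cell classes; this forces the topological half of the
  proof. No quotient topology is assumed for a cell: a continuous map from the compact disc to a
  Hausdorff space is closed, which yields continuity of the collar push and the homeomorphism of
  open cells.

  In the algebraic half, projection to the coordinates in \<open>S\<close> is injective on all
  vectors with a positive multiple in the boundary lattice, because the rows in \<open>S\<close>
  span all rows. On the full cycle lattice its kernel is the cycles supported off \<open>S\<close>,
  and this is where \<open>tors'\<close> enters. Indices are cardinalities with infinite read as 0,
  and the product formula for towers holds under this convention. So finiteness needs no separate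
  argument: one non-zero minor, factored into indices, makes every factor finite. As
  \<open>S\<close> and \<open>T\<close> are different sets, a minor needs an identification of the
  two; an arbitrary bijection is used, and it affects only the sign.\<close>

lemma disc_eq_top_of_set: "disc n = top_of_set {x. (\<forall>i\<ge>n. x i = 0) \<and> (\<Sum>i<n. (x i)\<^sup>2) \<le> 1}"
  by (simp add: disc_def Euclidean_space_def euclidean_product_topology subtopology_subtopology Collect_conj_eq)

lemma topspace_disc: "topspace (disc n) = {x. (\<forall>i\<ge>n. x i = 0) \<and> L2_set x {..<n} \<le> 1}"
  by (auto simp: disc_eq_top_of_set L2_set_def)

lemma disc_boundary_eq: "disc_boundary n = {x. (\<forall>i\<ge>n. x i = 0) \<and> L2_set x {..<n} = 1}"
  by (auto simp: disc_boundary_def topspace_disc L2_set_def)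

lemma disc_interior_eq: "disc_interior n = {x. (\<forall>i\<ge>n. x i = 0) \<and> L2_set x {..<n} < 1}"
  by (auto simp: disc_interior_def topspace_disc L2_set_def)

lemma topspace_disc_split: "topspace (disc n) = disc_interior n \<union> disc_boundary n"
  by (auto simp: topspace_disc disc_boundary_eq disc_interior_eq)

lemma continuous_on_coordinate: "continuous_on S (\<lambda>x :: nat \<Rightarrow> real. x i)"
  by (rule continuous_on_product_then_coordinatewise [OF continuous_on_id])

lemma continuous_on_L2_set: "continuous_on S (\<lambda>x :: nat \<Rightarrow> real. L2_set x A)"
  unfolding L2_set_def by (intro continuous_intros continuous_on_coordinate)

lemma closedin_disc: "closed T \<Longrightarrow> closedin (disc n) (topspace (disc n) \<inter> T)"
  by (simp add: disc_eq_top_of_set closedin_closed_Int)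

text \<open>The ambient space is an infinite product of lines, so Heine-Borel does not apply; the
  disc is a closed subset of a cube that is compact by Tychonoff.\<close>

lemma compact_space_disc: "compact_space (disc n)"
proof -
  let ?D = "{x :: nat \<Rightarrow> real. (\<forall>i\<ge>n. x i = 0) \<and> (\<Sum>i<n. (x i)\<^sup>2) \<le> 1}"
  have "compactin (powertop_real UNIV) (PiE UNIV (\<lambda>_ :: nat. {-1..1 :: real}))"
    by (simp add: compactin_PiE)
  then have "compact (PiE UNIV (\<lambda>_ :: nat. {-1..1 :: real}))"
    by (simp add: euclidean_product_topology)
  moreover have "closed ?D"
    by (intro closed_Collect_conj closed_Collect_all closed_Collect_imp closed_Collect_eq
        closed_Collect_le continuous_intros continuous_on_coordinate) auto
  moreover have "?D \<subseteq> PiE UNIV (\<lambda>_. {-1..1})"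
  proof
    fix x :: "nat \<Rightarrow> real" assume "x \<in> ?D"
    then have x: "\<forall>i\<ge>n. x i = 0" "(\<Sum>i<n. (x i)\<^sup>2) \<le> 1"
      by auto
    have "(x i)\<^sup>2 \<le> 1" for i
    proof (cases "i < n")
      case True
      then have "(x i)\<^sup>2 \<le> (\<Sum>i<n. (x i)\<^sup>2)"
        by (intro member_le_sum) auto
      then show ?thesis using x by simp
    qed (use x in simp)
    then have "\<bar>x i\<bar> \<le> 1" for i
      by (simp add: abs_square_le_1)
    then show "x \<in> PiE UNIV (\<lambda>_. {-1..1})"
      by (auto simp: abs_le_iff minus_le_iff)
  qed
  ultimately have "compact ?D"
    using compact_Int_closed [of "PiE UNIV (\<lambda>_. {-1..1})" ?D] by (simp only: Int_absorb1)
  then show ?thesis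
    by (simp add: disc_eq_top_of_set compact_space_subtopology)
qed

lemma Hausdorff_space_disc: "Hausdorff_space (disc n)"
  by (simp add: disc_def Hausdorff_Euclidean_space Hausdorff_space_subtopology)

text \<open>The radius is scaled by \<open>1 + t\<close> and truncated at \<open>1\<close>, so at time \<open>1\<close> the outer half of the disc lands on the
  boundary.\<close>

definition stretch_disc :: "nat \<Rightarrow> real \<Rightarrow> (nat \<Rightarrow> real) \<Rightarrow> nat \<Rightarrow> real" where
  "stretch_disc n t x = (\<lambda>i. x i / max (L2_set x {..<n}) (1 / (1 + t)))"

lemma L2_set_divide: "c \<ge> 0 \<Longrightarrow> L2_set (\<lambda>i. f i / c) A = L2_set f A / c"
  using L2_set_left_distrib [of "1/c" f A] by simp

lemma L2_stretch_disc:
  "0 \<le> t \<Longrightarrow> L2_set (stretch_disc n t x) {..<n} = L2_set x {..<n} / max (L2_set x {..<n}) (1 / (1 + t))"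
  unfolding stretch_disc_def by (subst L2_set_divide) (auto simp: le_max_iff_disj)

text \<open>The denominator is at least \<open>1 / (1 + t)\<close>, hence positive. This keeps the
  push continuous at the origin, where plain radial normalisation would not be.\<close>

lemma continuous_on_stretch_disc:
  "continuous_on ({0..} \<times> UNIV) (\<lambda>p. stretch_disc n (fst p) (snd p))"
proof -
  have [continuous_intros]: "continuous_on A (\<lambda>p :: real \<times> (nat \<Rightarrow> real). snd p i)" for A i
    by (rule continuous_on_compose2 [OF continuous_on_coordinate continuous_on_snd]) auto
  show ?thesis
    unfolding stretch_disc_def L2_set_def
    by (intro continuous_on_coordinatewise_then_product continuous_intros)
      (auto simp: max_def intro: add_pos_nonneg)
qed

lemma stretch_disc_boundary:
  assumes "x \<in> disc_boundary n" "0 \<le> t"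
  shows "stretch_disc n t x = x"
  using assms by (auto simp: stretch_disc_def disc_boundary_eq max_def field_simps)

lemma stretch_disc_0:
  assumes "x \<in> topspace (disc n)"
  shows "stretch_disc n 0 x = x"
  using assms by (auto simp: stretch_disc_def topspace_disc max_def)

lemma stretch_disc_1:
  assumes "x \<in> topspace (disc n)" "1 / 2 \<le> L2_set x {..<n}"
  shows "stretch_disc n 1 x \<in> disc_boundary n"
  using assms by (auto simp: disc_boundary_eq L2_stretch_disc topspace_disc)  (auto simp: stretch_disc_def)

lemma stretch_disc_in_disc:
  assumes "x \<in> topspace (disc n)" "0 \<le> t"
  shows "stretch_disc n t x \<in> topspace (disc n)"
proof -
  have "0 < max (L2_set x {..<n}) (1 / (1 + t))"
    using assms by (simp add: less_max_iff_disj)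
  then show ?thesis
    using assms by (auto simp: topspace_disc L2_stretch_disc divide_le_eq) (auto simp: stretch_disc_def)
qed

lemma L2_stretch_disc_ge:
  assumes "x \<in> topspace (disc n)" "0 \<le> t"
  shows "L2_set x {..<n} \<le> L2_set (stretch_disc n t x) {..<n}"
proof -
  have *: "0 < max (L2_set x {..<n}) (1 / (1 + t))"
    using assms by (simp add: less_max_iff_disj)
  moreover have "max (L2_set x {..<n}) (1 / (1 + t)) \<le> 1"
    using assms by (simp add: topspace_disc)
  ultimately show ?thesis
    using assms by (simp add: L2_stretch_disc le_divide_eq mult_left_le L2_set_nonneg)
qed

text \<open>\<open>Y\<close> is the closed subspace \<open>B\<close> with one \<open>n\<close>-cell
  attached. That \<open>Y\<close> carries the quotient topology is a consequence of the compactness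
  of the disc and the Hausdorff property. The locale is instantiated both by the layers of a complex
  and by the disc over its own sphere.\<close>

locale attached_cell =
  fixes Y :: "'a topology" and B :: "'a set" and n :: nat and \<phi> :: "(nat \<Rightarrow> real) \<Rightarrow> 'a"
  assumes Hausdorff: "Hausdorff_space Y"
    and closed: "closedin Y B"
    and cont: "continuous_map (disc n) Y \<phi>"
    and inj: "inj_on \<phi> (disc_interior n)"
    and image_interior: "\<phi> ` disc_interior n = topspace Y - B"
    and image_boundary: "\<phi> ` disc_boundary n \<subseteq> B"
begin

text \<open>The two clauses fit together because \<open>stretch_disc\<close> fixes the boundary
  sphere. Off \<open>B\<close> the use of \<open>inv_into\<close> is a genuine inverse, as \<phi> is
  injective on the open disc.\<close>

definition stretch :: "real \<Rightarrow> 'a \<Rightarrow> 'a" where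
  "stretch t y = (if y \<in> B then y else \<phi> (stretch_disc n t (inv_into (disc_interior n) \<phi> y)))"

text \<open>The threshold 1/2 is the truncation radius \<open>1 / (1 + t)\<close> at time 1: exactly
  the points of the cell at or beyond it are pushed into \<open>B\<close>.\<close>

definition collar :: "'a set" where
  "collar = topspace Y - \<phi> ` {x \<in> topspace (disc n). L2_set x {..<n} < 1 / 2}"

lemma B_subset: "B \<subseteq> topspace Y"
  using closed closedin_subset by blast

lemma image_disc: "\<phi> x \<in> topspace Y" if "x \<in> topspace (disc n)"
  using that cont continuous_map_image_subset_topspace by blast

lemma phi_in_B_iff: "x \<in> topspace (disc n) \<Longrightarrow> \<phi> x \<in> B \<longleftrightarrow> x \<in> disc_boundary n"
  using image_interior image_boundary by (auto simp: topspace_disc_split)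

lemma phi_cases:
  assumes "y \<in> topspace Y"
  obtains "y \<in> B" | x where "x \<in> disc_interior n" "y = \<phi> x" "y \<notin> B"
  using assms image_interior by blast

lemma stretch_phi:
  assumes "x \<in> topspace (disc n)" "0 \<le> t"
  shows "stretch t (\<phi> x) = \<phi> (stretch_disc n t x)"
proof (cases "x \<in> disc_boundary n")
  case True
  then show ?thesis
    using assms by (simp add: stretch_def phi_in_B_iff stretch_disc_boundary)
next
  case False
  then have "x \<in> disc_interior n"
    using assms by (simp add: topspace_disc_split)
  then show ?thesis
    using False assms by (simp add: stretch_def phi_in_B_iff inj)
qed

lemma stretch_B: "y \<in> B \<Longrightarrow> stretch t y = y"
  by (simp add: stretch_def)

text \<open>A quotient map times an identity need not be a quotient map. Here the whole product with
  the time interval is compact and its target Hausdorff, so the product map is closed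
  outright.\<close>

lemma closed_map_prod:
  "closed_map (prod_topology (top_of_set {0..1::real}) (disc n)) (prod_topology (top_of_set {0..1::real}) Y)
    (\<lambda>p. (fst p, \<phi> (snd p)))"
proof (rule continuous_imp_closed_map)
  show "continuous_map (prod_topology (top_of_set {0..1}) (disc n)) (prod_topology (top_of_set {0..1}) Y)
     (\<lambda>p. (fst p, \<phi> (snd p)))"
    using continuous_map_compose [OF continuous_map_snd cont]
    by (intro continuous_map_pairedI continuous_map_fst) (simp add: o_def)
  show "compact_space (prod_topology (top_of_set {0..1::real}) (disc n))"
    by (simp add: compact_space_prod_topology compact_space_disc compact_space_subtopology)
  show "Hausdorff_space (prod_topology (top_of_set {0..1::real}) Y)"
    by (simp add: Hausdorff_space_prod_topology Hausdorff Hausdorff_space_subtopology)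
qed

lemma continuous_map_stretch_disc:
  "continuous_map (prod_topology (top_of_set {0..1}) (disc n)) (disc n)
     (\<lambda>p. stretch_disc n (fst p) (snd p))"
proof -
  have *: "prod_topology (top_of_set {0..1}) (disc n) = top_of_set ({0..1} \<times> topspace (disc n))"
    by (simp add: disc_eq_top_of_set flip: prod_topology_subtopology_eu)
  have "continuous_on ({0..1} \<times> topspace (disc n)) (\<lambda>p. stretch_disc n (fst p) (snd p))"
    by (rule continuous_on_subset [OF continuous_on_stretch_disc]) auto
  then have "continuous_map (top_of_set ({0..1} \<times> topspace (disc n))) (top_of_set (topspace (disc n)))
     (\<lambda>p. stretch_disc n (fst p) (snd p))"
    using stretch_disc_in_disc by (simp only: continuous_map_subtopology_eu image_subset_iff) auto
  then show ?thesis
    unfolding * by (simp add: disc_eq_top_of_set)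
qed

lemma continuous_map_stretch:
  "continuous_map (prod_topology (top_of_set {0..1}) Y) Y (\<lambda>p. stretch (fst p) (snd p))"
  unfolding continuous_map_closedin
proof (intro conjI allI impI)
  show "(\<lambda>p. stretch (fst p) (snd p)) \<in> topspace (prod_topology (top_of_set {0..1}) Y) \<rightarrow> topspace Y"
    using B_subset by (auto elim!: phi_cases simp: stretch_B)
      (metis UnCI image_disc stretch_disc_in_disc stretch_phi topspace_disc_split)
  fix C assume C: "closedin Y C"
  let ?q = "\<lambda>p. (fst p :: real, \<phi> (snd p))"
  let ?I = "top_of_set {0..1::real}"
  let ?P = "{p \<in> topspace (prod_topology ?I (disc n)). (\<phi> \<circ> (\<lambda>p. stretch_disc n (fst p) (snd p))) p \<in> C}"
  \<comment> \<open>The preimage splits along \<open>B\<close>: over \<open>B\<close> the push is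
    constant in time, and over the cell the preimage is the image, under the closed product map, of
    a closed set in the cylinder over the disc.\<close>
  have "{p \<in> topspace (prod_topology ?I Y). stretch (fst p) (snd p) \<in> C} = {0..1} \<times> (B \<inter> C) \<union> ?q ` ?P" (is "?L = ?R")
  proof
    show "?L \<subseteq> ?R"
    proof
      fix p assume "p \<in> ?L"
      then obtain t y where p: "p = (t, y)" and t: "0 \<le> t" "t \<le> 1" and y: "y \<in> topspace Y" "stretch t y \<in> C"
        by (cases p) auto
      from y(1) show "p \<in> ?R"
      proof (cases rule: phi_cases)
        case 1
        then show ?thesis using y t p stretch_B by simp
      next
        case (2 x)
        then have "x \<in> topspace (disc n)" by (simp add: topspace_disc_split)
        then have "(t, x) \<in> ?P" "p = ?q (t, x)"
          using 2 t y p stretch_phi by auto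
        then show ?thesis
          by blast
      qed
    qed
    show "?R \<subseteq> ?L"
      using B_subset by (auto simp: stretch_B stretch_phi image_disc)
  qed
  moreover have "closedin (prod_topology ?I (disc n)) ?P"
    by (rule closedin_continuous_map_preimage [OF continuous_map_compose [OF continuous_map_stretch_disc cont] C])
  then have "closedin (prod_topology ?I Y) (?q ` ?P)"
    using closed_map_prod by (simp add: closed_map_def)
  moreover have "closedin (prod_topology ?I Y) ({0..1} \<times> (B \<inter> C))"
    using C closed by (simp add: closedin_prod_Times_iff closedin_Int closedin_subtopology_refl)
  ultimately show "closedin (prod_topology ?I Y) {p \<in> topspace (prod_topology ?I Y). stretch (fst p) (snd p) \<in> C}"
    by (simp only: closedin_Un)
qed

lemma collar_subset: "collar \<subseteq> topspace Y"
  by (auto simp: collar_def)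

lemma B_subset_collar: "B \<subseteq> collar"
proof -
  have "\<phi> x \<notin> B" if "x \<in> topspace (disc n)" "L2_set x {..<n} < 1 / 2" for x
    using that by (simp add: phi_in_B_iff disc_boundary_eq)
  then show ?thesis
    unfolding collar_def using B_subset by blast
qed

lemma in_collar_iff:
  assumes "x \<in> topspace (disc n)"
  shows "\<phi> x \<in> collar \<longleftrightarrow> 1 / 2 \<le> L2_set x {..<n}"
proof -
  \<comment> \<open>A further preimage \<open>z\<close> in the inner ball lies in the open disc.
    Membership in \<open>B\<close> detects the sphere, so \<open>x\<close> lies in the open disc
    too, and injectivity gives \<open>x = z\<close>.\<close>
  have "L2_set x {..<n} < 1 / 2" if "\<phi> x = \<phi> z" "z \<in> topspace (disc n)" "L2_set z {..<n} < 1 / 2" for z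
  proof -
    have z: "z \<in> disc_interior n" "z \<notin> disc_boundary n"
      using that by (auto simp: disc_interior_eq topspace_disc disc_boundary_eq)
    then have "x \<notin> disc_boundary n"
      using that assms phi_in_B_iff by metis
    then have "x \<in> disc_interior n"
      using assms by (simp add: topspace_disc_split)
    then show ?thesis
      using z that inj by (metis inj_onD)
  qed
  then show ?thesis
    using assms by (force simp: collar_def image_disc not_less)
qed

lemma stretch_collar:
  assumes "y \<in> collar" "0 \<le> t"
  shows "stretch t y \<in> collar"
proof -
  have "y \<in> topspace Y" using assms by (simp add: collar_def)
  then show ?thesis
  proof (cases rule: phi_cases)
    case 1
    then show ?thesis using assms by (simp add: stretch_B)
  next
    case (2 x)
    then have x: "x \<in> topspace (disc n)" by (simp add: topspace_disc_split)
    then have "1 / 2 \<le> L2_set x {..<n}"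
      using assms 2 in_collar_iff by blast
    then have "1 / 2 \<le> L2_set (stretch_disc n t x) {..<n}"
      using L2_stretch_disc_ge [OF x assms(2)] by linarith
    then show ?thesis
      using 2 x assms by (simp add: stretch_phi in_collar_iff stretch_disc_in_disc)
  qed
qed

lemma stretch_1_collar:
  assumes "y \<in> collar"
  shows "stretch 1 y \<in> B"
proof -
  have "y \<in> topspace Y" using assms by (simp add: collar_def)
  then show ?thesis
  proof (cases rule: phi_cases)
    case 1
    then show ?thesis using assms by (simp add: stretch_B)
  next
    case (2 x)
    then have x: "x \<in> topspace (disc n)" by (simp add: topspace_disc_split)
    then have "1 / 2 \<le> L2_set x {..<n}"
      using assms 2 in_collar_iff by blast
    then have "stretch_disc n 1 x \<in> disc_boundary n"
      using x stretch_disc_1 by blast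
    then show ?thesis
      using 2 x image_boundary by (auto simp: stretch_phi)
  qed
qed

lemma stretch_0: "y \<in> topspace Y \<Longrightarrow> stretch 0 y = y"
  by (erule phi_cases) (auto simp: stretch_B stretch_phi stretch_disc_0 topspace_disc_split)

text \<open>One homotopy serves every invariant subspace. It is used for \<open>B\<close>, which is
  fixed pointwise, and for \<open>collar\<close>, which is invariant because the push never
  decreases the radius.\<close>

lemma homotopic_stretch:
  assumes "S \<subseteq> topspace Y" and "\<And>t y. \<lbrakk>0 \<le> t; y \<in> S\<rbrakk> \<Longrightarrow> stretch t y \<in> S"
  shows "homotopic_with (\<lambda>h. h \<in> S \<rightarrow> S) Y Y (stretch 1) id"
proof -
  have "homotopic_with (\<lambda>h. h \<in> S \<rightarrow> S) Y Y (stretch 0) (stretch 1)"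
    unfolding homotopic_with_def
    using continuous_map_stretch assms(2)
    by (intro exI [of _ "\<lambda>p. stretch (fst p) (snd p)"]) auto
  then have "homotopic_with (\<lambda>h. h \<in> S \<rightarrow> S) Y Y (stretch 1) (stretch 0)"
    by (rule homotopic_with_symD)
  moreover have "homotopic_with (\<lambda>h. h \<in> S \<rightarrow> S) Y Y id (stretch 0)"
    by (rule homotopic_with_equal) (use assms(2) in \<open>auto simp: stretch_0\<close>)
  then have "homotopic_with (\<lambda>h. h \<in> S \<rightarrow> S) Y Y (stretch 0) id"
    by (rule homotopic_with_symD)
  ultimately show ?thesis
    by (rule homotopic_with_trans)
qed

lemma homotopic_stretch_B: "homotopic_with (\<lambda>h. h \<in> B \<rightarrow> B) Y Y (stretch 1) id"
  by (rule homotopic_stretch [OF B_subset]) (simp add: stretch_B)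

lemma homotopic_stretch_collar: "homotopic_with (\<lambda>h. h \<in> collar \<rightarrow> collar) Y Y (stretch 1) id"
  by (rule homotopic_stretch [OF collar_subset]) (rule stretch_collar)

text \<open>The inclusion and \<open>stretch 1\<close> are inverse up to homotopy of pairs: both
  composites are \<open>stretch 1\<close> itself.\<close>

lemma iso_B_collar:
  "hom_induced p Y B Y collar id \<in> iso (relative_homology_group p Y B) (relative_homology_group p Y collar)"
proof -
  have "group_isomorphisms (relative_homology_group p Y B) (relative_homology_group p Y collar)
          (hom_induced p Y B Y collar id) (hom_induced p Y collar Y B (stretch 1))"
  proof (rule homotopy_equivalence_relative_homology_group_isomorphisms)
    show "id \<in> B \<rightarrow> collar" "stretch 1 \<in> collar \<rightarrow> B"
      using B_subset_collar stretch_1_collar by auto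
    show "continuous_map Y Y (stretch 1)"
      using homotopic_with_imp_continuous_maps [OF homotopic_stretch_B] by blast
    show "homotopic_with (\<lambda>h. h \<in> B \<rightarrow> B) Y Y (stretch 1 \<circ> id) id"
      "homotopic_with (\<lambda>h. h \<in> collar \<rightarrow> collar) Y Y (id \<circ> stretch 1) id"
      by (simp_all only: comp_id id_comp homotopic_stretch_B homotopic_stretch_collar)
  qed simp
  then show ?thesis
    by (rule group_isomorphisms_imp_iso)
qed

text \<open>Excision of \<open>B\<close>. It requires \<open>B\<close> to lie in the interior of the
  collar; the complement of the compact image of the closed ball of radius 1/2 is an open set
  between the two.\<close>

lemma iso_collar_interior:
  "hom_induced p (subtopology Y (topspace Y - B)) (collar - B) Y collar id
   \<in> iso (relative_homology_group p (subtopology Y (topspace Y - B)) (collar - B)) (relative_homology_group p Y collar)"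
proof -
  let ?V = "{x \<in> topspace (disc n). L2_set x {..<n} \<le> 1 / 2}"
  have "closed {x :: nat \<Rightarrow> real. L2_set x {..<n} \<le> 1 / 2}"
    by (rule closed_Collect_le [OF continuous_on_L2_set continuous_on_const])
  then have "closedin (disc n) (topspace (disc n) \<inter> {x. L2_set x {..<n} \<le> 1 / 2})"
    by (rule closedin_disc)
  then have "closedin (disc n) ?V"
    by (simp add: Collect_conj_eq)
  then have "compactin (disc n) ?V"
    using closedin_compact_space compact_space_disc by blast
  then have "closedin Y (\<phi> ` ?V)"
    using Hausdorff compactin_imp_closedin cont image_compactin by blast
  then have "openin Y (topspace Y - \<phi> ` ?V)"
    by (rule openin_diff [OF openin_topspace])
  moreover have "topspace Y - \<phi> ` ?V \<subseteq> collar"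
    by (auto simp: collar_def)
  ultimately have "topspace Y - \<phi> ` ?V \<subseteq> Y interior_of collar"
    by (simp add: interior_of_maximal)
  moreover have "B \<subseteq> topspace Y - \<phi> ` ?V"
    using B_subset phi_in_B_iff by (auto simp: disc_boundary_eq)
  moreover have "Y closure_of B = B"
    by (simp add: closed closure_of_closedin)
  ultimately have "Y closure_of B \<subseteq> Y interior_of collar"
    by simp
  then have "hom_induced p (subtopology Y (topspace Y - B)) (collar - B) (subtopology Y (topspace Y)) collar id
   \<in> iso (relative_homology_group p (subtopology Y (topspace Y - B)) (collar - B)) (relative_homology_group p (subtopology Y (topspace Y)) collar)"
    by (rule homology_excision_axiom) (auto simp: collar_def)
  then show ?thesis
    by simp
qed

text \<open>A closed map stays closed over a subset of its target if the full preimage is kept, and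
  the full preimage of the open cell is the open disc.\<close>

lemma homeomorphic_map_interior:
  "homeomorphic_map (subtopology (disc n) (topspace (disc n) - disc_boundary n)) (subtopology Y (topspace Y - B)) \<phi>"
proof (rule bijective_closed_imp_homeomorphic_map)
  have int: "topspace (disc n) - disc_boundary n = disc_interior n"
    by (auto simp: topspace_disc disc_interior_eq disc_boundary_eq)
  have sub: "disc_interior n \<subseteq> topspace (disc n)"
    by (simp add: topspace_disc_split)
  have closed_map: "closed_map (disc n) Y \<phi>"
    using cont Hausdorff compact_space_disc continuous_imp_closed_map by blast
  show "continuous_map (subtopology (disc n) (topspace (disc n) - disc_boundary n)) (subtopology Y (topspace Y - B)) \<phi>"
    using image_interior by (auto simp: int continuous_map_in_subtopology continuous_map_from_subtopology cont)
  have "{x \<in> topspace (disc n). \<phi> x \<in> topspace Y - B} = topspace (disc n) - disc_boundary n"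
    by (auto simp: phi_in_B_iff image_disc)
  then show "closed_map (subtopology (disc n) (topspace (disc n) - disc_boundary n)) (subtopology Y (topspace Y - B)) \<phi>"
    using closed_map_restriction [OF closed_map] by metis
  show "\<phi> ` topspace (subtopology (disc n) (topspace (disc n) - disc_boundary n)) = topspace (subtopology Y (topspace Y - B))"
    using image_interior sub by (simp add: int Int_absorb1 Int_commute) (simp add: Int_absorb2)
  show "inj_on \<phi> (topspace (subtopology (disc n) (topspace (disc n) - disc_boundary n)))"
    using inj sub by (simp add: int Int_absorb1)
qed

end

text \<open>This makes the collar and excision isomorphisms available on the source side of
  \<open>iso_hom_induced\<close> as well.\<close>

lemma attached_cell_disc: "attached_cell (disc n) (disc_boundary n) n id"
proof
  show "closedin (disc n) (disc_boundary n)"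
  proof -
    have "closed {x :: nat \<Rightarrow> real. L2_set x {..<n} = 1}"
      by (rule closed_Collect_eq [OF continuous_on_L2_set continuous_on_const])
    then have "closedin (disc n) (topspace (disc n) \<inter> {x. L2_set x {..<n} = 1})"
      by (rule closedin_disc)
    moreover have "topspace (disc n) \<inter> {x. L2_set x {..<n} = 1} = disc_boundary n"
      by (auto simp: topspace_disc disc_boundary_eq)
    ultimately show ?thesis
      by simp
  qed
  show "id ` disc_interior n = topspace (disc n) - disc_boundary n"
    by (auto simp: topspace_disc disc_interior_eq disc_boundary_eq)
qed (simp_all add: Hausdorff_space_disc)

context attached_cell
begin

text \<open>Passing to collars and then excising reduces \<phi> to a homeomorphism of open cells
  with matching collars. Two naturality squares carry bijectivity back, by cancelling
  isomorphisms.\<close>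

theorem iso_hom_induced:
  "hom_induced p (disc n) (disc_boundary n) Y B \<phi>
   \<in> iso (relative_homology_group p (disc n) (disc_boundary n)) (relative_homology_group p Y B)"
proof -
  interpret D: attached_cell "disc n" "disc_boundary n" n id
    by (rule attached_cell_disc)
  let ?D = "disc n" and ?S = "disc_boundary n"
  let ?HD = "relative_homology_group p ?D ?S" and ?HY = "relative_homology_group p Y B"
  let ?HDc = "relative_homology_group p ?D D.collar" and ?HYc = "relative_homology_group p Y collar"
  let ?Di = "subtopology ?D (topspace ?D - ?S)" and ?Yi = "subtopology Y (topspace Y - B)"
  let ?HDi = "relative_homology_group p ?Di (D.collar - ?S)" and ?HYi = "relative_homology_group p ?Yi (collar - B)"
  have eD: "bij_betw (hom_induced p ?Di (D.collar - ?S) ?D D.collar id) (carrier ?HDi) (carrier ?HDc)"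
    using D.iso_collar_interior [of p] by (simp add: iso_def)
  have iD: "bij_betw (hom_induced p ?D ?S ?D D.collar id) (carrier ?HD) (carrier ?HDc)"
    using D.iso_B_collar [of p] by (simp add: iso_def)
  have iY: "bij_betw (hom_induced p Y B Y collar id) (carrier ?HY) (carrier ?HYc)"
    using iso_B_collar [of p] by (simp add: iso_def)
  have S: "\<phi> \<in> ?S \<rightarrow> B"
    using image_boundary by blast
  have Dc: "D.collar \<subseteq> topspace ?D"
    by (auto simp: D.collar_def)
  have c: "\<phi> \<in> D.collar \<rightarrow> collar"
    using Dc D.in_collar_iff in_collar_iff by auto
  have "\<phi> ` (D.collar - ?S) = collar - B"
  proof
    show "\<phi> ` (D.collar - ?S) \<subseteq> collar - B"
      using Dc c phi_in_B_iff by blast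
    show "collar - B \<subseteq> \<phi> ` (D.collar - ?S)"
    proof
      fix y assume y: "y \<in> collar - B"
      then obtain x where x: "x \<in> disc_interior n" "y = \<phi> x"
        using image_interior by (auto simp: collar_def)
      then have "x \<in> D.collar" "x \<notin> ?S"
        using y D.in_collar_iff in_collar_iff phi_in_B_iff by (auto simp: topspace_disc_split)
      then show "y \<in> \<phi> ` (D.collar - ?S)"
        using x by blast
    qed
  qed
  then have h: "hom_induced p ?Di (D.collar - ?S) ?Yi (collar - B) \<phi> \<in> iso ?HDi ?HYi"
    using Dc by (intro homeomorphic_map_relative_homology_iso homeomorphic_map_interior) auto
  have "continuous_map ?Di ?Yi \<phi>"
    using homeomorphic_map_interior homeomorphic_imp_continuous_map by blast
  moreover have "\<phi> \<in> (D.collar - ?S) \<rightarrow> collar - B"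
    using Dc c phi_in_B_iff by blast
  ultimately have "hom_induced p ?D D.collar Y collar \<phi> \<circ> hom_induced p ?Di (D.collar - ?S) ?D D.collar id
     = hom_induced p ?Yi (collar - B) Y collar id \<circ> hom_induced p ?Di (D.collar - ?S) ?Yi (collar - B) \<phi>"
    using c cont by (subst (1 2) hom_induced_compose [symmetric]) auto
  then have "hom_induced p ?D D.collar Y collar \<phi> \<circ> hom_induced p ?Di (D.collar - ?S) ?D D.collar id \<in> iso ?HDi ?HYc"
    using iso_set_trans [OF h iso_collar_interior] by simp
  then have "bij_betw (hom_induced p ?D D.collar Y collar \<phi>) (carrier ?HDc) (carrier ?HYc)"
    by (simp only: iso_def mem_Collect_eq bij_betw_comp_iff [OF eD, symmetric])
  then have "bij_betw (hom_induced p ?D D.collar Y collar \<phi> \<circ> hom_induced p ?D ?S ?D D.collar id) (carrier ?HD) (carrier ?HYc)"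
    using bij_betw_trans [OF iD] by blast
  moreover have "hom_induced p ?D D.collar Y collar \<phi> \<circ> hom_induced p ?D ?S ?D D.collar id
    = hom_induced p Y B Y collar id \<circ> hom_induced p ?D ?S Y B \<phi>"
    using c cont S B_subset_collar D.B_subset_collar by (subst (1 2) hom_induced_compose [symmetric]) auto
  moreover have "hom_induced p ?D ?S Y B \<phi> ` carrier ?HD \<subseteq> carrier ?HY"
    using hom_induced_carrier by blast
  ultimately have "bij_betw (hom_induced p ?D ?S Y B \<phi>) (carrier ?HD) (carrier ?HY)"
    using bij_betw_comp_iff2 [OF iY] by metis
  then show ?thesis
    by (simp add: iso_def hom_induced_hom)
qed

end

section \<open>Relative homology of the disc modulo its sphere\<close>

lemma contractible_space_disc: "contractible_space (disc n)"
  unfolding contractible_space_def homotopic_with_def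
proof (intro exI conjI allI ballI)
  let ?h = "\<lambda>p :: real \<times> (nat \<Rightarrow> real). \<lambda>i. (1 - fst p) * snd p i"
  have "?h p \<in> topspace (disc n)" if p: "p \<in> {0..1} \<times> topspace (disc n)" for p
  proof -
    have "L2_set (?h p) {..<n} = (1 - fst p) * L2_set (snd p) {..<n}"
      using p by (intro L2_set_right_distrib [symmetric]) auto
    also have "\<dots> \<le> 1 * 1"
      using p by (intro mult_mono) (auto simp: topspace_disc L2_set_nonneg)
    finally show ?thesis
      using p by (auto simp: topspace_disc)
  qed
  moreover have "continuous_on ({0..1} \<times> topspace (disc n)) ?h"
    by (intro continuous_on_coordinatewise_then_product continuous_intros
        continuous_on_compose2 [OF continuous_on_coordinate continuous_on_snd]) auto
  ultimately have "continuous_map (top_of_set ({0..1} \<times> topspace (disc n))) (top_of_set (topspace (disc n))) ?h"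
    by (simp only: continuous_map_subtopology_eu image_subset_iff) auto
  then show "continuous_map (prod_topology (top_of_set {0..1}) (disc n)) (disc n) ?h"
    by (simp add: disc_eq_top_of_set flip: prod_topology_subtopology_eu)
qed auto

lemma subtopology_disc_boundary: "subtopology (disc (Suc n)) (disc_boundary (Suc n)) = nsphere n"
proof -
  have "{x. (\<Sum>i<Suc n. (x i)\<^sup>2) \<le> 1} \<inter> disc_boundary (Suc n)
      = topspace (Euclidean_space (Suc n)) \<inter> {x. (\<Sum>i\<le>n. (x i)\<^sup>2) = 1}"
    by (auto simp: disc_boundary_def disc_def lessThan_Suc_atMost)
  then show ?thesis
    unfolding disc_def nsphere_def subtopology_subtopology by (metis subtopology_restrict)
qed

abbreviation disc_homology :: "nat \<Rightarrow> (nat \<Rightarrow> real) chain set monoid" where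
  "disc_homology n \<equiv> relative_homology_group (int n) (disc n) (disc_boundary n)"

text \<open>For positive \<open>n\<close> contractibility identifies the group with the reduced
  homology of the sphere, one degree lower; this needs a point on the sphere. In dimension 0 the
  sphere is empty and the group is the homology of a point.\<close>

lemma disc_homology_integer_group:
  "disc_homology n \<cong> integer_group"
proof (cases n)
  case 0
  have "topspace (disc 0) = {\<lambda>_. 0}"
    by (auto simp: topspace_disc)
  moreover have "disc_boundary 0 = {}"
    by (simp add: disc_boundary_def)
  ultimately show ?thesis
    using homology_coefficients 0 by simp
next
  case (Suc m)
  have "(\<lambda>i. if i = 0 then 1 else 0) \<in> disc_boundary n"
    by (simp add: disc_boundary_eq Suc L2_set_def power2_eq_square if_distrib [where f = "\<lambda>x. x * _"] cong: if_cong)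
  then have "topspace (disc n) \<inter> disc_boundary n \<noteq> {}"
    by (auto simp: topspace_disc_split)
  then have "disc_homology n \<cong> reduced_homology_group (int n - 1) (subtopology (disc n) (disc_boundary n))"
    by (simp add: contractible_space_disc isomorphic_group_relative_homology_of_contractible)
  also have "subtopology (disc n) (disc_boundary n) = nsphere m"
    by (simp add: Suc subtopology_disc_boundary)
  also have "reduced_homology_group (int n - 1) (nsphere m) \<cong> integer_group"
    using reduced_homology_group_nsphere(1) [of m] by (simp add: Suc)
  finally show ?thesis .
qed

text \<open>As a simplification rule this would unfold units of homology groups into sets of chains.\<close>

declare one_relative_homology_group [simp del]

lemma exact_seq_kernel:
  "exact_seq ([G, H, K], [g, f]) \<Longrightarrow> kernel H G g = f ` carrier K"
  by simp

lemma (in comm_group) finprod_int_pow: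
  assumes "finite I" "f \<in> I \<rightarrow> carrier G"
  shows "finprod G f I [^] (k::int) = finprod G (\<lambda>i. f i [^] k) I"
  using assms by (induction) (auto simp: int_pow_distrib Pi_iff)

lemma hom_finprod_comm_group:
  assumes "comm_group G" "comm_group H" "\<phi> \<in> hom G H" "finite I" "f \<in> I \<rightarrow> carrier G"
  shows "\<phi> (finprod G f I) = finprod H (\<lambda>i. \<phi> (f i)) I"
proof -
  interpret G: comm_group G by fact
  interpret H: comm_group H by fact
  interpret group_hom G H \<phi>
    using assms by (simp add: group_hom_def group_hom_axioms_def G.group_axioms H.group_axioms)
  show ?thesis
    using assms(4,5) by (induction) (auto simp: Pi_iff)
qed

text \<open>The isomorphism \<open>h\<close> to the integers takes the value 1 at some power of
  \<open>x\<close>, with exponent \<open>j\<close> say. Then \<open>j * h x = 1\<close>, so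
  \<open>h x\<close> is non-zero and \<open>x\<close> has infinite order.\<close>

lemma infinite_cyclic_generator:
  assumes "G \<cong> integer_group" and o: "x \<in> carrier G" "generate G {x} = carrier G" and "group G"
  shows "y \<in> carrier G \<Longrightarrow> \<exists>k::int. y = x [^]\<^bsub>G\<^esub> k"
    and "x [^]\<^bsub>G\<^esub> (k::int) = \<one>\<^bsub>G\<^esub> \<Longrightarrow> k = 0"
proof -
  interpret group G by fact
  obtain h where h: "h \<in> iso G integer_group"
    using assms(1) by (auto simp: is_iso_def)
  interpret h: group_hom G integer_group h
    using h by (simp add: group_hom_def group_hom_axioms_def iso_def)
  have gen: "\<exists>k::int. y = x [^]\<^bsub>G\<^esub> k" if "y \<in> carrier G" for y
    using generate_pow [OF o(1)] o(2) that by auto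
  then show "y \<in> carrier G \<Longrightarrow> \<exists>k::int. y = x [^]\<^bsub>G\<^esub> k" .
  have "h ` carrier G = UNIV"
    using h by (auto simp: iso_def bij_betw_def)
  then obtain z where z: "z \<in> carrier G" "h z = 1"
    by (metis UNIV_I imageE)
  then obtain j :: int where j: "z = x [^]\<^bsub>G\<^esub> j"
    using gen by blast
  have pow: "h (x [^]\<^bsub>G\<^esub> (k::int)) = k * h x" for k
    using h.hom_int_pow [OF o(1), of k] by (simp add: mult.commute)
  then have "h x \<noteq> 0"
    using z j pow [of j] by auto
  then show "k = 0" if "x [^]\<^bsub>G\<^esub> (k::int) = \<one>\<^bsub>G\<^esub>"
    using pow [of k] that h.hom_one by simp
qed

section \<open>Cellular chain groups\<close>

text \<open>The space below dimension \<open>n\<close> with only the \<open>n\<close>-cells in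
  \<open>F\<close> attached. It interpolates between consecutive skeleta, so that cells can be added
  singly, and it is also the underlying space of \<open>subcomplex X n F\<close>.\<close>

definition layer :: "('a, 'c) cw_complex \<Rightarrow> nat \<Rightarrow> 'c set \<Rightarrow> 'a set" where
  "layer X n F = (\<Union>e \<in> {e \<in> cw_cells X. cw_dim X e < n} \<union> F. open_cell X e)"

abbreviation layer_space :: "('a, 'c) cw_complex \<Rightarrow> nat \<Rightarrow> 'c set \<Rightarrow> 'a topology" where
  "layer_space X n F \<equiv> subtopology (cw_space X) (layer X n F)"

abbreviation layer_homology :: "('a, 'c) cw_complex \<Rightarrow> nat \<Rightarrow> 'c set \<Rightarrow> 'a chain set monoid" where
  "layer_homology X n F \<equiv> relative_homology_group (int n) (layer_space X n F) (layer X n {})"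

text \<open>The class of a cell has to be formed in each layer separately, as the target group
  changes with \<open>F\<close>; \<open>cell_class\<close> is the case of all
  \<open>n\<close>-cells. The class on the disc stays an argument so that the homomorphism property
  can be used.\<close>

definition cell_map :: "('a, 'c) cw_complex \<Rightarrow> nat \<Rightarrow> 'c set \<Rightarrow> 'c \<Rightarrow> (nat \<Rightarrow> real) chain set \<Rightarrow> 'a chain set" where
  "cell_map X n F e = hom_induced (int n) (disc n) (disc_boundary n)
     (layer_space X n F) (layer X n {}) (cw_map X e)"

lemma layer_empty: "layer X n {} = skeleton X (int n - 1)"
proof -
  have "int k \<le> int n - 1 \<longleftrightarrow> k < n" for k by linarith
  then show ?thesis by (simp add: layer_def skeleton_def)
qed

lemma layer_cells: "layer X n (cells X n) = skeleton X (int n)"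
  by (force simp: layer_def skeleton_def cells_def)

lemma layer_mono: "F \<subseteq> F' \<Longrightarrow> layer X n F \<subseteq> layer X n F'"
  by (auto simp: layer_def)

locale cw =
  fixes X :: "('a, 'c) cw_complex"
  assumes cw: "finite_cw_complex X"
begin

lemma Hausdorff_cw_space: "Hausdorff_space (cw_space X)"
  and finite_cw_cells: "finite (cw_cells X)"
  and cw_map_continuous: "e \<in> cw_cells X \<Longrightarrow> continuous_map (disc (cw_dim X e)) (cw_space X) (cw_map X e)"
  and cw_map_inj: "e \<in> cw_cells X \<Longrightarrow> inj_on (cw_map X e) (disc_interior (cw_dim X e))"
  and cw_map_boundary: "e \<in> cw_cells X \<Longrightarrow> cw_map X e ` disc_boundary (cw_dim X e) \<subseteq> skeleton X (int (cw_dim X e) - 1)"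
  and open_cells_disjoint: "disjoint_family_on (open_cell X) (cw_cells X)"
  and open_cells_cover: "(\<Union>e \<in> cw_cells X. open_cell X e) = topspace (cw_space X)"
  and cw_orient_carrier: "e \<in> cw_cells X \<Longrightarrow> cw_orient X e \<in> carrier (disc_homology (cw_dim X e))"
  and cw_orient_generate: "e \<in> cw_cells X \<Longrightarrow> generate (disc_homology (cw_dim X e)) {cw_orient X e}
     = carrier (disc_homology (cw_dim X e))"
  using cw unfolding finite_cw_complex_def Let_def by auto

lemma finite_cells: "finite (cells X n)"
  using finite_cw_cells by (simp add: cells_def)

lemma open_cell_subset: "e \<in> cw_cells X \<Longrightarrow> open_cell X e \<subseteq> topspace (cw_space X)"
  using open_cells_cover by blast

lemma layer_subset: "F \<subseteq> cells X n \<Longrightarrow> layer X n F \<subseteq> topspace (cw_space X)"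
  using open_cell_subset by (auto simp: layer_def cells_def)

lemma cw_map_disc:
  assumes "e \<in> cw_cells X"
  shows "cw_map X e ` topspace (disc (cw_dim X e)) \<subseteq> open_cell X e \<union> layer X (cw_dim X e) {}"
  using cw_map_boundary [OF assms] by (auto simp: topspace_disc_split open_cell_def layer_empty)

text \<open>Boundaries of cells lie in lower cells, so the layer is also a finite union of images of
  full closed discs, each compact in a Hausdorff space.\<close>

lemma closedin_layer:
  assumes "F \<subseteq> cells X n"
  shows "closedin (cw_space X) (layer X n F)"
proof -
  let ?C = "{e \<in> cw_cells X. cw_dim X e < n} \<union> F"
  have C: "?C \<subseteq> cw_cells X" "finite ?C"
    using assms finite_cw_cells by (auto simp: cells_def intro: finite_subset)
  have *: "cw_map X e ` topspace (disc (cw_dim X e)) \<subseteq> layer X n F" if "e \<in> ?C" for e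
  proof -
    have "cw_dim X e \<le> n"
      using that assms by (auto simp: cells_def)
    then have "layer X (cw_dim X e) {} \<subseteq> layer X n F"
      by (auto simp: layer_def)
    moreover have "open_cell X e \<subseteq> layer X n F"
      using that by (auto simp: layer_def)
    ultimately show ?thesis
      using cw_map_disc [of e] that C by blast
  qed
  moreover have "open_cell X e \<subseteq> cw_map X e ` topspace (disc (cw_dim X e))" for e
    by (auto simp: open_cell_def topspace_disc_split)
  ultimately have "layer X n F = (\<Union>e\<in>?C. cw_map X e ` topspace (disc (cw_dim X e)))"
    unfolding layer_def by (intro equalityI UN_least UN_mono order_refl) simp_all
  moreover have "closedin (cw_space X) (cw_map X e ` topspace (disc (cw_dim X e)))" if "e \<in> ?C" for e
  proof (rule compactin_imp_closedin [OF Hausdorff_cw_space], rule image_compactin)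
    show "compactin (disc (cw_dim X e)) (topspace (disc (cw_dim X e)))"
      using compact_space_disc by (simp only: compact_space_def)
    show "continuous_map (disc (cw_dim X e)) (cw_space X) (cw_map X e)"
      using that C by (intro cw_map_continuous) blast
  qed
  ultimately show ?thesis
    using C(2) by (simp only:) (rule closedin_Union; blast)
qed

lemma attached_cell_layer:
  assumes F: "F \<subseteq> cells X n" and e: "e \<in> cells X n" "e \<notin> F"
  shows "attached_cell (layer_space X n (insert e F)) (layer X n F) n (cw_map X e)"
proof
  have n: "cw_dim X e = n" and e': "e \<in> cw_cells X"
    using e by (auto simp: cells_def)
  have F': "insert e F \<subseteq> cells X n"
    using F e by simp
  have sub: "layer X n F \<subseteq> layer X n (insert e F)"
    by (rule layer_mono) auto
  have top: "topspace (layer_space X n (insert e F)) = layer X n (insert e F)"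
    using layer_subset [OF F'] by auto
  show "Hausdorff_space (layer_space X n (insert e F))"
    by (simp add: Hausdorff_cw_space Hausdorff_space_subtopology)
  show "closedin (layer_space X n (insert e F)) (layer X n F)"
    using closedin_layer [OF F] sub closedin_subset_topspace by blast
  have "cw_map X e ` topspace (disc n) \<subseteq> layer X n (insert e F)"
    using cw_map_disc [OF e'] n by (auto simp: layer_def)
  then show "continuous_map (disc n) (layer_space X n (insert e F)) (cw_map X e)"
    using cw_map_continuous [OF e'] n by (auto simp: continuous_map_in_subtopology)
  show "inj_on (cw_map X e) (disc_interior n)"
    using cw_map_inj [OF e'] n by simp
  have "open_cell X e \<inter> open_cell X f = {}" if "f \<in> {e \<in> cw_cells X. cw_dim X e < n} \<union> F" for f
  proof -
    have "f \<in> cw_cells X" "f \<noteq> e"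
      using that e n F by (auto simp: cells_def)
    then show ?thesis
      using open_cells_disjoint e' by (simp add: disjoint_family_on_def)
  qed
  then have "open_cell X e \<inter> layer X n F = {}"
    by (auto simp: layer_def)
  then have "open_cell X e = layer X n (insert e F) - layer X n F"
    by (auto simp: layer_def)
  then show "cw_map X e ` disc_interior n = topspace (layer_space X n (insert e F)) - layer X n F"
    using n by (simp only: top open_cell_def)
  show "cw_map X e ` disc_boundary n \<subseteq> layer X n F"
    using cw_map_boundary [OF e'] n layer_mono [of "{}" F X n] by (auto simp: layer_empty)
qed

lemma cw_map_continuous_layer:
  assumes "F \<subseteq> cells X n" "e \<in> F"
  shows "continuous_map (disc n) (layer_space X n F) (cw_map X e)"
proof -
  interpret attached_cell "layer_space X n (insert e (F - {e}))" "layer X n (F - {e})" n "cw_map X e"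
    using assms by (intro attached_cell_layer) auto
  show ?thesis
    using cont assms by (simp add: insert_absorb)
qed

lemma cw_map_boundary_layer: "e \<in> cells X n \<Longrightarrow> cw_map X e \<in> disc_boundary n \<rightarrow> layer X n {}"
  using cw_map_boundary by (auto simp: cells_def layer_empty)

lemma orient_powers:
  assumes "e \<in> cells X n"
  shows "y \<in> carrier (disc_homology n) \<Longrightarrow>
      \<exists>k::int. y = cw_orient X e [^]\<^bsub>disc_homology n\<^esub> k"
    and "cw_orient X e [^]\<^bsub>disc_homology n\<^esub> (k::int) = \<one>\<^bsub>disc_homology n\<^esub> \<Longrightarrow> k = 0"
  using infinite_cyclic_generator [OF disc_homology_integer_group, of "cw_orient X e" n] cw_orient_carrier cw_orient_generate assms
  unfolding cells_def by auto

text \<open>Induction along the exact sequence of the triple of layers for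
  \<open>insert e F\<close>, \<open>F\<close> and the empty set. The relative group of the two
  larger layers is generated by the new cell, so dividing by a power of its class moves
  \<open>x\<close> into the image of the smaller layer.\<close>

lemma layer_homology_generated:
  assumes "finite F" "F \<subseteq> cells X n"
    and "x \<in> carrier (layer_homology X n F)"
  shows "\<exists>c :: 'c \<Rightarrow> int. x = finprod (layer_homology X n F)
     (\<lambda>e. cell_map X n F e (cw_orient X e) [^]\<^bsub>layer_homology X n F\<^esub> c e) F"
  using assms
proof (induction F arbitrary: x)
  case empty
  have "trivial_group (layer_homology X n {})"
    using trivial_relative_homology_group_topspace [of "int n" "layer_space X n {}"]
      layer_subset [of "{}" n] by (simp add: Int_absorb1)
  then show ?case
    using empty by (simp add: trivial_group_def comm_monoid.finprod_empty comm_group.axioms)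
next
  case (insert e F)
  let ?A = "layer X n {}"
  let ?YF = "layer_space X n F" and ?Y = "layer_space X n (insert e F)"
  let ?GF = "relative_homology_group (int n) ?YF ?A" and ?G = "relative_homology_group (int n) ?Y ?A"
  let ?Q = "relative_homology_group (int n) ?Y (layer X n F)"
  let ?D = "disc_homology n"
  let ?i = "hom_induced (int n) ?YF ?A ?Y ?A id" and ?j = "hom_induced (int n) ?Y ?A ?Y (layer X n F) id"
  interpret G: comm_group ?G by simp
  interpret GF: comm_group ?GF by simp
  interpret Q: comm_group ?Q by simp
  have e: "e \<in> cells X n" "F \<subseteq> cells X n" using insert by auto
  interpret att: attached_cell ?Y "layer X n F" n "cw_map X e"
    using insert e by (intro attached_cell_layer) auto
  have sub: "layer X n F \<subseteq> layer X n (insert e F)" "?A \<subseteq> layer X n F"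
    by (intro layer_mono; auto)+
  have sub2: "subtopology ?Y (layer X n F) = ?YF"
    using sub by (simp add: subtopology_subtopology Int_absorb1)
  have ex: "kernel ?G ?Q ?j = ?i ` carrier ?GF"
    using exact_seq_kernel [OF homology_exactness_triple_3 [OF sub(2), of "int n" ?Y]] by (simp only: sub2)
  have contY: "continuous_map (disc n) ?Y (cw_map X f)" if "f \<in> insert e F" for f
    using insert.prems that by (intro cw_map_continuous_layer)
  have contYF: "continuous_map (disc n) ?YF (cw_map X f)" if "f \<in> F" for f
    using e that by (intro cw_map_continuous_layer)
  have idc: "continuous_map ?YF ?Y id"
    using sub continuous_map_id_subt sub2 by metis
  have jhom: "?j \<in> hom ?G ?Q" and ihom: "?i \<in> hom ?GF ?G"
    by (simp_all add: hom_induced_hom)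
  have iota: "?i (cell_map X n F f (cw_orient X f)) = cell_map X n (insert e F) f (cw_orient X f)" if "f \<in> F" for f
    unfolding cell_map_def using contYF [OF that] idc cw_map_boundary_layer that e
    by (subst hom_induced_compose') auto
  have je: "?j (cell_map X n (insert e F) e z) = hom_induced (int n) (disc n) (disc_boundary n) ?Y (layer X n F) (cw_map X e) z" for z
    unfolding cell_map_def using contY cw_map_boundary_layer e sub
    by (subst hom_induced_compose') auto
  have carr: "cell_map X n (insert e F) f z \<in> carrier ?G" "cell_map X n F f z \<in> carrier ?GF" for f z
    by (simp_all add: cell_map_def hom_induced_carrier)
  \<comment> \<open>The isomorphism for the attached cell lifts the image of \<open>x\<close> in the
    relative group to the disc, where it is a power of the orientation of \<open>e\<close>; the
    exponent is the coefficient at \<open>e\<close>.\<close>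
  obtain z where z: "z \<in> carrier ?D" "?j x = hom_induced (int n) (disc n) (disc_boundary n) ?Y (layer X n F) (cw_map X e) z"
    using att.iso_hom_induced [of "int n"] hom_induced_carrier [of "int n" ?Y ?A ?Y "layer X n F" id x]
    unfolding iso_def bij_betw_def by blast
  obtain k :: int where k: "z = cw_orient X e [^]\<^bsub>?D\<^esub> k"
    using orient_powers(1) [OF e(1) z(1)] by blast
  let ?u = "cell_map X n (insert e F) e (cw_orient X e)"
  have oc: "cw_orient X e \<in> carrier ?D"
    using cw_orient_carrier e by (auto simp: cells_def)
  have hom_e: "hom_induced (int n) (disc n) (disc_boundary n) ?Y ?A (cw_map X e) \<in> hom ?D ?G"
    by (simp add: hom_induced_hom)
  have "?j x = ?j (cell_map X n (insert e F) e z)"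
    using z je by simp
  also have "cell_map X n (insert e F) e z = ?u [^]\<^bsub>?G\<^esub> k"
    unfolding cell_map_def k by (rule hom_int_pow [OF hom_e oc]) simp_all
  finally have jx: "?j x = ?j (?u [^]\<^bsub>?G\<^esub> k)" .
  have x: "x \<in> carrier ?G" by fact
  interpret j: group_hom ?G ?Q ?j
    using jhom by (simp add: group_hom_def group_hom_axioms_def)
  have "x \<otimes>\<^bsub>?G\<^esub> inv\<^bsub>?G\<^esub> (?u [^]\<^bsub>?G\<^esub> k) \<in> kernel ?G ?Q ?j"
    using x carr jx by (simp add: kernel_def)
  then obtain w where w: "w \<in> carrier ?GF" "x \<otimes>\<^bsub>?G\<^esub> inv\<^bsub>?G\<^esub> (?u [^]\<^bsub>?G\<^esub> k) = ?i w"
    using ex by auto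
  then obtain c :: "'c \<Rightarrow> int" where c: "w = finprod ?GF (\<lambda>f. cell_map X n F f (cw_orient X f) [^]\<^bsub>?GF\<^esub> c f) F"
    using insert.IH e by blast
  have "?i w = finprod ?G (\<lambda>f. ?i (cell_map X n F f (cw_orient X f) [^]\<^bsub>?GF\<^esub> c f)) F"
    unfolding c using carr insert.hyps by (intro hom_finprod_comm_group ihom) auto
  also have "\<dots> = finprod ?G (\<lambda>f. cell_map X n (insert e F) f (cw_orient X f) [^]\<^bsub>?G\<^esub> (c(e := k)) f) F"
  proof (rule G.finprod_cong')
    fix f assume f: "f \<in> F"
    then have "?i (cell_map X n F f (cw_orient X f) [^]\<^bsub>?GF\<^esub> c f) = cell_map X n (insert e F) f (cw_orient X f) [^]\<^bsub>?G\<^esub> c f"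
      by (simp add: hom_int_pow [OF ihom carr(2)] iota)
    then show "?i (cell_map X n F f (cw_orient X f) [^]\<^bsub>?GF\<^esub> c f) = cell_map X n (insert e F) f (cw_orient X f) [^]\<^bsub>?G\<^esub> (c(e := k)) f"
      using f insert.hyps by auto
  qed (use carr in auto)
  finally have iw: "?i w = finprod ?G (\<lambda>f. cell_map X n (insert e F) f (cw_orient X f) [^]\<^bsub>?G\<^esub> (c(e := k)) f) F" .
  have "x = ?u [^]\<^bsub>?G\<^esub> k \<otimes>\<^bsub>?G\<^esub> ?i w"
    using x carr w(2) by (metis G.int_pow_closed G.inv_closed G.inv_solve_right G.m_closed G.m_comm)
  then have "x = finprod ?G (\<lambda>f. cell_map X n (insert e F) f (cw_orient X f) [^]\<^bsub>?G\<^esub> (c(e := k)) f) (insert e F)"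
    unfolding iw using insert.hyps carr by (subst G.finprod_insert) auto
  then show ?case
    by blast
qed

text \<open>Working relative to all cells but \<open>f\<close> kills every other cell class and
  keeps that of \<open>f\<close>, which has infinite order there.\<close>

lemma layer_homology_independent:
  fixes c :: "'c \<Rightarrow> int"
  assumes F: "F \<subseteq> cells X n" and f: "f \<in> F"
    and one: "finprod (layer_homology X n F)
     (\<lambda>e. cell_map X n F e (cw_orient X e) [^]\<^bsub>layer_homology X n F\<^esub> c e) F
      = \<one>\<^bsub>layer_homology X n F\<^esub>"
  shows "c f = 0"
proof -
  let ?A = "layer X n {}" and ?F = "F - {f}"
  let ?YF = "layer_space X n ?F" and ?Y = "layer_space X n F"
  let ?G = "relative_homology_group (int n) ?Y ?A"
  let ?Q = "relative_homology_group (int n) ?Y (layer X n ?F)"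
  let ?D = "disc_homology n"
  let ?j = "hom_induced (int n) ?Y ?A ?Y (layer X n ?F) id"
  let ?k = "\<lambda>e. hom_induced (int n) (disc n) (disc_boundary n) ?Y (layer X n ?F) (cw_map X e)"
  interpret Q: comm_group ?Q by simp
  interpret D: comm_group ?D by simp
  have finF: "finite F"
    using F finite_cells finite_subset by blast
  have ins: "insert f ?F = F" using f by blast
  interpret att: attached_cell ?Y "layer X n ?F" n "cw_map X f"
    using attached_cell_layer [of ?F n f] F f ins by (auto simp: insert_absorb)
  have sub: "?A \<subseteq> layer X n ?F" "layer X n ?F \<subseteq> layer X n F"
    by (intro layer_mono; auto)+
  have jhom: "?j \<in> hom ?G ?Q"
    by (simp add: hom_induced_hom)
  have carr: "cell_map X n F e z \<in> carrier ?G" for e z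
    by (simp add: cell_map_def hom_induced_carrier)
  have contY: "continuous_map (disc n) ?Y (cw_map X e)" if "e \<in> F" for e
    using F that by (intro cw_map_continuous_layer)
  have je: "?j (cell_map X n F e z) = ?k e z" if "e \<in> F" for e z
    unfolding cell_map_def using contY [OF that] cw_map_boundary_layer [of e n] that F sub
    by (subst hom_induced_compose') auto
  \<comment> \<open>The map of any other cell factors through a pair whose subspace is the whole
    space, and such a relative group is trivial.\<close>
  have triv: "?k e z = \<one>\<^bsub>?Q\<^esub>" if "e \<in> ?F" for e z
  proof -
    let ?T = "relative_homology_group (int n) ?YF (layer X n ?F)"
    have "trivial_group ?T"
      using trivial_relative_homology_group_topspace [of "int n" ?YF]
        layer_subset [of ?F n] F by (simp add: Int_absorb1 subset_iff)
    then have "hom_induced (int n) (disc n) (disc_boundary n) ?YF (layer X n ?F) (cw_map X e) z = \<one>\<^bsub>?T\<^esub>"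
      by (metis hom_induced_carrier singletonD trivial_group_def)
    moreover have "?k e z = hom_induced (int n) ?YF (layer X n ?F) ?Y (layer X n ?F) id
      (hom_induced (int n) (disc n) (disc_boundary n) ?YF (layer X n ?F) (cw_map X e) z)"
    proof (subst hom_induced_compose')
      show "continuous_map (disc n) ?YF (cw_map X e)"
        using F that by (intro cw_map_continuous_layer) auto
      show "continuous_map ?YF ?Y id"
        using sub(2) by (auto simp: continuous_map_in_subtopology layer_subset)
      show "cw_map X e \<in> disc_boundary n \<rightarrow> layer X n ?F"
        using cw_map_boundary_layer [of e n] that F sub by blast
    qed auto
    ultimately show ?thesis
      by (simp add: hom_one [OF hom_induced_hom])
  qed
  have "\<one>\<^bsub>?Q\<^esub> = ?j (finprod ?G (\<lambda>e. cell_map X n F e (cw_orient X e) [^]\<^bsub>?G\<^esub> c e) F)"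
    by (simp add: one hom_one [OF jhom])
  also have "\<dots> = finprod ?Q (\<lambda>e. ?j (cell_map X n F e (cw_orient X e) [^]\<^bsub>?G\<^esub> c e)) F"
    using carr finF by (intro hom_finprod_comm_group jhom) (auto intro!: group.int_pow_closed)
  also have "\<dots> = finprod ?Q (\<lambda>e. if e = f then ?k f (cw_orient X f) [^]\<^bsub>?Q\<^esub> c f else \<one>\<^bsub>?Q\<^esub>) F"
  proof (rule Q.finprod_cong')
    fix e assume e: "e \<in> F"
    have "?j (cell_map X n F e (cw_orient X e) [^]\<^bsub>?G\<^esub> c e) = ?k e (cw_orient X e) [^]\<^bsub>?Q\<^esub> c e"
      by (simp add: hom_int_pow [OF jhom carr] je [OF e])
    then show "?j (cell_map X n F e (cw_orient X e) [^]\<^bsub>?G\<^esub> c e) = (if e = f then ?k f (cw_orient X f) [^]\<^bsub>?Q\<^esub> c f else \<one>\<^bsub>?Q\<^esub>)"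
      using e triv by auto
  qed (auto simp: hom_induced_carrier)
  also have "\<dots> = ?k f (cw_orient X f) [^]\<^bsub>?Q\<^esub> c f"
    using Q.finprod_singleton [OF f finF, of "\<lambda>_. ?k f (cw_orient X f) [^]\<^bsub>?Q\<^esub> c f"]
    by (simp add: hom_induced_carrier eq_commute [of _ f])
  also have "\<dots> = ?k f (cw_orient X f [^]\<^bsub>?D\<^esub> c f)"
  proof -
    have "cw_orient X f \<in> carrier ?D"
      using cw_orient_carrier F f by (auto simp: cells_def)
    then show ?thesis
      by (simp add: hom_int_pow [OF hom_induced_hom])
  qed
  finally have "?k f (cw_orient X f [^]\<^bsub>?D\<^esub> c f) = ?k f \<one>\<^bsub>?D\<^esub>"
    by (simp add: hom_one [OF hom_induced_hom])
  moreover have "inj_on (?k f) (carrier ?D)"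
    using att.iso_hom_induced [of "int n"] by (simp add: iso_def bij_betw_def)
  moreover have "cw_orient X f \<in> carrier ?D"
    using cw_orient_carrier F f by (auto simp: cells_def)
  ultimately have "cw_orient X f [^]\<^bsub>?D\<^esub> c f = \<one>\<^bsub>?D\<^esub>"
    by (simp add: inj_on_def)
  then show ?thesis
    using orient_powers(2) F f by blast
qed

end

text \<open>Interchange of two finite sums in multiplicative notation; it collects the terms of a
  double boundary into one combination of basis elements.\<close>

lemma (in comm_group) finprod_int_pow_sum:
  assumes "finite I" "finite J" "b \<in> J \<rightarrow> carrier G"
  shows "finprod G (\<lambda>i. finprod G (\<lambda>j. b j [^] (m j i :: int)) J) I = finprod G (\<lambda>j. b j [^] (\<Sum>i\<in>I. m j i)) J"
  using assms(1)
proof induction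
  case empty
  then show ?case by (simp add: finprod_one_eqI)
next
  case (insert i I)
  have "finprod G (\<lambda>j. b j [^] m j i) J \<otimes> finprod G (\<lambda>j. b j [^] (\<Sum>i\<in>I. m j i)) J
     = finprod G (\<lambda>j. b j [^] m j i \<otimes> b j [^] (\<Sum>i\<in>I. m j i)) J"
    using assms by (intro finprod_multf [symmetric]) (auto simp: Pi_iff)
  also have "\<dots> = finprod G (\<lambda>j. b j [^] (\<Sum>i\<in>insert i I. m j i)) J"
    using assms insert by (intro finprod_cong') (auto simp: Pi_iff int_pow_mult)
  finally show ?case
    using insert assms by (subst finprod_insert) (auto simp: Pi_iff)
qed

section \<open>The basis of cell classes, incidence numbers and the cellular boundary\<close>

context cw
begin

lemma cellular_group_eq:
  "cellular_group X n = layer_homology X n (cells X n)"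
  by (simp add: cellular_group_def layer_cells layer_empty)

lemma cell_class_eq: "e \<in> cells X n \<Longrightarrow> cell_class X e = cell_map X n (cells X n) e (cw_orient X e)"
  unfolding cell_class_def cell_map_def Let_def layer_cells layer_empty by (simp add: cells_def)

lemma comm_group_cellular_group: "comm_group (cellular_group X n)"
  by (simp add: cellular_group_def)

lemma cell_class_carrier: "e \<in> cells X n \<Longrightarrow> cell_class X e \<in> carrier (cellular_group X n)"
  by (simp add: cell_class_eq cell_map_def cellular_group_eq hom_induced_carrier)

lemma cellular_group_generated:
  assumes "x \<in> carrier (cellular_group X n)"
  shows "\<exists>c :: 'c \<Rightarrow> int. x = finprod (cellular_group X n) (\<lambda>e. cell_class X e [^]\<^bsub>cellular_group X n\<^esub> c e) (cells X n)"
proof -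
  interpret comm_group "cellular_group X n" by (rule comm_group_cellular_group)
  obtain c :: "'c \<Rightarrow> int" where c: "x = finprod (cellular_group X n)
      (\<lambda>e. cell_map X n (cells X n) e (cw_orient X e) [^]\<^bsub>cellular_group X n\<^esub> c e) (cells X n)"
    using layer_homology_generated [OF finite_cells order_refl] assms unfolding cellular_group_eq by blast
  show ?thesis
    unfolding c by (intro exI [of _ c] finprod_cong') (auto simp: cell_class_eq [symmetric] cell_class_carrier)
qed

lemma cellular_group_independent:
  fixes c :: "'c \<Rightarrow> int"
  assumes "finprod (cellular_group X n) (\<lambda>e. cell_class X e [^]\<^bsub>cellular_group X n\<^esub> c e) (cells X n) = \<one>\<^bsub>cellular_group X n\<^esub>"
    and "f \<in> cells X n"
  shows "c f = 0"
proof -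
  interpret comm_group "cellular_group X n" by (rule comm_group_cellular_group)
  have "finprod (cellular_group X n) (\<lambda>e. cell_class X e [^]\<^bsub>cellular_group X n\<^esub> c e) (cells X n)
    = finprod (cellular_group X n) (\<lambda>e. cell_map X n (cells X n) e (cw_orient X e) [^]\<^bsub>cellular_group X n\<^esub> c e) (cells X n)"
    by (intro finprod_cong') (auto simp: cell_class_eq [symmetric] cell_class_carrier)
  then show ?thesis
    using layer_homology_independent [OF order_refl assms(2), of c] assms(1) unfolding cellular_group_eq by simp
qed

text \<open>The definite description in \<open>incidence\<close> requires this uniqueness of
  coordinates; it is independence applied to the difference of the coefficients.\<close>

lemma cellular_group_unique:
  fixes c c' :: "'c \<Rightarrow> int"
  assumes "finprod (cellular_group X n) (\<lambda>e. cell_class X e [^]\<^bsub>cellular_group X n\<^esub> c e) (cells X n)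
         = finprod (cellular_group X n) (\<lambda>e. cell_class X e [^]\<^bsub>cellular_group X n\<^esub> c' e) (cells X n)"
    and f: "f \<in> cells X n"
  shows "c f = c' f"
proof -
  interpret comm_group "cellular_group X n" by (rule comm_group_cellular_group)
  let ?P = "\<lambda>c :: 'c \<Rightarrow> int. finprod (cellular_group X n) (\<lambda>e. cell_class X e [^]\<^bsub>cellular_group X n\<^esub> c e) (cells X n)"
  have add: "?P (\<lambda>e. a e + b e) = ?P a \<otimes>\<^bsub>cellular_group X n\<^esub> ?P b" for a b
  proof -
    have "?P (\<lambda>e. a e + b e) = finprod (cellular_group X n)
       (\<lambda>e. cell_class X e [^]\<^bsub>cellular_group X n\<^esub> a e \<otimes>\<^bsub>cellular_group X n\<^esub> cell_class X e [^]\<^bsub>cellular_group X n\<^esub> b e) (cells X n)"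
      by (intro finprod_cong') (simp_all add: cell_class_carrier int_pow_mult Pi_iff)
    also have "\<dots> = ?P a \<otimes>\<^bsub>cellular_group X n\<^esub> ?P b"
      by (rule finprod_multf) (simp_all add: cell_class_carrier Pi_iff)
    finally show ?thesis .
  qed
  have "?P (\<lambda>e. c e + - c' e) = ?P (\<lambda>e. c' e + - c' e)"
    by (simp only: add assms)
  also have "\<dots> = \<one>\<^bsub>cellular_group X n\<^esub>"
    by (intro finprod_one_eqI) simp
  finally show ?thesis
    using cellular_group_independent [of n "\<lambda>e. c e + - c' e" f] f by simp
qed

lemma subtopology_skeleton_mono:
  "i \<le> j \<Longrightarrow> subtopology (subtopology (cw_space X) (skeleton X j)) (skeleton X i) = subtopology (cw_space X) (skeleton X i)"
proof -
  assume "i \<le> j"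
  then have "skeleton X j \<inter> skeleton X i = skeleton X i"
    by (force simp: skeleton_def)
  then show ?thesis
    by (simp add: subtopology_subtopology)
qed

lemma cellular_boundary_hom_in_hom:
  "cellular_boundary_hom X (Suc n) \<in> hom (cellular_group X (Suc n)) (cellular_group X n)"
  using group_homomorphism_hom_relboundary [of "int (Suc n)" "subtopology (cw_space X) (skeleton X (int (Suc n)))"
      "skeleton X (int (Suc n) - 1)" "skeleton X (int (Suc n) - 2)"]
    subtopology_skeleton_mono [of "int n" "1 + int n"]
  by (simp add: cellular_boundary_hom_def cellular_group_def)

text \<open>The composite contains two consecutive maps of the long exact sequence of the pair of
  skeleta in dimensions \<open>n + 1\<close> and \<open>n\<close>: the map to relative homology,
  followed by its boundary.\<close>

lemma cellular_boundary_boundary: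
  assumes "x \<in> carrier (cellular_group X (Suc (Suc n)))"
  shows "cellular_boundary_hom X (Suc n) (cellular_boundary_hom X (Suc (Suc n)) x) = \<one>\<^bsub>cellular_group X n\<^esub>"
proof -
  let ?Y2 = "subtopology (cw_space X) (skeleton X (2 + int n))"
  let ?Y1 = "subtopology (cw_space X) (skeleton X (1 + int n))"
  let ?Y0 = "subtopology (cw_space X) (skeleton X (int n))"
  let ?S1 = "skeleton X (1 + int n)" and ?S0 = "skeleton X (int n)" and ?U = "skeleton X (int n - 1)"
  have sub: "subtopology ?Y2 ?S1 = ?Y1" "subtopology ?Y1 ?S0 = ?Y0"
    by (rule subtopology_skeleton_mono, simp)+
  let ?b = "hom_boundary (2 + int n) ?Y2 ?S1 x"
  have "?b \<in> carrier (homology_group (1 + int n) ?Y1)"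
    using hom_boundary_carrier [of "2 + int n" ?Y2 ?S1 x] sub by simp
  then have "hom_induced (1 + int n) ?Y1 {} ?Y1 ?S0 id ?b
      \<in> kernel (relative_homology_group (1 + int n) ?Y1 ?S0) (homology_group (int n) ?Y0) (hom_boundary (1 + int n) ?Y1 ?S0)"
    using exact_seq_kernel [OF homology_exactness_axiom_1 [of "1 + int n" ?Y1 ?S0]] sub by simp
  then have "hom_boundary (1 + int n) ?Y1 ?S0 (hom_induced (1 + int n) ?Y1 {} ?Y1 ?S0 id ?b) = \<one>\<^bsub>homology_group (int n) ?Y0\<^esub>"
    by (simp add: kernel_def)
  moreover have "cellular_boundary_hom X (Suc n) (cellular_boundary_hom X (Suc (Suc n)) x)
     = hom_induced (int n) ?Y0 {} ?Y0 ?U id (hom_boundary (1 + int n) ?Y1 ?S0 (hom_induced (1 + int n) ?Y1 {} ?Y1 ?S0 id ?b))"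
    by (simp add: cellular_boundary_hom_def hom_relboundary_def sub)
  ultimately show ?thesis
    by (simp add: cellular_group_def hom_one [OF hom_induced_hom])
qed

text \<open>Existence and uniqueness of coordinates resolve the definite description. Only the
  values at \<open>n\<close>-cells are pinned down, and the product ranges over just these.\<close>

lemma cellular_boundary_cell_class:
  assumes e: "e \<in> cells X (Suc n)"
  shows "cellular_boundary_hom X (Suc n) (cell_class X e) =
    finprod (cellular_group X n) (\<lambda>f. cell_class X f [^]\<^bsub>cellular_group X n\<^esub> incidence X f e) (cells X n)"
proof -
  interpret comm_group "cellular_group X n" by (rule comm_group_cellular_group)
  have "cellular_boundary_hom X (Suc n) (cell_class X e) \<in> carrier (cellular_group X n)"
    using cellular_boundary_hom_in_hom cell_class_carrier [OF e] by (rule hom_in_carrier)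
  then obtain c :: "'c \<Rightarrow> int" where c: "cellular_boundary_hom X (Suc n) (cell_class X e) =
     finprod (cellular_group X n) (\<lambda>f. cell_class X f [^]\<^bsub>cellular_group X n\<^esub> c f) (cells X n)"
    using cellular_group_generated by blast
  have inc: "incidence X f e = c f" if f: "f \<in> cells X n" for f
  proof -
    have "incidence X f e = (THE m. \<exists>c :: 'c \<Rightarrow> int. c f = m \<and>
             cellular_boundary_hom X (Suc n) (cell_class X e) =
             finprod (cellular_group X n) (\<lambda>g. cell_class X g [^]\<^bsub>cellular_group X n\<^esub> c g) (cells X n))"
      using e f by (simp add: incidence_def cells_def)
    also have "\<dots> = c f"
      using c cellular_group_unique [OF _ f] by (intro the_equality) auto
    finally show ?thesis .
  qed
  show ?thesis
    unfolding c by (intro finprod_cong') (auto simp: inc cell_class_carrier)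
qed

text \<open>The double boundary of the class of \<open>e\<close> is trivial; expanded in the basis
  of \<open>n\<close>-cells, its coefficient at \<open>g\<close> is this sum.\<close>

lemma incidence_compose:
  assumes e: "e \<in> cells X (Suc (Suc n))" and g: "g \<in> cells X n"
  shows "(\<Sum>f\<in>cells X (Suc n). incidence X g f * incidence X f e) = 0"
proof -
  let ?G = "cellular_group X n" and ?G1 = "cellular_group X (Suc n)"
  let ?d = "cellular_boundary_hom X (Suc n)"
  interpret comm_group ?G by (rule comm_group_cellular_group)
  have hom: "?d \<in> hom ?G1 ?G"
    by (rule cellular_boundary_hom_in_hom)
  interpret G1: comm_group ?G1 by (rule comm_group_cellular_group)
  have fin: "finprod ?G (\<lambda>g. cell_class X g [^]\<^bsub>?G\<^esub> incidence X g f) (cells X n) \<in> carrier ?G" for f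
    by (intro finprod_closed) (auto simp: cell_class_carrier)
  have "\<one>\<^bsub>?G\<^esub> = ?d (finprod ?G1 (\<lambda>f. cell_class X f [^]\<^bsub>?G1\<^esub> incidence X f e) (cells X (Suc n)))"
    using cellular_boundary_boundary [OF cell_class_carrier [OF e]] cellular_boundary_cell_class [OF e] by simp
  also have "\<dots> = finprod ?G (\<lambda>f. ?d (cell_class X f [^]\<^bsub>?G1\<^esub> incidence X f e)) (cells X (Suc n))"
    by (intro hom_finprod_comm_group hom comm_group_cellular_group finite_cells) (auto simp: cell_class_carrier)
  also have "\<dots> = finprod ?G (\<lambda>f. finprod ?G (\<lambda>g. cell_class X g [^]\<^bsub>?G\<^esub> (incidence X g f * incidence X f e)) (cells X n)) (cells X (Suc n))"
  proof (intro finprod_cong' refl)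
    fix f assume f: "f \<in> cells X (Suc n)"
    have "?d (cell_class X f [^]\<^bsub>?G1\<^esub> incidence X f e) = ?d (cell_class X f) [^]\<^bsub>?G\<^esub> incidence X f e"
      by (rule hom_int_pow [OF hom cell_class_carrier [OF f]]) (simp_all add: G1.group_axioms group_axioms)
    also have "\<dots> = finprod ?G (\<lambda>g. (cell_class X g [^]\<^bsub>?G\<^esub> incidence X g f) [^]\<^bsub>?G\<^esub> incidence X f e) (cells X n)"
      unfolding cellular_boundary_cell_class [OF f] by (intro finprod_int_pow finite_cells) (auto simp: cell_class_carrier)
    also have "\<dots> = finprod ?G (\<lambda>g. cell_class X g [^]\<^bsub>?G\<^esub> (incidence X g f * incidence X f e)) (cells X n)"
      by (intro finprod_cong') (auto simp: cell_class_carrier int_pow_pow)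
    finally show "?d (cell_class X f [^]\<^bsub>?G1\<^esub> incidence X f e) = \<dots>" .
  qed (auto intro!: finprod_closed simp: cell_class_carrier)
  also have "\<dots> = finprod ?G (\<lambda>g. cell_class X g [^]\<^bsub>?G\<^esub> (\<Sum>f\<in>cells X (Suc n). incidence X g f * incidence X f e)) (cells X n)"
    by (intro finprod_int_pow_sum finite_cells) (auto simp: cell_class_carrier)
  finally have "\<one>\<^bsub>?G\<^esub> = \<dots>" .
  from this [symmetric] g show ?thesis
    by (rule cellular_group_independent)
qed

text \<open>By naturality the boundary is computed on the sphere and pushed forward by the attaching
  map. The right-hand side does not involve \<open>F\<close>, so a cell has the same boundary in a
  subcomplex as in the whole complex.\<close>

lemma relboundary_cell_map:
  assumes "F \<subseteq> cells X n" "e \<in> F"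
  shows "hom_relboundary (int n) (layer_space X n F) (layer X n {}) V (cell_map X n F e z)
    = hom_induced (int n - 1) (subtopology (disc n) (disc_boundary n)) {} (layer_space X n {}) V (cw_map X e)
       (hom_relboundary (int n) (disc n) (disc_boundary n) {} z)"
proof -
  let ?Y = "layer_space X n F"
  have "layer X n F \<inter> layer X n {} = layer X n {}"
    using layer_mono [of "{}" F X n] by auto
  then have sub: "subtopology ?Y (layer X n {}) = layer_space X n {}"
    by (simp add: subtopology_subtopology)
  have "hom_relboundary (int n) ?Y (layer X n {}) V \<circ> hom_induced (int n) (disc n) (disc_boundary n) ?Y (layer X n {}) (cw_map X e)
    = hom_induced (int n - 1) (subtopology (disc n) (disc_boundary n)) {} (subtopology ?Y (layer X n {})) V (cw_map X e)
      \<circ> hom_relboundary (int n) (disc n) (disc_boundary n) {}"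
    using assms by (intro naturality_hom_induced_relboundary cw_map_continuous_layer cw_map_boundary_layer) auto
  then show ?thesis
    unfolding sub cell_map_def by (metis comp_apply)
qed

end

section \<open>Subcomplexes\<close>

locale cw_subcomplex = cw X for X :: "('a, 'c) cw_complex" +
  fixes k :: nat and T :: "'c set"
  assumes T: "T \<subseteq> cells X k"
begin

abbreviation "X' \<equiv> subcomplex X k T"

lemma subcomplex_simps [simp]:
  "cw_space X' = layer_space X k T"
  "cw_cells X' = T \<union> {e \<in> cw_cells X. cw_dim X e < k}"
  "cw_dim X' = cw_dim X" "cw_map X' = cw_map X" "cw_orient X' = cw_orient X"
  by (simp_all add: subcomplex_def Let_def layer_def Un_commute)

lemma subcomplex_cells:
  "n < k \<Longrightarrow> cells X' n = cells X n" "cells X' k = T" "n > k \<Longrightarrow> cells X' n = {}"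
  using T by (auto simp: cells_def)

lemma open_cell_subcomplex [simp]: "open_cell X' = open_cell X"
  by (simp add: fun_eq_iff open_cell_def)

lemma skeleton_subcomplex: "j < int k \<Longrightarrow> skeleton X' j = skeleton X j"
  using T by (force simp: skeleton_def cells_def)

lemma skeleton_subcomplex_top: "skeleton X' (int k) = layer X k T"
  using T by (force simp: skeleton_def cells_def layer_def)

lemma skeleton_space: "j < int k \<Longrightarrow> subtopology (cw_space X') (skeleton X j) = subtopology (cw_space X) (skeleton X j)"
proof -
  assume j: "j < int k"
  then have "skeleton X j \<subseteq> layer X k T"
    by (auto simp: skeleton_def layer_def)
  then have "layer X k T \<inter> skeleton X j = skeleton X j"
    by auto
  then show ?thesis
    by (simp add: subtopology_subtopology)
qed

lemma cellular_group_subcomplex: "n < k \<Longrightarrow> cellular_group X' n = cellular_group X n"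
  unfolding cellular_group_def by (simp add: skeleton_space skeleton_subcomplex del: subcomplex_simps(1))

lemma cell_class_subcomplex: "cw_dim X e < k \<Longrightarrow> cell_class X' e = cell_class X e"
  unfolding cell_class_def by (simp add: skeleton_space skeleton_subcomplex del: subcomplex_simps(1))

lemma boundary_subcomplex:
  assumes "e \<in> cw_cells X'"
  shows "cellular_boundary_hom X' (cw_dim X e) (cell_class X' e) = cellular_boundary_hom X (cw_dim X e) (cell_class X e)"
proof (cases "cw_dim X e < k")
  case True
  then show ?thesis
    unfolding cell_class_subcomplex [OF True] cellular_boundary_hom_def
    by (simp add: skeleton_space skeleton_subcomplex del: subcomplex_simps(1))
next
  \<comment> \<open>For a cell of top dimension \<open>k\<close> the two classes live in relative
    groups of different layers, so only their boundaries can be compared.\<close>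
  case False
  then have e: "e \<in> T" "cw_dim X e = k" "e \<in> cells X k"
    using assms T by (auto simp: cells_def)
  have sp: "subtopology (cw_space X') (skeleton X' (int k)) = layer_space X k T"
    by (simp add: skeleton_subcomplex_top subtopology_subtopology)
  have "cell_class X' e = cell_map X k T e (cw_orient X e)"
    unfolding cell_class_def cell_map_def Let_def layer_empty using sp e
    by (simp add: skeleton_subcomplex del: subcomplex_simps(1))
  then have "cellular_boundary_hom X' k (cell_class X' e)
     = hom_relboundary (int k) (layer_space X k T) (layer X k {}) (skeleton X (int k - 2)) (cell_map X k T e (cw_orient X e))"
    unfolding cellular_boundary_hom_def sp by (simp add: skeleton_subcomplex layer_empty)
  also have "\<dots> = hom_relboundary (int k) (layer_space X k (cells X k)) (layer X k {}) (skeleton X (int k - 2)) (cell_map X k (cells X k) e (cw_orient X e))"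
    using relboundary_cell_map [OF T e(1)] relboundary_cell_map [OF order_refl e(3)] by simp
  also have "\<dots> = cellular_boundary_hom X k (cell_class X e)"
    by (simp add: cellular_boundary_hom_def cell_class_eq [OF e(3)] layer_empty layer_cells)
  finally show ?thesis
    using e by simp
qed

text \<open>For consecutive cells of the subcomplex the definite descriptions coincide, because the
  group of the boundary and its basis lie in dimension below \<open>k\<close>, where both complexes
  have the same skeleta.\<close>

lemma incidence_subcomplex:
  "incidence X' f e = (if e \<in> cw_cells X' \<and> f \<in> cw_cells X' then incidence X f e else 0)"
proof (cases "e \<in> cw_cells X' \<and> f \<in> cw_cells X' \<and> cw_dim X e = Suc (cw_dim X f)")
  case True
  then have X: "e \<in> cw_cells X \<and> f \<in> cw_cells X" "cw_dim X f < k"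
    using T by (auto simp: cells_def)
  have "cells X' (cw_dim X f) = cells X (cw_dim X f)"
    using X subcomplex_cells by blast
  moreover have "finprod (cellular_group X (cw_dim X f)) (\<lambda>g. cell_class X' g [^]\<^bsub>cellular_group X (cw_dim X f)\<^esub> c g) (cells X (cw_dim X f))
    = finprod (cellular_group X (cw_dim X f)) (\<lambda>g. cell_class X g [^]\<^bsub>cellular_group X (cw_dim X f)\<^esub> c g) (cells X (cw_dim X f))" for c :: "'c \<Rightarrow> int"
  proof -
    interpret comm_group "cellular_group X (cw_dim X f)" by (rule comm_group_cellular_group)
    show ?thesis
    proof (intro finprod_cong' refl)
      fix g assume g: "g \<in> cells X (cw_dim X f)"
      then have "cw_dim X g < k" using X by (simp add: cells_def)
      then show "cell_class X' g [^]\<^bsub>cellular_group X (cw_dim X f)\<^esub> c g = cell_class X g [^]\<^bsub>cellular_group X (cw_dim X f)\<^esub> c g"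
        by (simp add: cell_class_subcomplex)
    qed (auto simp: cell_class_carrier)
  qed
  ultimately show ?thesis
    using True X boundary_subcomplex [of e] cellular_group_subcomplex [OF X(2)]
    unfolding incidence_def by (simp del: subcomplex_simps(2))
next
  case False
  then show ?thesis
    using T by (auto simp: incidence_def)
qed

end

section \<open>Indices of subgroups\<close>

text \<open>Lattices are plain sets in a type class group, for functions with pointwise addition, so
  that sums, images and intersections need no carriers. The link to the quotient groups of the
  statement is made only when torsion is treated.\<close>

definition is_subgroup :: "'g::ab_group_add set \<Rightarrow> bool" where
  "is_subgroup A \<longleftrightarrow> 0 \<in> A \<and> (\<forall>x\<in>A. \<forall>y\<in>A. x - y \<in> A)"

text \<open>An infinite index is \<open>0\<close>, by the convention on \<open>card\<close>.\<close>

definition index :: "'g::ab_group_add set \<Rightarrow> 'g set \<Rightarrow> nat" where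
  "index A B = card ((\<lambda>a. (+) a ` B) ` A)"

lemma is_subgroup_zero: "is_subgroup A \<Longrightarrow> 0 \<in> A"
  and is_subgroup_diff: "is_subgroup A \<Longrightarrow> x \<in> A \<Longrightarrow> y \<in> A \<Longrightarrow> x - y \<in> A"
  by (auto simp: is_subgroup_def)

lemma is_subgroup_minus: "is_subgroup A \<Longrightarrow> x \<in> A \<Longrightarrow> - x \<in> A"
  using is_subgroup_diff [of A 0 x] is_subgroup_zero by force

lemma is_subgroup_add: "is_subgroup A \<Longrightarrow> x \<in> A \<Longrightarrow> y \<in> A \<Longrightarrow> x + y \<in> A"
  using is_subgroup_diff [of A x "- y"] is_subgroup_minus by force

lemma is_subgroup_image:
  assumes "is_subgroup A" "\<And>x y. x \<in> A \<Longrightarrow> y \<in> A \<Longrightarrow> f (x - y) = f x - f y"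
  shows "is_subgroup (f ` A)"
proof -
  have "f 0 = 0"
    using assms(2) [of 0 0] assms(1) by (simp add: is_subgroup_zero)
  then show ?thesis
    using assms unfolding is_subgroup_def by (auto simp flip: assms(2))
qed

lemma coset_eq_iff:
  assumes "is_subgroup B"
  shows "(+) a ` B = (+) a' ` B \<longleftrightarrow> a - a' \<in> B"
proof
  assume "(+) a ` B = (+) a' ` B"
  then have "a \<in> (+) a' ` B"
    using is_subgroup_zero [OF assms] by (metis add.right_neutral image_eqI)
  then show "a - a' \<in> B"
    by auto
next
  assume d: "a - a' \<in> B"
  have "a + b \<in> (+) a' ` B" if "b \<in> B" for b
    using is_subgroup_add [OF assms d that] by (intro image_eqI [of _ _ "a - a' + b"]) auto
  moreover have "a' + b \<in> (+) a ` B" if "b \<in> B" for b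
    using is_subgroup_diff [OF assms that d] by (intro image_eqI [of _ _ "b - (a - a')"]) auto
  ultimately show "(+) a ` B = (+) a' ` B"
    by blast
qed

lemma index_self: "is_subgroup A \<Longrightarrow> index A A = 1"
proof -
  assume A: "is_subgroup A"
  have "(\<lambda>a. (+) a ` A) ` A = {A}"
  proof -
    have "(+) a ` A = (+) 0 ` A" if "a \<in> A" for a
      using A that by (subst coset_eq_iff) auto
    then show ?thesis
      using is_subgroup_zero [OF A] by auto
  qed
  then show ?thesis
    by (simp add: index_def)
qed

text \<open>Both images are in bijection with the set of fibres. The index comparisons below rest on
  this, and it also covers infinite images, where both cardinalities are 0.\<close>

lemma card_image_eq_if_iff:
  assumes "\<And>x y. x \<in> A \<Longrightarrow> y \<in> A \<Longrightarrow> f x = f y \<longleftrightarrow> g x = g y"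
  shows "card (f ` A) = card (g ` A)"
proof (rule bij_betw_same_card)
  show "bij_betw (\<lambda>u. g (inv_into A f u)) (f ` A) (g ` A)"
    unfolding bij_betw_def
  proof
    show "inj_on (\<lambda>u. g (inv_into A f u)) (f ` A)"
      by (rule inj_onI) (metis assms f_inv_into_f inv_into_into)
    have "g (inv_into A f (f x)) = g x" if "x \<in> A" for x
      using that by (metis assms f_inv_into_f image_eqI inv_into_into)
    then show "(\<lambda>u. g (inv_into A f u)) ` f ` A = g ` A"
      by (simp add: image_image)
  qed
qed

text \<open>As \<open>B\<close> contains the kernel of \<open>f\<close> on \<open>A\<close>,
  distinct cosets of \<open>B\<close> keep distinct images.\<close>

lemma index_image:
  assumes A: "is_subgroup A" and B: "is_subgroup B" "B \<subseteq> A"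
    and f: "\<And>x y. x \<in> A \<Longrightarrow> y \<in> A \<Longrightarrow> f (x - y) = f x - f y"
    and ker: "\<And>x. x \<in> A \<Longrightarrow> f x = 0 \<Longrightarrow> x \<in> B"
  shows "index (f ` A) (f ` B) = index A B"
proof -
  have fB: "is_subgroup (f ` B)"
    using B f by (intro is_subgroup_image) auto
  have "card ((\<lambda>a. (+) (f a) ` f ` B) ` A) = card ((\<lambda>a. (+) a ` B) ` A)"
  proof (rule card_image_eq_if_iff)
    fix x y assume xy: "x \<in> A" "y \<in> A"
    have "f (x - y) \<in> f ` B \<longleftrightarrow> x - y \<in> B"
    proof
      assume "f (x - y) \<in> f ` B"
      then obtain b where b: "b \<in> B" "f (x - y) = f b" by auto
      then have "f (x - y - b) = 0"
        using f is_subgroup_diff [OF A xy] B by auto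
      then have "x - y - b \<in> B"
        using ker is_subgroup_diff [OF A is_subgroup_diff [OF A xy]] b B by blast
      then show "x - y \<in> B"
        using is_subgroup_add [OF B(1) _ b(1)] by force
    qed auto
    then show "(+) (f x) ` f ` B = (+) (f y) ` f ` B \<longleftrightarrow> (+) x ` B = (+) y ` B"
      using xy by (simp add: coset_eq_iff fB B f)
  qed
  then show ?thesis
    by (simp add: index_def image_image)
qed

text \<open>A chosen representative in each coset of \<open>M\<close> turns cosets of
  \<open>B\<close> into pairs. The cardinality of a product is multiplicative without finiteness, so
  the formula survives the convention that an infinite index is 0.\<close>

lemma index_tower:
  assumes A: "is_subgroup A" and M: "is_subgroup M" and B: "is_subgroup B" and sub: "B \<subseteq> M" "M \<subseteq> A"
  shows "index A B = index A M * index M B"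
proof -
  let ?q = "\<lambda>a. (+) a ` M"
  define r where "r = (\<lambda>u. inv_into A ?q u)"
  have r: "r (?q a) \<in> A" "a - r (?q a) \<in> M" if "a \<in> A" for a
  proof -
    show "r (?q a) \<in> A"
      unfolding r_def using that by (intro inv_into_into) auto
    have "?q (r (?q a)) = ?q a"
      unfolding r_def using that by (intro f_inv_into_f) auto
    then show "a - r (?q a) \<in> M"
      by (metis M coset_eq_iff)
  qed
  let ?c = "\<lambda>a. (?q a, (+) (a - r (?q a)) ` B)"
  have "card ((\<lambda>a. (+) a ` B) ` A) = card (?c ` A)"
  proof (rule card_image_eq_if_iff)
    fix x y assume "x \<in> A" "y \<in> A"
    show "(+) x ` B = (+) y ` B \<longleftrightarrow> ?c x = ?c y"
    proof
      assume "(+) x ` B = (+) y ` B"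
      then have d: "x - y \<in> B"
        by (simp only: coset_eq_iff [OF B])
      then have q: "?q x = ?q y"
        using sub by (simp only: coset_eq_iff [OF M]) blast
      have "(+) (x - r (?q x)) ` B = (+) (y - r (?q y)) ` B"
        using d by (simp only: coset_eq_iff [OF B] q) simp
      then show "?c x = ?c y"
        by (simp only: q)
    next
      assume *: "?c x = ?c y"
      have q: "?q x = ?q y"
        using * by (rule prod.inject [THEN iffD1, THEN conjunct1])
      have "(+) (x - r (?q x)) ` B = (+) (y - r (?q y)) ` B"
        using * by (rule prod.inject [THEN iffD1, THEN conjunct2])
      then have "x - r (?q y) - (y - r (?q y)) \<in> B"
        by (simp only: coset_eq_iff [OF B] q)
      then show "(+) x ` B = (+) y ` B"
        by (simp only: coset_eq_iff [OF B]) simp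
    qed
  qed
  also have "?c ` A = (?q ` A) \<times> ((\<lambda>m. (+) m ` B) ` M)"
  proof
    show "?c ` A \<subseteq> (?q ` A) \<times> ((\<lambda>m. (+) m ` B) ` M)"
      using r(2) by (intro image_subsetI SigmaI imageI)
    show "(?q ` A) \<times> ((\<lambda>m. (+) m ` B) ` M) \<subseteq> ?c ` A"
    proof clarify
      fix a m assume a: "a \<in> A" and m: "m \<in> M"
      let ?x = "r (?q a) + m"
      have x: "?x \<in> A"
        using r(1) [OF a] m sub by (auto intro: is_subgroup_add [OF A])
      have "?q ?x = ?q a"
        using is_subgroup_diff [OF M m r(2) [OF a]] by (simp only: coset_eq_iff [OF M]) (simp add: algebra_simps)
      then have "(?q a, (+) m ` B) = ?c ?x"
        by (simp only: add_diff_cancel_left')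
      then show "(?q a, (+) m ` B) \<in> ?c ` A"
        using x by (rule image_eqI)
    qed
  qed
  finally show ?thesis
    by (simp add: index_def card_cartesian_product)
qed

text \<open>The second isomorphism theorem: each coset of \<open>L\<close> in the sum has a
  representative in \<open>K\<close>.\<close>

lemma index_sum:
  assumes K: "is_subgroup K" and L: "is_subgroup L"
  shows "index {k + l | k l. k \<in> K \<and> l \<in> L} L = index K (K \<inter> L)"
proof -
  have KL: "is_subgroup (K \<inter> L)"
    using assms by (auto simp: is_subgroup_def)
  have "(\<lambda>a. (+) a ` L) ` {k + l | k l. k \<in> K \<and> l \<in> L} = (\<lambda>a. (+) a ` L) ` K"
  proof
    have "(+) (k + l) ` L = (+) k ` L" if "l \<in> L" for k l
      using that by (simp add: coset_eq_iff L)
    then show "(\<lambda>a. (+) a ` L) ` {k + l | k l. k \<in> K \<and> l \<in> L} \<subseteq> (\<lambda>a. (+) a ` L) ` K"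
      by auto
    have "K \<subseteq> {k + l | k l. k \<in> K \<and> l \<in> L}"
      using is_subgroup_zero [OF L] by force
    then show "(\<lambda>a. (+) a ` L) ` K \<subseteq> (\<lambda>a. (+) a ` L) ` {k + l | k l. k \<in> K \<and> l \<in> L}"
      by (rule image_mono)
  qed
  moreover have "card ((\<lambda>a. (+) a ` L) ` K) = card ((\<lambda>a. (+) a ` (K \<inter> L)) ` K)"
    by (rule card_image_eq_if_iff) (auto simp: coset_eq_iff L KL is_subgroup_diff [OF K])
  ultimately show ?thesis
    by (simp add: index_def)
qed

lemma is_subgroup_set_plus:
  assumes K: "is_subgroup K" and L: "is_subgroup L"
  shows "is_subgroup {k + l | k l. k \<in> K \<and> l \<in> L}"
  unfolding is_subgroup_def
proof (intro conjI ballI)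
  show "0 \<in> {k + l | k l. k \<in> K \<and> l \<in> L}"
    using is_subgroup_zero [OF K] is_subgroup_zero [OF L] by force
  fix x y assume "x \<in> {k + l | k l. k \<in> K \<and> l \<in> L}" "y \<in> {k + l | k l. k \<in> K \<and> l \<in> L}"
  then obtain k l k' l' where *: "x = k + l" "y = k' + l'" "k \<in> K" "k' \<in> K" "l \<in> L" "l' \<in> L"
    by blast
  have "x - y = (k - k') + (l - l')" "k - k' \<in> K" "l - l' \<in> L"
    using * by (simp_all add: is_subgroup_diff K L)
  then show "x - y \<in> {k + l | k l. k \<in> K \<and> l \<in> L}"
    by blast
qed

text \<open>For \<open>g = 0\<close> the index is infinite and both sides are 0; singular matrices
  can therefore be treated together with the others.\<close>

lemma index_int_multiples: "index UNIV (range ((*) (g::int))) = nat \<bar>g\<bar>"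
proof -
  have dvd: "x \<in> range ((*) g) \<longleftrightarrow> \<bar>g\<bar> dvd x" for x
    unfolding abs_dvd_iff by (auto simp: dvd_def image_iff)
  have sg: "is_subgroup (range ((*) g))"
    unfolding is_subgroup_def dvd by auto
  have "index UNIV (range ((*) g)) = card (range (\<lambda>a. a mod \<bar>g\<bar>))"
    unfolding index_def
    by (rule card_image_eq_if_iff) (simp only: coset_eq_iff [OF sg] dvd mod_eq_dvd_iff)
  also have "\<dots> = nat \<bar>g\<bar>"
  proof (cases "g = 0")
    case True
    then show ?thesis by (simp add: infinite_UNIV_int)
  next
    case False
    have "range (\<lambda>a. a mod \<bar>g\<bar>) = {0..<\<bar>g\<bar>}"
    proof
      show "range (\<lambda>a. a mod \<bar>g\<bar>) \<subseteq> {0..<\<bar>g\<bar>}"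
        using False by auto
      have "x = x mod \<bar>g\<bar>" if "x \<in> {0..<\<bar>g\<bar>}" for x
        using that by simp
      then show "{0..<\<bar>g\<bar>} \<subseteq> range (\<lambda>a. a mod \<bar>g\<bar>)"
        by blast
    qed
    then show ?thesis
      by simp
  qed
  finally show ?thesis .
qed

text \<open>Pigeonhole: a non-zero index means finitely many cosets, so two multiples of
  \<open>z\<close> share one and their difference lies in \<open>B\<close>.\<close>

lemma index_nonzero_multiple:
  fixes z :: "'a \<Rightarrow> int"
  assumes A: "is_subgroup A" and B: "is_subgroup B" and i: "index A B \<noteq> 0" and z: "z \<in> A"
  shows "\<exists>n>0. (\<lambda>x. int n * z x) \<in> B"
proof -
  let ?m = "\<lambda>n :: nat. \<lambda>x. int n * z x"
  have mA: "?m n \<in> A" for n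
  proof (induction n)
    case 0
    then show ?case using is_subgroup_zero [OF A] by (simp add: zero_fun_def)
  next
    case (Suc n)
    have "?m (Suc n) = z + ?m n" by (simp add: fun_eq_iff algebra_simps)
    then show ?case using is_subgroup_add [OF A z Suc] by simp
  qed
  have "finite ((\<lambda>a. (+) a ` B) ` A)"
    using i unfolding index_def by (meson card.infinite)
  moreover have "range (\<lambda>n. (+) (?m n) ` B) \<subseteq> (\<lambda>a. (+) a ` B) ` A"
    using mA by blast
  ultimately have "\<not> inj (\<lambda>n. (+) (?m n) ` B)"
    by (meson finite_imageD finite_subset infinite_UNIV_nat)
  then obtain p q where pq: "p < q" "(+) (?m q) ` B = (+) (?m p) ` B"
    unfolding inj_on_def by (metis linorder_neqE_nat UNIV_I)
  then have "?m q - ?m p \<in> B"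
    by (simp add: coset_eq_iff B)
  moreover have "?m q - ?m p = ?m (q - p)"
    using pq by (simp add: fun_eq_iff of_nat_diff algebra_simps)
  ultimately show ?thesis
    using pq(1) by (intro exI [of _ "q - p"]) simp
qed

section \<open>Determinants as lattice indices\<close>

text \<open>Vectors over an index set are total functions vanishing elsewhere, so lattices over
  different index sets live in one type and can be added and intersected.\<close>

definition supported_on :: "'a set \<Rightarrow> ('a \<Rightarrow> 'r::zero) set" where
  "supported_on A = {v. \<forall>x. x \<notin> A \<longrightarrow> v x = 0}"

definition mat_apply :: "'a set \<Rightarrow> 'b set \<Rightarrow> ('a \<Rightarrow> 'b \<Rightarrow> 'r::comm_ring_1) \<Rightarrow> ('b \<Rightarrow> 'r) \<Rightarrow> 'a \<Rightarrow> 'r" where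
  "mat_apply R C A x = (\<lambda>i. if i \<in> R then \<Sum>j\<in>C. A i j * x j else 0)"

abbreviation sq_apply :: "nat \<Rightarrow> (nat \<Rightarrow> nat \<Rightarrow> 'r::comm_ring_1) \<Rightarrow> (nat \<Rightarrow> 'r) \<Rightarrow> nat \<Rightarrow> 'r" where
  "sq_apply n \<equiv> mat_apply {..<n} {..<n}"

lemma is_subgroup_supported_on: "is_subgroup (supported_on A :: ('a \<Rightarrow> int) set)"
  by (simp add: is_subgroup_def supported_on_def)

lemma mat_apply_diff: "mat_apply R C A (x - y) = mat_apply R C A x - mat_apply R C A y"
  by (auto simp: mat_apply_def fun_eq_iff algebra_simps sum_subtractf)

lemma mat_apply_in_supported_on: "mat_apply R C A x \<in> supported_on R"
  by (simp add: mat_apply_def supported_on_def)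

lemma is_subgroup_UNIV: "is_subgroup UNIV"
  by (simp add: is_subgroup_def)

lemma is_subgroup_range_mat_apply: "is_subgroup (range (mat_apply R C A))"
  by (intro is_subgroup_image is_subgroup_UNIV mat_apply_diff)

definition nat_det :: "nat \<Rightarrow> (nat \<Rightarrow> nat \<Rightarrow> 'r::comm_ring_1) \<Rightarrow> 'r" where
  "nat_det n N = Determinant.det (Matrix.mat n n (\<lambda>(i, j). N i j))"

lemma nat_det_addcol:
  assumes "k < n" "l < n" "k \<noteq> l"
  shows "nat_det n (\<lambda>i j. if j = k then a * N i l + N i j else N i j) = nat_det n N"
proof -
  have "Matrix.mat n n (\<lambda>(i, j). if j = k then a * N i l + N i j else N i j) = addcol a k l (Matrix.mat n n (\<lambda>(i, j). N i j))"
    using assms by (intro eq_matI) (auto simp: mat_addcol_def)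
  then show ?thesis
    using assms by (simp add: nat_det_def)
qed

text \<open>A column operation is an invertible substitution in the argument: \<open>x l\<close> is
  replaced by \<open>x l + a * x k\<close>, and the inverse subtracts the same term.\<close>

lemma range_mat_apply_addcol:
  fixes N :: "nat \<Rightarrow> nat \<Rightarrow> 'b::comm_ring_1"
  assumes "k < n" "l < n" "k \<noteq> l"
  shows "range (sq_apply n (\<lambda>i j. if j = k then a * N i l + N i j else N i j)) = range (sq_apply n N)"
proof -
  let ?N = "\<lambda>i j. if j = k then a * N i l + N i j else N i j"
  have upd: "(\<Sum>j<n. N i j * (x(l := x l + y)) j) = (\<Sum>j<n. N i j * x j) + N i l * y" for i x y
  proof -
    have "N i j * (x(l := x l + y)) j = N i j * x j + (if j = l then N i l * y else 0)" for j
      by (simp add: algebra_simps)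
    then show ?thesis
      using assms by (simp only: sum.distrib) (simp add: sum.delta)
  qed
  have eq: "(\<Sum>j<n. ?N i j * x j) = (\<Sum>j<n. N i j * x j) + N i l * (a * x k)" for i x
  proof -
    have "?N i j * x j = N i j * x j + (if j = k then N i l * (a * x k) else 0)" for j
      by (simp add: algebra_simps)
    then show ?thesis
      using assms by (simp only: sum.distrib) (simp add: sum.delta)
  qed
  have 1: "sq_apply n ?N x = sq_apply n N (x(l := x l + a * x k))" for x
    unfolding mat_apply_def by (rule ext) (simp only: eq upd)
  have 2: "sq_apply n N x = sq_apply n ?N (x(l := x l + - (a * x k)))" for x
    unfolding mat_apply_def by (rule ext) (use assms in \<open>simp only: eq upd fun_upd_other, simp\<close>)
  show ?thesis
  proof (intro equalityI image_subsetI)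
    fix x
    show "sq_apply n ?N x \<in> range (sq_apply n N)"
      unfolding 1 by (rule rangeI)
    show "sq_apply n N x \<in> range (sq_apply n ?N)"
      by (subst 2) (rule rangeI)
  qed
qed

lemma nat_det_swapcols:
  assumes "k < n" "l < n" "k \<noteq> l"
  shows "nat_det n (\<lambda>i j. N i (Transposition.transpose k l j)) = - nat_det n N"
proof -
  have "Matrix.mat n n (\<lambda>(i, j). N i (Transposition.transpose k l j)) = swapcols k l (Matrix.mat n n (\<lambda>(i, j). N i j))"
    using assms by (intro eq_matI) (auto simp: mat_swapcols_def Transposition.transpose_def)
  moreover have "Determinant.det (swapcols k l (Matrix.mat n n (\<lambda>(i, j). N i j))) = - Determinant.det (Matrix.mat n n (\<lambda>(i, j). N i j))"
    using assms by (intro det_swapcols) auto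
  ultimately show ?thesis
    by (simp add: nat_det_def)
qed

lemma range_mat_apply_swapcols:
  fixes N :: "nat \<Rightarrow> nat \<Rightarrow> 'b::comm_ring_1"
  assumes "k < n" "l < n"
  shows "range (sq_apply n (\<lambda>i j. N i (Transposition.transpose k l j))) = range (sq_apply n N)"
proof -
  let ?t = "Transposition.transpose k l"
  have perm: "?t permutes {..<n}"
    using assms by (simp add: permutes_swap_id)
  have *: "sq_apply n (\<lambda>i j. N i (?t j)) x = sq_apply n N (x \<circ> ?t)" for N :: "nat \<Rightarrow> nat \<Rightarrow> 'b::comm_ring_1" and x
  proof -
    have "(\<Sum>j<n. N i (?t j) * x j) = (\<Sum>j<n. N i j * x (?t j))" for i
      using sum.permute [OF perm, of "\<lambda>j. N i j * x (?t j)"] by (simp add: o_def)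
    then show ?thesis
      unfolding mat_apply_def o_def by (intro ext) (simp only:)
  qed
  have **: "sq_apply n N x = sq_apply n (\<lambda>i j. N i (?t j)) (x \<circ> ?t)" for x
    using * [of N "x \<circ> ?t"] by (simp add: o_def)
  show ?thesis
  proof (intro equalityI image_subsetI)
    fix x
    show "sq_apply n (\<lambda>i j. N i (?t j)) x \<in> range (sq_apply n N)"
      unfolding * by (rule rangeI)
    show "sq_apply n N x \<in> range (sq_apply n (\<lambda>i j. N i (?t j)))"
      by (subst **) (rule rangeI)
  qed
qed

text \<open>With a single entry left in the last row the matrix is block triangular. Projection to
  the last coordinate contributes the index of the multiples of \<open>N n n\<close>. If this entry
  is non-zero, the part of the lattice in the kernel of the projection is the lattice of the smaller
  matrix; if it is zero, both sides are 0.\<close>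

lemma index_range_mat_apply_last_row:
  fixes N :: "nat \<Rightarrow> nat \<Rightarrow> int"
  assumes row: "\<And>j. j < n \<Longrightarrow> N n j = 0"
    and IH: "index (supported_on {..<n}) (range (sq_apply n N)) = nat \<bar>nat_det n N\<bar>"
  shows "index (supported_on {..<Suc n}) (range (sq_apply (Suc n) N)) = nat \<bar>nat_det (Suc n) N\<bar>"
proof -
  let ?V = "supported_on {..<Suc n} :: (nat \<Rightarrow> int) set" and ?K = "supported_on {..<n} :: (nat \<Rightarrow> int) set"
  let ?L = "range (sq_apply (Suc n) N)" and ?L' = "range (sq_apply n N)"
  let ?M = "{k + l | k l. k \<in> ?K \<and> l \<in> ?L}"
  let ?A = "Matrix.mat (Suc n) (Suc n) (\<lambda>(i, j). N i j)"
  have sgV: "is_subgroup ?V" and sgK: "is_subgroup ?K" and sgL: "is_subgroup ?L"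
    by (simp_all add: is_subgroup_supported_on is_subgroup_range_mat_apply)
  have sgM: "is_subgroup ?M"
    by (rule is_subgroup_set_plus [OF sgK sgL])
  have KV: "?K \<subseteq> ?V" and LV: "?L \<subseteq> ?V"
    by (auto simp: supported_on_def mat_apply_def)
  have LM: "?L \<subseteq> ?M"
  proof
    fix l assume "l \<in> ?L"
    moreover have "l = 0 + l" by simp
    ultimately show "l \<in> ?M"
      using is_subgroup_zero [OF sgK] by blast
  qed
  have KM: "?K \<subseteq> ?M"
  proof
    fix k assume "k \<in> ?K"
    moreover have "k = k + 0" by simp
    ultimately show "k \<in> ?M"
      using is_subgroup_zero [OF sgL] by blast
  qed
  have MV: "?M \<subseteq> ?V"
    using KV LV is_subgroup_add [OF sgV] by blast
  have last: "sq_apply (Suc n) N x n = N n n * x n" for x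
    by (simp add: mat_apply_def row)
  have "nat_det (Suc n) N = (\<Sum>j<Suc n. ?A $$ (n, j) * cofactor ?A n j)"
    unfolding nat_det_def by (rule laplace_expansion_row) auto
  also have "\<dots> = N n n * cofactor ?A n n"
    by (simp add: row)
  also have "mat_delete ?A n n = Matrix.mat n n (\<lambda>(i, j). N i j)"
    by (intro eq_matI) (auto simp: mat_delete_def)
  then have "cofactor ?A n n = nat_det n N"
    by (simp add: cofactor_def nat_det_def flip: mult_2)
  finally have det: "nat_det (Suc n) N = N n n * nat_det n N" .
  have 1: "index ((\<lambda>v. v n) ` ?V) ((\<lambda>v. v n) ` ?M) = index ?V ?M"
  proof (rule index_image [OF sgV sgM MV])
    fix v assume "v \<in> ?V" "v n = 0"
    then have "v \<in> ?K"
      by (auto simp: supported_on_def) (metis less_Suc_eq lessThan_iff)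
    then show "v \<in> ?M" using KM by blast
  qed auto
  have 2: "(\<lambda>v. v n) ` ?V = UNIV"
  proof -
    have "a \<in> (\<lambda>v. v n) ` ?V" for a
      by (rule image_eqI [of _ _ "\<lambda>i. if i = n then a else 0"]) (auto simp: supported_on_def)
    then show ?thesis by blast
  qed
  have 3: "(\<lambda>v. v n) ` ?M = range ((*) (N n n))"
  proof
    show "(\<lambda>v. v n) ` ?M \<subseteq> range ((*) (N n n))"
    proof (rule image_subsetI)
      fix v assume "v \<in> ?M"
      then obtain k x where "k \<in> ?K" and v: "v = k + sq_apply (Suc n) N x"
        by blast
      then have "(k + sq_apply (Suc n) N x) n = N n n * x n"
        by (simp add: last) (simp add: supported_on_def)
      then show "v n \<in> range ((*) (N n n))"
        by (simp only: v rangeI)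
    qed
    show "range ((*) (N n n)) \<subseteq> (\<lambda>v. v n) ` ?M"
    proof (rule image_subsetI)
      fix a
      show "N n n * a \<in> (\<lambda>v. v n) ` ?M"
      proof (rule image_eqI [where x = "sq_apply (Suc n) N (\<lambda>_. a)"])
        show "N n n * a = sq_apply (Suc n) N (\<lambda>_. a) n"
          by (simp only: last)
        show "sq_apply (Suc n) N (\<lambda>_. a) \<in> ?M"
          by (rule subsetD [OF LM rangeI])
      qed
    qed
  qed
  have VM: "index ?V ?M = nat \<bar>N n n\<bar>"
    using 1 unfolding 2 3 index_int_multiples by (rule sym)
  have "index ?V ?L = index ?V ?M * index ?M ?L"
    using sgV sgM sgL LM MV by (rule index_tower)
  also have "index ?M ?L = index ?K (?K \<inter> ?L)"
    by (rule index_sum [OF sgK sgL])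
  finally have VL: "index ?V ?L = nat \<bar>N n n\<bar> * index ?K (?K \<inter> ?L)"
    by (simp only: VM)
  show ?thesis
  proof (cases "N n n = 0")
    case True
    then show ?thesis by (simp add: VL det)
  next
    case False
    have "?K \<inter> ?L = ?L'"
    proof
      show "?K \<inter> ?L \<subseteq> ?L'"
      proof
        fix v assume v: "v \<in> ?K \<inter> ?L"
        then obtain x where x: "v = sq_apply (Suc n) N x" by blast
        have "v n = 0" using v by (simp add: supported_on_def)
        then have "x n = 0" using last x False by simp
        then have "v = sq_apply n N x"
          unfolding x by (auto simp: mat_apply_def fun_eq_iff row less_Suc_eq)
        then show "v \<in> ?L'" by blast
      qed
      show "?L' \<subseteq> ?K \<inter> ?L"
      proof (rule image_subsetI)
        fix x
        have "sq_apply n N x = sq_apply (Suc n) N (x(n := 0))"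
          by (auto simp: mat_apply_def fun_eq_iff row less_Suc_eq)
        then show "sq_apply n N x \<in> ?K \<inter> ?L"
          using mat_apply_in_supported_on [of "{..<n}" "{..<n}" N x] by (intro IntI) simp_all
      qed
    qed
    then show ?thesis
      by (simp add: VL IH det abs_mult nat_mult_distrib)
  qed
qed

text \<open>Column operations change neither the lattice nor the absolute determinant. Euclid's
  algorithm on the last row, by induction on the sum of its absolute values, leaves at most one
  non-zero entry, which a swap moves to the end.\<close>

theorem index_range_mat_apply:
  fixes N :: "nat \<Rightarrow> nat \<Rightarrow> int"
  shows "index (supported_on {..<n}) (range (sq_apply n N)) = nat \<bar>nat_det n N\<bar>"
proof (induction n arbitrary: N)
  case 0
  have "range (sq_apply 0 N) = supported_on {..<0}"
    by (auto simp: mat_apply_def supported_on_def)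
  then show ?case
    using index_self [OF is_subgroup_supported_on] by (simp add: nat_det_def det_dim_zero)
next
  case (Suc n)
  note IH = Suc
  show ?case
  proof (induction "\<Sum>j<Suc n. nat \<bar>N n j\<bar>" arbitrary: N rule: less_induct)
    case less
    show ?case
    proof (cases "\<exists>k l. k < Suc n \<and> l < Suc n \<and> k \<noteq> l \<and> N n k \<noteq> 0 \<and> N n l \<noteq> 0")
      case True
      then obtain p q where pq: "p < Suc n" "q < Suc n" "p \<noteq> q" "N n p \<noteq> 0" "N n q \<noteq> 0"
        by blast
      have "\<bar>N n q\<bar> \<le> \<bar>N n p\<bar> \<or> \<bar>N n p\<bar> \<le> \<bar>N n q\<bar>"
        by linarith
      then obtain k l where kl: "k < Suc n" "l < Suc n" "k \<noteq> l" "N n k \<noteq> 0" "N n l \<noteq> 0" "\<bar>N n l\<bar> \<le> \<bar>N n k\<bar>"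
        using pq by auto
      \<comment> \<open>The signs are chosen so that the new entry at \<open>k\<close> has absolute
        value \<open>|N n k| - |N n l|\<close>.\<close>
      define a where "a = - (sgn (N n l) * sgn (N n k))"
      define N' where "N' = (\<lambda>i j. if j = k then a * N i l + N i j else N i j)"
      have "\<bar>N' n k\<bar> < \<bar>N n k\<bar>"
        using kl by (auto simp: N'_def a_def sgn_if)
      then have "(\<Sum>j<Suc n. nat \<bar>N' n j\<bar>) < (\<Sum>j<Suc n. nat \<bar>N n j\<bar>)"
        using kl by (intro sum_strict_mono_ex1) (auto simp: N'_def intro!: bexI [of _ k])
      then have "index (supported_on {..<Suc n}) (range (sq_apply (Suc n) N')) = nat \<bar>nat_det (Suc n) N'\<bar>"
        by (rule less)
      then show ?thesis
        unfolding N'_def using kl by (simp only: range_mat_apply_addcol nat_det_addcol not_False_eq_True)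
    next
      case False
      \<comment> \<open>At most one entry of the last row is non-zero; if the whole row vanishes,
        \<open>k = n\<close> serves.\<close>
      then obtain k where k: "k < Suc n" "\<And>j. j < Suc n \<Longrightarrow> j \<noteq> k \<Longrightarrow> N n j = 0"
        by (metis lessI)
      show ?thesis
      proof (cases "k = n")
        case True
        then show ?thesis
          using k by (intro index_range_mat_apply_last_row IH) auto
      next
        case kn: False
        let ?N = "\<lambda>i j. N i (Transposition.transpose k n j)"
        have "index (supported_on {..<Suc n}) (range (sq_apply (Suc n) ?N)) = nat \<bar>nat_det (Suc n) ?N\<bar>"
        proof (intro index_range_mat_apply_last_row IH)
          fix j assume "j < n"
          then show "N n (Transposition.transpose k n j) = 0"
            using k kn by (auto simp: Transposition.transpose_def)
        qed
        then show ?thesis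
          using k kn nat_det_swapcols [of k "Suc n" n N] range_mat_apply_swapcols [of k "Suc n" n N]
          by simp
      qed
    qed
  qed
qed

section \<open>The Cauchy-Binet formula and the characteristic polynomial\<close>

text \<open>The Leibniz formula over an unordered index set, so that minors indexed by sets of cells
  need no enumeration.\<close>

definition set_det :: "'a set \<Rightarrow> ('a \<Rightarrow> 'a \<Rightarrow> 'r::comm_ring_1) \<Rightarrow> 'r" where
  "set_det S M = (\<Sum>p | p permutes S. of_int (sign p) * (\<Prod>i\<in>S. M i (p i)))"

lemma nat_det_eq_set_det: "nat_det n N = set_det {..<n} N"
proof -
  have "nat_det n N = (\<Sum>p | p permutes {0..<n}. of_int (sign p) * (\<Prod>i=0..<n. Matrix.mat n n (\<lambda>(i, j). N i j) $$ (i, p i)))"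
    unfolding nat_det_def by (rule det_def') simp
  also have "\<dots> = set_det {..<n} N"
    unfolding set_det_def atLeast0LessThan
  proof (intro sum.cong refl arg_cong2 [where f = "(*)"] prod.cong)
    fix p i assume "p \<in> {p. p permutes {..<n}}" "i \<in> {..<n}"
    then have "p i < n" "i < n"
      using permutes_in_image [of p "{..<n}" i] by simp_all
    then show "Matrix.mat n n (\<lambda>(i, j). N i j) $$ (i, p i) = N i (p i)"
      by simp
  qed
  finally show ?thesis .
qed

text \<open>Conjugation by a bijection matches the permutations of the two sets and preserves
  signs.\<close>

lemma set_det_reindex:
  assumes s: "bij_betw s A S" and "finite A"
  shows "set_det S M = set_det A (\<lambda>i j. M (s i) (s j))"
proof -
  have bij: "bij_betw (map_permutation A s) {p. p permutes A} {p. p permutes S}"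
  proof -
    have "map_permutation A s = (\<lambda>p x. if x \<in> S then s (p (inv_into A s x)) else x)"
      using s by (intro ext) (auto simp: map_permutation_def restrict_id_def bij_betw_def)
    then show ?thesis
      using bij_betw_permutations [OF s] by simp
  qed
  have inj: "inj_on s A" using s by (simp add: bij_betw_def)
  have "set_det S M = (\<Sum>p | p permutes A. of_int (sign (map_permutation A s p)) * (\<Prod>i\<in>S. M i (map_permutation A s p i)))"
    unfolding set_det_def by (rule sum.reindex_bij_betw [OF bij, symmetric])
  also have "\<dots> = (\<Sum>p | p permutes A. of_int (sign p) * (\<Prod>i\<in>A. M (s i) (s (p i))))"
  proof (intro sum.cong refl)
    fix p assume "p \<in> {p. p permutes A}"
    then have p: "p permutes A" by simp
    have "(\<Prod>i\<in>S. M i (map_permutation A s p i)) = (\<Prod>i\<in>A. M (s i) (map_permutation A s p (s i)))"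
      by (rule prod.reindex_bij_betw [OF s, symmetric])
    also have "\<dots> = (\<Prod>i\<in>A. M (s i) (s (p i)))"
      by (intro prod.cong refl) (simp add: map_permutation_apply inj)
    finally show "of_int (sign (map_permutation A s p)) * (\<Prod>i\<in>S. M i (map_permutation A s p i))
       = of_int (sign p) * (\<Prod>i\<in>A. M (s i) (s (p i)))"
      using sign_map_permutation [OF inj p assms(2)] by simp
  qed
  finally show ?thesis
    by (simp add: set_det_def)
qed

lemma set_det_transpose:
  assumes "finite S"
  shows "set_det S (\<lambda>i j. M j i) = set_det S M"
proof -
  have "set_det S (\<lambda>i j. M j i) = (\<Sum>p | p permutes S. of_int (sign (Hilbert_Choice.inv p)) * (\<Prod>i\<in>S. M (Hilbert_Choice.inv p i) i))"
    unfolding set_det_def by (rule sum_permutations_inverse)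
  also have "\<dots> = set_det S M"
    unfolding set_det_def
  proof (intro sum.cong refl)
    fix p assume "p \<in> {p. p permutes S}"
    then have p: "p permutes S" by simp
    have "(\<Prod>i\<in>S. M (Hilbert_Choice.inv p i) i) = (\<Prod>i\<in>S. ((\<lambda>i. M (Hilbert_Choice.inv p i) i) \<circ> p) i)"
      using prod.permute [OF p, of "\<lambda>i. M (Hilbert_Choice.inv p i) i"] by simp
    also have "\<dots> = (\<Prod>i\<in>S. M i (p i))"
      by (simp add: permutes_inverses [OF p])
    finally show "of_int (sign (Hilbert_Choice.inv p)) * (\<Prod>i\<in>S. M (Hilbert_Choice.inv p i) i) = of_int (sign p) * (\<Prod>i\<in>S. M i (p i))"
      using sign_inverse permutation_permutes p assms by metis
  qed
  finally show ?thesis .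
qed

text \<open>The product over \<open>S\<close> is expanded by the set \<open>U\<close> of positions
  where the factor comes from \<open>M\<close>. A permutation then contributes only if it fixes the
  remaining positions, that is, if it permutes \<open>U\<close>.\<close>

lemma set_det_add_diagonal:
  assumes S: "finite S"
  shows "set_det S (\<lambda>i j. (if i = j then x else 0) + M i j) = (\<Sum>U\<in>Pow S. x ^ card (S - U) * set_det U M)"
proof -
  have fin: "finite {p. p permutes S}"
    using S by (rule finite_permutations)
  have "set_det S (\<lambda>i j. (if i = j then x else 0) + M i j)
    = (\<Sum>p | p permutes S. \<Sum>U\<in>Pow S. of_int (sign p) * ((\<Prod>i\<in>U. M i (p i)) * (\<Prod>i\<in>S-U. if i = p i then x else 0)))"
    unfolding set_det_def by (subst add.commute, subst prod_add [OF S]) (simp only: sum_distrib_left)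
  also have "\<dots> = (\<Sum>U\<in>Pow S. \<Sum>p | p permutes S. of_int (sign p) * ((\<Prod>i\<in>U. M i (p i)) * (\<Prod>i\<in>S-U. if i = p i then x else 0)))"
    by (rule sum.swap)
  also have "\<dots> = (\<Sum>U\<in>Pow S. x ^ card (S - U) * set_det U M)"
  proof (intro sum.cong refl)
    fix U assume "U \<in> Pow S"
    then have U: "U \<subseteq> S" by simp
    have perms: "{p. p permutes S \<and> (\<forall>i\<in>S-U. p i = i)} = {p. p permutes U}"
      using U permutes_superset [of _ S U] permutes_subset [of _ U S] by (auto simp: permutes_not_in)
    have diag: "(\<Prod>i\<in>S-U. if i = p i then x else 0) = (if \<forall>i\<in>S-U. p i = i then x ^ card (S - U) else 0)" for p
    proof (cases "\<forall>i\<in>S-U. p i = i")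
      case True
      then have "(\<Prod>i\<in>S-U. if i = p i then x else 0) = (\<Prod>i\<in>S-U. x)"
        by (intro prod.cong) auto
      then show ?thesis using True by simp
    next
      case False
      then obtain i where "i \<in> S - U" "p i \<noteq> i" by blast
      then have "(\<Prod>i\<in>S-U. if i = p i then x else 0) = 0"
        using S by (intro prod_zero) (auto intro!: bexI [of _ i])
      then show ?thesis by (simp only: False if_False)
    qed
    have "(\<Sum>p | p permutes S. of_int (sign p) * ((\<Prod>i\<in>U. M i (p i)) * (\<Prod>i\<in>S-U. if i = p i then x else 0)))
        = (\<Sum>p | p permutes S. if \<forall>i\<in>S-U. p i = i then of_int (sign p) * (\<Prod>i\<in>U. M i (p i)) * x ^ card (S - U) else 0)"
      unfolding diag by (intro sum.cong refl) (simp add: mult.assoc)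
    also have "\<dots> = (\<Sum>p | p permutes S \<and> (\<forall>i\<in>S-U. p i = i). of_int (sign p) * (\<Prod>i\<in>U. M i (p i)) * x ^ card (S - U))"
      using fin by (subst sum.inter_filter [symmetric]) auto
    also have "\<dots> = x ^ card (S - U) * set_det U M"
      unfolding perms set_det_def by (simp add: sum_distrib_left mult.commute)
    finally show "(\<Sum>p | p permutes S. of_int (sign p) * ((\<Prod>i\<in>U. M i (p i)) * (\<Prod>i\<in>S-U. if i = p i then x else 0)))
       = x ^ card (S - U) * set_det U M" .
  qed
  finally show ?thesis .
qed

lemma set_det_eq_0_iff:
  fixes M :: "'a \<Rightarrow> 'a \<Rightarrow> 'r::idom"
  assumes S: "finite S"
  shows "set_det S M = 0 \<longleftrightarrow> (\<exists>v. (\<exists>i\<in>S. v i \<noteq> 0) \<and> (\<forall>i\<in>S. (\<Sum>j\<in>S. M i j * v j) = 0))"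
proof -
  let ?n = "card S"
  obtain s where s: "bij_betw s {..<?n} S"
    using ex_bij_betw_nat_finite [OF S] by (auto simp: atLeast0LessThan)
  define s' where "s' = inv_into {..<?n} s"
  have s': "bij_betw s' S {..<?n}"
    unfolding s'_def by (rule bij_betw_inv_into [OF s])
  have ss': "s' (s i) = i" if "i < ?n" for i
    using that bij_betw_inv_into_left [OF s] by (simp add: s'_def)
  let ?A = "Matrix.mat ?n ?n (\<lambda>(i, j). M (s i) (s j))"
  have row: "(?A *\<^sub>v v) $ i = (\<Sum>j\<in>S. M (s i) j * v $ s' j)" if "i < ?n" "v \<in> carrier_vec ?n" for i v
  proof -
    have "(?A *\<^sub>v v) $ i = (\<Sum>j<?n. M (s i) (s j) * v $ j)"
      using that by (auto simp: scalar_prod_def atLeast0LessThan)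
    also have "\<dots> = (\<Sum>j<?n. M (s i) (s j) * v $ s' (s j))"
      by (intro sum.cong) (auto simp: ss')
    also have "\<dots> = (\<Sum>j\<in>S. M (s i) j * v $ s' j)"
      by (rule sum.reindex_bij_betw [OF s])
    finally show ?thesis .
  qed
  have "set_det S M = Determinant.det ?A"
    unfolding set_det_reindex [OF s finite_lessThan] nat_det_eq_set_det [symmetric] nat_det_def ..
  moreover have "Determinant.det ?A = 0 \<longleftrightarrow> (\<exists>v. v \<in> carrier_vec ?n \<and> v \<noteq> 0\<^sub>v ?n \<and> ?A *\<^sub>v v = 0\<^sub>v ?n)"
    by (rule det_0_iff_vec_prod_zero) simp
  moreover have "(\<exists>v. v \<in> carrier_vec ?n \<and> v \<noteq> 0\<^sub>v ?n \<and> ?A *\<^sub>v v = 0\<^sub>v ?n)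
     \<longleftrightarrow> (\<exists>v. (\<exists>i\<in>S. v i \<noteq> 0) \<and> (\<forall>i\<in>S. (\<Sum>j\<in>S. M i j * v j) = 0))" (is "?L \<longleftrightarrow> ?R")
  proof
    assume ?L
    then obtain v where v: "v \<in> carrier_vec ?n" "v \<noteq> 0\<^sub>v ?n" "?A *\<^sub>v v = 0\<^sub>v ?n" by blast
    then obtain i where i: "i < ?n" "v $ i \<noteq> 0"
      by (metis carrier_vecD eq_vecI index_zero_vec)
    have "s i \<in> S" "v $ s' (s i) \<noteq> 0"
      using i ss' s by (auto simp: bij_betw_def)
    moreover have "(\<Sum>j\<in>S. M k j * v $ s' j) = 0" if "k \<in> S" for k
    proof -
      have "k \<in> s ` {..<?n}"
        using s that by (simp add: bij_betw_def)
      then obtain i where "i < ?n" "k = s i"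
        by blast
      then have "(\<Sum>j\<in>S. M k j * v $ s' j) = (?A *\<^sub>v v) $ i"
        using row [of i v] v(1) by (simp only:)
      also have "\<dots> = 0"
        using v(3) \<open>i < ?n\<close> by (simp only: index_zero_vec)
      finally show ?thesis .
    qed
    ultimately show ?R
      by (intro exI [of _ "\<lambda>j. v $ s' j"]) blast
  next
    assume ?R
    then obtain v i where v: "i \<in> S" "v i \<noteq> 0" "\<forall>i\<in>S. (\<Sum>j\<in>S. M i j * v j) = 0" by blast
    let ?v = "vec ?n (\<lambda>k. v (s k))"
    have vs: "?v $ s' j = v j" if "j \<in> S" for j
    proof -
      have "s' j < ?n"
        using that s' bij_betwE by blast
      then show ?thesis
        using bij_betw_inv_into_right [OF s that] by (simp add: s'_def)
    qed
    have "?v \<noteq> 0\<^sub>v ?n"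
    proof
      assume "?v = 0\<^sub>v ?n"
      moreover have "s' i < ?n"
        using s' v(1) bij_betwE by blast
      ultimately have "?v $ s' i = 0"
        by simp
      then show False
        using vs v(1,2) by simp
    qed
    moreover have "?A *\<^sub>v ?v = 0\<^sub>v ?n"
    proof (rule eq_vecI)
      fix i assume i: "i < dim_vec (0\<^sub>v ?n :: 'r vec)"
      then have "s i \<in> S" using s by (auto simp: bij_betw_def)
      have "(?A *\<^sub>v ?v) $ i = (\<Sum>j\<in>S. M (s i) j * ?v $ s' j)"
        using i by (intro row) auto
      also have "\<dots> = (\<Sum>j\<in>S. M (s i) j * v j)"
        by (intro sum.cong refl) (simp only: vs)
      finally show "(?A *\<^sub>v ?v) $ i = 0\<^sub>v ?n $ i"
        using v(3) \<open>s i \<in> S\<close> i by simp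
    qed simp
    ultimately show ?L
      by (intro exI [of _ ?v]) simp
  qed
  ultimately show ?thesis
    by simp
qed

lemma set_det_repeated_column:
  fixes B :: "'a \<Rightarrow> 'b \<Rightarrow> 'r::{idom,ring_char_0}"
  assumes S: "finite S" and f: "\<not> inj_on f S"
  shows "set_det S (\<lambda>i j. B j (f i)) = 0"
proof -
  obtain a b where ab: "a \<in> S" "b \<in> S" "a \<noteq> b" "f a = f b"
    using f by (auto simp: inj_on_def)
  \<comment> \<open>The rows \<open>a\<close> and \<open>b\<close> of the given matrix coincide; in
    its transpose these are columns, and the difference of the two unit vectors lies in the
    kernel.\<close>
  let ?v = "\<lambda>i. if i = a then 1 else if i = b then - 1 else 0 :: 'r"
  have "(\<Sum>j\<in>S. B i (f j) * ?v j) = 0" for i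
  proof -
    have "(\<Sum>j\<in>S. B i (f j) * ?v j) = (\<Sum>j\<in>S. (if j = a then B i (f a) else 0) - (if j = b then B i (f b) else 0))"
      using ab by (intro sum.cong) auto
    also have "\<dots> = 0"
      using S ab by (simp add: sum_subtractf)
    finally show ?thesis .
  qed
  moreover have "\<exists>i\<in>S. ?v i \<noteq> 0"
    using ab by (auto intro!: bexI [of _ a])
  ultimately have "set_det S (\<lambda>i j. B i (f j)) = 0"
    unfolding set_det_eq_0_iff [OF S] by (intro exI [of _ ?v]) blast
  then show ?thesis
    using set_det_transpose [OF S, of "\<lambda>i j. B i (f j)"] by simp
qed

text \<open>Arbitrary bijections \<open>\<phi> T\<close> replace increasing enumerations, as the
  sign they introduce occurs in both factors. The determinant expands over maps from
  \<open>S\<close> to \<open>K\<close>: those that are not injective contribute 0, and those with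
  image \<open>T\<close> are \<open>\<phi> T\<close> composed with a permutation of
  \<open>S\<close>.\<close>

theorem cauchy_binet:
  fixes A B :: "'a \<Rightarrow> 'b \<Rightarrow> 'r::{idom,ring_char_0}"
  assumes S: "finite S" and K: "finite K"
    and \<phi>: "\<And>T. T \<subseteq> K \<Longrightarrow> card T = card S \<Longrightarrow> bij_betw (\<phi> T) S T"
  shows "set_det S (\<lambda>i j. \<Sum>k\<in>K. A i k * B j k) =
    (\<Sum>T | T \<subseteq> K \<and> card T = card S. set_det S (\<lambda>i j. A i (\<phi> T j)) * set_det S (\<lambda>i j. B i (\<phi> T j)))"
proof -
  let ?P = "{p. p permutes S}" and ?F = "PiE S (\<lambda>_. K)" and ?T = "{T. T \<subseteq> K \<and> card T = card S}"
  define D where "D f = set_det S (\<lambda>i j. B j (f i))" for f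
  let ?g = "\<lambda>f. (\<Prod>i\<in>S. A i (f i)) * D f"
  have finF: "finite ?F"
    using S K by (simp add: finite_PiE)
  have finT: "finite ?T"
    using K by simp
  have "set_det S (\<lambda>i j. \<Sum>k\<in>K. A i k * B j k) = (\<Sum>p\<in>?P. \<Sum>f\<in>?F. of_int (sign p) * (\<Prod>i\<in>S. A i (f i) * B (p i) (f i)))"
    unfolding set_det_def using S K by (subst prod_sum_PiE) (auto simp: sum_distrib_left)
  also have "\<dots> = (\<Sum>f\<in>?F. \<Sum>p\<in>?P. of_int (sign p) * (\<Prod>i\<in>S. A i (f i) * B (p i) (f i)))"
    by (rule sum.swap)
  also have "\<dots> = (\<Sum>f\<in>?F. ?g f)"
    unfolding D_def set_det_def sum_distrib_left
    by (intro sum.cong refl) (simp add: prod.distrib algebra_simps)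
  also have "\<dots> = (\<Sum>f\<in>{f\<in>?F. inj_on f S}. ?g f)"
    using finF set_det_repeated_column [OF S] by (intro sum.mono_neutral_right) (auto simp: D_def)
  also have "\<dots> = (\<Sum>T\<in>?T. \<Sum>f\<in>{f\<in>{f\<in>?F. inj_on f S}. f ` S = T}. ?g f)"
    using finF finT by (intro sum.group [symmetric]) (auto simp: card_image)
  also have "\<dots> = (\<Sum>T\<in>?T. set_det S (\<lambda>i j. A i (\<phi> T j)) * set_det S (\<lambda>i j. B i (\<phi> T j)))"
  proof (intro sum.cong refl)
    fix T assume "T \<in> ?T"
    then have T: "T \<subseteq> K" "card T = card S" by auto
    have bT: "bij_betw (\<phi> T) S T" using \<phi> T by blast
    let ?r = "\<lambda>q. restrict (\<phi> T \<circ> q) S"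
    have bij: "bij_betw ?r ?P {f\<in>{f\<in>?F. inj_on f S}. f ` S = T}"
      unfolding bij_betw_def
    proof
      show "inj_on ?r ?P"
      proof (rule inj_onI)
        fix p q assume p: "p \<in> ?P" and q: "q \<in> ?P" and eq: "?r p = ?r q"
        have "p i = q i" for i
        proof (cases "i \<in> S")
          case True
          then have "\<phi> T (p i) = \<phi> T (q i)"
            using fun_cong [OF eq, of i] by simp
          moreover have "p i \<in> S" "q i \<in> S"
            using p q True by (simp_all add: permutes_in_image)
          ultimately show ?thesis
            by (rule inj_onD [OF bij_betw_imp_inj_on [OF bT]])
        next
          case False
          then show ?thesis
            using p q by (simp add: permutes_not_in)
        qed
        then show "p = q" by blast
      qed
      show "?r ` ?P = {f\<in>{f\<in>?F. inj_on f S}. f ` S = T}"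
      proof
        show "?r ` ?P \<subseteq> {f\<in>{f\<in>?F. inj_on f S}. f ` S = T}"
        proof (rule image_subsetI)
          fix q assume "q \<in> ?P"
          then have "bij_betw (\<phi> T \<circ> q) S T"
            using bij_betw_trans [OF permutes_imp_bij bT] by blast
          then have "inj_on (?r q) S" "?r q ` S = T"
            by (auto simp: bij_betw_def inj_on_def)
          then show "?r q \<in> {f\<in>{f\<in>?F. inj_on f S}. f ` S = T}"
            using T by auto
        qed
        show "{f\<in>{f\<in>?F. inj_on f S}. f ` S = T} \<subseteq> ?r ` ?P"
        proof
          fix f assume "f \<in> {f\<in>{f\<in>?F. inj_on f S}. f ` S = T}"
          then have f: "f \<in> ?F" "bij_betw f S T" by (auto simp: bij_betw_def)
          define q where "q = (\<lambda>i. if i \<in> S then inv_into S (\<phi> T) (f i) else i)"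
          have "bij_betw (inv_into S (\<phi> T) \<circ> f) S S"
            using bij_betw_trans [OF f(2) bij_betw_inv_into [OF bT]] .
          then have "bij_betw q S S"
            by (rule bij_betw_cong [THEN iffD1, rotated]) (simp add: q_def)
          then have "q permutes S"
            by (intro bij_imp_permutes) (simp_all add: q_def)
          moreover have "?r q = f"
          proof
            fix i
            show "?r q i = f i"
            proof (cases "i \<in> S")
              case True
              then have "f i \<in> T"
                using f(2) bij_betwE by blast
              then have "\<phi> T (inv_into S (\<phi> T) (f i)) = f i"
                by (rule bij_betw_inv_into_right [OF bT])
              then show ?thesis
                using True by (simp add: q_def)
            next
              case False
              then show ?thesis using PiE_arb [OF f(1) False] False by simp
            qed
          qed
          ultimately show "f \<in> ?r ` ?P" by blast
        qed
      qed
    qed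
    \<comment> \<open>Permuting the columns by \<open>q\<close> costs \<open>sign q\<close>, which
      is the sign that the remaining product over \<open>A\<close> needs to become a
      determinant.\<close>
    have D: "D (?r q) = of_int (sign q) * set_det S (\<lambda>i j. B i (\<phi> T j))" if "q \<in> ?P" for q
    proof -
      have q: "q permutes S" using that by simp
      have "D (?r q) = (\<Sum>p\<in>?P. of_int (sign p) * (\<Prod>i\<in>S. B (p i) (\<phi> T (q i))))"
        unfolding D_def set_det_def by (intro sum.cong refl arg_cong2 [where f = "(*)"] prod.cong) auto
      also have "\<dots> = (\<Sum>p\<in>?P. of_int (sign (p \<circ> q)) * (\<Prod>i\<in>S. B ((p \<circ> q) i) (\<phi> T (q i))))"
        by (rule sum_permutations_compose_right [OF q])
      also have "\<dots> = (\<Sum>p\<in>?P. of_int (sign q) * (of_int (sign p) * (\<Prod>i\<in>S. B (p i) (\<phi> T i))))"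
      proof (intro sum.cong refl)
        fix p assume "p \<in> ?P"
        then have "sign (p \<circ> q) = sign p * sign q"
          using q S permutation_permutes by (intro sign_compose) blast+
        moreover have "(\<Prod>i\<in>S. B ((p \<circ> q) i) (\<phi> T (q i))) = (\<Prod>i\<in>S. B (p i) (\<phi> T i))"
          using prod.permute [OF q, of "\<lambda>i. B (p i) (\<phi> T i)"] by (simp add: o_def)
        ultimately show "of_int (sign (p \<circ> q)) * (\<Prod>i\<in>S. B ((p \<circ> q) i) (\<phi> T (q i)))
           = of_int (sign q) * (of_int (sign p) * (\<Prod>i\<in>S. B (p i) (\<phi> T i)))"
          by simp
      qed
      also have "\<dots> = of_int (sign q) * set_det S (\<lambda>i j. B j (\<phi> T i))"
        by (simp add: set_det_def sum_distrib_left)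
      finally show ?thesis
        using set_det_transpose [OF S, of "\<lambda>i j. B i (\<phi> T j)"] by simp
    qed
    have "(\<Sum>f\<in>{f\<in>{f\<in>?F. inj_on f S}. f ` S = T}. ?g f) = (\<Sum>q\<in>?P. ?g (?r q))"
      by (rule sum.reindex_bij_betw [OF bij, symmetric])
    also have "\<dots> = (\<Sum>q\<in>?P. of_int (sign q) * (\<Prod>i\<in>S. A i (\<phi> T (q i))) * set_det S (\<lambda>i j. B i (\<phi> T j)))"
      by (intro sum.cong refl) (simp only: D, simp)
    also have "\<dots> = set_det S (\<lambda>i j. A i (\<phi> T j)) * set_det S (\<lambda>i j. B i (\<phi> T j))"
      by (simp add: set_det_def sum_distrib_right)
    finally show "(\<Sum>f\<in>{f\<in>{f\<in>?F. inj_on f S}. f ` S = T}. ?g f)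
      = set_det S (\<lambda>i j. A i (\<phi> T j)) * set_det S (\<lambda>i j. B i (\<phi> T j))" .
  qed
  finally show ?thesis .
qed

section \<open>The characteristic polynomial and principal minors\<close>

lemma set_det_const_poly:
  fixes a :: "'a \<Rightarrow> 'a \<Rightarrow> 'b::comm_ring_1"
  shows "set_det U (\<lambda>i j. [:- a i j:]) = [:(-1) ^ card U * set_det U a:]"
proof -
  have 1: "(\<Prod>i\<in>U. [:f i:]) = [:\<Prod>i\<in>U. f i:]" for f :: "'a \<Rightarrow> 'b"
    by (induction U rule: infinite_finite_induct) (simp_all add: one_pCons)
  have 2: "(\<Sum>p\<in>P. [:g p:]) = [:\<Sum>p\<in>P. g p:]" for g :: "('a \<Rightarrow> 'a) \<Rightarrow> 'b" and P
    by (induction P rule: infinite_finite_induct) simp_all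
  have "set_det U (\<lambda>i j. [:- a i j:]) = (\<Sum>p | p permutes U. [:of_int (sign p) * ((-1) ^ card U * (\<Prod>i\<in>U. a i (p i))):])"
    unfolding set_det_def
  proof (intro sum.cong refl)
    fix p
    have "(\<Prod>i\<in>U. - a i (p i)) = (-1) ^ card U * (\<Prod>i\<in>U. a i (p i))"
      using prod.distrib [of "\<lambda>_. -1" "\<lambda>i. a i (p i)" U] by simp
    then show "of_int (sign p) * (\<Prod>i\<in>U. [:- a i (p i):]) = [:of_int (sign p) * ((-1) ^ card U * (\<Prod>i\<in>U. a i (p i))):]"
      by (simp add: 1 of_int_poly)
  qed
  also have "\<dots> = [:(-1) ^ card U * set_det U a:]"
    unfolding 2 set_det_def by (simp add: sum_distrib_left mult.left_commute)
  finally show ?thesis .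
qed

text \<open>This is \<open>set_det_add_diagonal\<close> with the indeterminate as the diagonal term:
  a minor of size \<open>n - k\<close> leaves \<open>k\<close> diagonal factors.\<close>

lemma coeff_char_poly:
  fixes a :: "nat \<Rightarrow> nat \<Rightarrow> 'a::comm_ring_1"
  assumes "k \<le> n"
  shows "coeff (char_poly (Matrix.mat n n (\<lambda>(i, j). a i j))) k
    = (-1) ^ (n - k) * (\<Sum>U | U \<subseteq> {..<n} \<and> card U = n - k. set_det U a)"
proof -
  let ?A = "Matrix.mat n n (\<lambda>(i, j). a i j)"
  have "char_poly_matrix ?A = Matrix.mat n n (\<lambda>(i, j). (if i = j then [:0, 1:] else 0) + [:- a i j:])"
    by (intro eq_matI) (auto simp: char_poly_matrix_def)
  then have "char_poly ?A = nat_det n (\<lambda>i j. (if i = j then [:0, 1:] else 0) + [:- a i j:])"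
    by (simp add: char_poly_def nat_det_def)
  also have "\<dots> = (\<Sum>U\<in>Pow {..<n}. [:0, 1:] ^ card ({..<n} - U) * [:(-1) ^ card U * set_det U a:])"
    by (simp only: nat_det_eq_set_det set_det_add_diagonal [OF finite_lessThan] set_det_const_poly)
  finally have "coeff (char_poly ?A) k = (\<Sum>U\<in>Pow {..<n}. coeff ([:0, 1:] ^ card ({..<n} - U) * [:(-1) ^ card U * set_det U a:]) k)"
    by (simp only: coeff_sum)
  also have "\<dots> = (\<Sum>U\<in>Pow {..<n}. if card U = n - k then (-1) ^ (n - k) * set_det U a else 0)"
  proof (intro sum.cong refl)
    fix U assume "U \<in> Pow {..<n}"
    then have U: "U \<subseteq> {..<n}" by simp
    then have "card ({..<n} - U) = n - card U" "card U \<le> n"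
      using card_mono [OF finite_lessThan U] by (simp_all add: card_Diff_subset finite_subset)
    moreover have "coeff ([:0, 1:] ^ m * [:b:]) k = (if k = m then b else 0)" for m and b :: 'a
      by (simp add: monom_altdef [of 1, simplified, symmetric] coeff_monom_mult coeff_pCons split: nat.splits)
    ultimately show "coeff ([:0, 1:] ^ card ({..<n} - U) * [:(-1) ^ card U * set_det U a:]) k
      = (if card U = n - k then (-1) ^ (n - k) * set_det U a else 0)"
      using assms by auto
  qed
  also have "\<dots> = (\<Sum>U | U \<subseteq> {..<n} \<and> card U = n - k. (-1) ^ (n - k) * set_det U a)"
    by (simp add: sum.inter_filter [symmetric])
  finally show ?thesis
    by (simp add: sum_distrib_left)
qed

text \<open>Here \<open>r\<close> acts as the rank. The characteristic polynomial is the power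
  \<open>n - r\<close> of the indeterminate times a factor \<open>P\<close>, and \<open>P\<close> at
  0 is the product of the negated non-zero roots. The sign \<open>(-1) ^ r\<close> occurs both in
  this product and in the coefficient, and cancels.\<close>

lemma prod_nonzero_eigenvalues_eq:
  assumes r: "r \<le> n" and nz: "(\<Sum>U | U \<subseteq> {..<n} \<and> card U = r. set_det U a) \<noteq> 0"
    and zero: "\<And>s. r < s \<Longrightarrow> s \<le> n \<Longrightarrow> (\<Sum>U | U \<subseteq> {..<n} \<and> card U = s. set_det U a) = 0"
  shows "prod_nonzero_eigenvalues (Matrix.mat n n (\<lambda>(i, j). a i j)) = (\<Sum>U | U \<subseteq> {..<n} \<and> card U = r. set_det U a)"
proof -
  let ?A = "Matrix.mat n n (\<lambda>(i, j). a i j)"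
  define p where "p = char_poly ?A"
  define e where "e = (\<Sum>U | U \<subseteq> {..<n} \<and> card U = r. set_det U a)"
  have A: "?A \<in> carrier_mat n n" by simp
  have deg: "degree p = n" and lead: "lead_coeff p = 1"
    using degree_monic_char_poly [OF A] by (simp_all add: p_def)
  then have p0: "p \<noteq> 0" by auto
  let ?Z = "{z. poly p z = 0}" and ?Y = "{z. poly p z = 0 \<and> z \<noteq> 0}"
  have finZ: "finite ?Z" by (rule poly_roots_finite [OF p0])
  define P where "P = (\<Prod>z\<in>?Y. [:- z, 1:] ^ Polynomial.order z p)"
  have "p = (\<Prod>z\<in>?Z. [:- z, 1:] ^ Polynomial.order z p)"
    using complex_poly_decompose [of p] lead by simp
  also have "\<dots> = (\<Prod>z\<in>insert 0 ?Y. [:- z, 1:] ^ Polynomial.order z p)"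
    using finZ by (intro prod.mono_neutral_left) (auto simp: order_0I)
  also have "\<dots> = [:0, 1:] ^ Polynomial.order 0 p * P"
    using finZ by (subst prod.insert) (auto simp: P_def)
  finally have p: "p = [:0, 1:] ^ Polynomial.order 0 p * P" .
  have P0: "poly P 0 = (\<Prod>z\<in>?Y. (- z) ^ Polynomial.order z p)"
    by (simp add: P_def poly_prod poly_power)
  have Pnz: "poly P 0 \<noteq> 0"
    unfolding P0 using finZ by (subst prod_zero_iff) auto
  have degP: "degree P = (\<Sum>z\<in>?Y. Polynomial.order z p)"
    unfolding P_def by (subst degree_prod_sum_eq) (auto simp: degree_linear_power)
  have "P \<noteq> 0" using Pnz by auto
  then have "n = Polynomial.order 0 p + degree P"
    using arg_cong [OF p, of degree] deg by (simp add: degree_mult_eq degree_linear_power)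
  have coeff: "coeff p k = (if k < Polynomial.order 0 p then 0 else coeff P (k - Polynomial.order 0 p))" for k
    by (subst p) (simp add: monom_altdef [of 1, simplified, symmetric] coeff_monom_mult)
  have cr: "coeff p (n - r) = (-1) ^ r * e"
    using coeff_char_poly [of "n - r" n a] r by (simp add: p_def e_def)
  have "coeff p (n - r) \<noteq> 0"
    using nz by (simp add: cr e_def)
  then have "Polynomial.order 0 p \<le> n - r"
    using coeff [of "n - r"] by (auto split: if_splits)
  \<comment> \<open>A smaller order of vanishing at 0 would give a non-zero coefficient below
    \<open>n - r\<close>, that is, a non-zero sum of minors of size above \<open>r\<close>.\<close>
  moreover have "n - r \<le> Polynomial.order 0 p"
  proof (rule ccontr)
    assume "\<not> n - r \<le> Polynomial.order 0 p"
    then have lt: "Polynomial.order 0 p < n - r" by simp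
    then have "coeff p (Polynomial.order 0 p) = 0"
      using coeff_char_poly [of "Polynomial.order 0 p" n a] zero [of "n - Polynomial.order 0 p"] r by (simp add: p_def)
    then show False
      using coeff [of "Polynomial.order 0 p"] Pnz by (simp add: poly_0_coeff_0)
  qed
  ultimately have o: "Polynomial.order 0 p = n - r" by simp
  then have degP': "degree P = r"
    using \<open>n = Polynomial.order 0 p + degree P\<close> r by simp
  have "poly P 0 = (-1) ^ r * e"
    using coeff [of "n - r"] cr o by (simp add: poly_0_coeff_0)
  moreover have "poly P 0 = (-1) ^ r * (\<Prod>z\<in>?Y. z ^ Polynomial.order z p)"
  proof -
    have "poly P 0 = (\<Prod>z\<in>?Y. (-1) ^ Polynomial.order z p * z ^ Polynomial.order z p)"
      unfolding P0 by (intro prod.cong refl) (simp flip: power_mult_distrib)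
    also have "\<dots> = (\<Prod>z\<in>?Y. (-1) ^ Polynomial.order z p) * (\<Prod>z\<in>?Y. z ^ Polynomial.order z p)"
      by (rule prod.distrib)
    also have "(\<Prod>z\<in>?Y. (-1) ^ Polynomial.order z p) = ((-1) ^ (\<Sum>z\<in>?Y. Polynomial.order z p) :: complex)"
      by (rule power_sum [symmetric])
    finally show ?thesis
      using degP degP' by simp
  qed
  ultimately have "(\<Prod>z\<in>?Y. z ^ Polynomial.order z p) = e"
    by simp
  then show ?thesis
    by (simp add: prod_nonzero_eigenvalues_def eigenvalue_root_char_poly [OF A] p_def e_def)
qed

section \<open>Maximal independent rows and columns\<close>

definition indep_cols :: "('a \<Rightarrow> 'b \<Rightarrow> int) \<Rightarrow> 'a set \<Rightarrow> 'b set \<Rightarrow> bool" where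
  "indep_cols A R T \<longleftrightarrow> (\<forall>c :: 'b \<Rightarrow> complex. (\<forall>f\<in>R. (\<Sum>e\<in>T. of_int (A f e) * c e) = 0) \<longrightarrow> (\<forall>e\<in>T. c e = 0))"

definition max_indep_cols :: "('a \<Rightarrow> 'b \<Rightarrow> int) \<Rightarrow> 'a set \<Rightarrow> 'b set \<Rightarrow> 'b set \<Rightarrow> bool" where
  "max_indep_cols A R C T \<longleftrightarrow> T \<subseteq> C \<and> indep_cols A R T \<and>
     (\<forall>T'. T' \<subseteq> C \<and> indep_cols A R T' \<and> T \<subseteq> T' \<longrightarrow> T' = T)"

text \<open>A cobase is a base of the transposed matrix, so each fact about columns also yields one
  about rows.\<close>

abbreviation max_indep_rows :: "('a \<Rightarrow> 'b \<Rightarrow> int) \<Rightarrow> 'a set \<Rightarrow> 'b set \<Rightarrow> 'a set \<Rightarrow> bool" where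
  "max_indep_rows A R C S \<equiv> max_indep_cols (\<lambda>e f. A f e) C R S"

lemma indep_colsD:
  "indep_cols A R T \<Longrightarrow> (\<And>f. f \<in> R \<Longrightarrow> (\<Sum>e\<in>T. of_int (A f e) * c e) = (0::complex)) \<Longrightarrow> e \<in> T \<Longrightarrow> c e = 0"
  by (auto simp: indep_cols_def)

lemma max_indep_cols_span:
  fixes A :: "'a \<Rightarrow> 'b \<Rightarrow> int"
  assumes T: "max_indep_cols A R C T" and "finite C" and e: "e \<in> C"
  obtains c :: "'b \<Rightarrow> complex" where "\<And>f. f \<in> R \<Longrightarrow> of_int (A f e) = (\<Sum>t\<in>T. of_int (A f t) * c t)"
proof (cases "e \<in> T")
  case True
  have fin: "finite T"
    using T \<open>finite C\<close> finite_subset by (auto simp: max_indep_cols_def)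
  have "of_int (A f e) = (\<Sum>t\<in>T. of_int (A f t) * (if t = e then 1 else 0 :: complex))" for f
  proof -
    have "(\<Sum>t\<in>T. of_int (A f t) * (if t = e then 1 else 0 :: complex)) = (\<Sum>t\<in>T. if t = e then of_int (A f e) else 0)"
      by (intro sum.cong) auto
    then show ?thesis using True fin by simp
  qed
  then show ?thesis by (rule that)
next
  case False
  have fin: "finite T"
    using T \<open>finite C\<close> finite_subset by (auto simp: max_indep_cols_def)
  have "\<not> indep_cols A R (insert e T)"
  proof
    assume "indep_cols A R (insert e T)"
    then have "insert e T = T"
      using T e unfolding max_indep_cols_def by blast
    then show False using False by blast
  qed
  then obtain c :: "'b \<Rightarrow> complex" and t where c: "\<And>f. f \<in> R \<Longrightarrow> (\<Sum>e\<in>insert e T. of_int (A f e) * c e) = 0"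
    and t: "t \<in> insert e T" "c t \<noteq> 0"
    unfolding indep_cols_def by blast
  have c': "of_int (A f e) * c e + (\<Sum>e\<in>T. of_int (A f e) * c e) = 0" if "f \<in> R" for f
    using c [OF that] False fin by simp
  have "c e \<noteq> 0"
  proof
    assume "c e = 0"
    then have "(\<Sum>e\<in>T. of_int (A f e) * c e) = 0" if "f \<in> R" for f
      using c' [OF that] by simp
    then have "c t = 0" if "t \<in> T" for t
      using indep_colsD [of A R T c] T that by (auto simp: max_indep_cols_def)
    then show False using t \<open>c e = 0\<close> by blast
  qed
  show ?thesis
  proof
    fix f assume "f \<in> R"
    have "(\<Sum>t\<in>T. of_int (A f t) * (- c t / c e)) = - (\<Sum>t\<in>T. of_int (A f t) * c t) / c e"
      by (simp add: sum_negf sum_divide_distrib)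
    also have "\<dots> = of_int (A f e)"
      using c' [OF \<open>f \<in> R\<close>] \<open>c e \<noteq> 0\<close> by (simp add: field_simps add_eq_0_iff)
    finally show "of_int (A f e) = (\<Sum>t\<in>T. of_int (A f t) * (- c t / c e))" ..
  qed
qed

lemma max_indep_cols_extend:
  fixes A :: "'a \<Rightarrow> 'b \<Rightarrow> int"
  assumes "T \<subseteq> C" "indep_cols A R T" "finite C"
  obtains T' where "T \<subseteq> T'" "max_indep_cols A R C T'"
proof -
  let ?P = "\<lambda>T'. T' \<subseteq> C \<and> indep_cols A R T' \<and> T \<subseteq> T'"
  have "\<exists>T'. ?P T' \<and> (\<forall>T''. ?P T'' \<longrightarrow> card T'' \<le> card T')"
    using assms by (intro ex_has_greatest_nat [of ?P T card "Suc (card C)"]) (auto intro: card_mono le_imp_less_Suc)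
  then obtain T' where T': "?P T'" "\<And>T''. ?P T'' \<Longrightarrow> card T'' \<le> card T'" by blast
  have "T'' = T'" if "T'' \<subseteq> C" "indep_cols A R T''" "T' \<subseteq> T''" for T''
  proof -
    have "card T'' \<le> card T'" using T' that by blast
    moreover have "finite T''" using that(1) assms(3) finite_subset by blast
    ultimately show ?thesis
      using that(3) card_seteq by blast
  qed
  then show ?thesis
    using T'(1) by (intro that [of T']) (auto simp: max_indep_cols_def)
qed

lemma ex_max_indep_cols:
  assumes "finite C"
  obtains T where "max_indep_cols A R C T"
  using max_indep_cols_extend [of "{}" C A R] assms by (auto simp: indep_cols_def)

text \<open>Zero rows pad the system to a square matrix indexed by \<open>T\<close>. Its determinant
  vanishes because the transpose kills the unit vector at a zero row.\<close>

lemma homogeneous_system_nontrivial: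
  fixes A :: "'a \<Rightarrow> 'b \<Rightarrow> 'r::idom"
  assumes S: "finite S" and T: "finite T" and card: "card S < card T"
  obtains c where "\<exists>e\<in>T. c e \<noteq> 0" "\<And>f. f \<in> S \<Longrightarrow> (\<Sum>e\<in>T. A f e * c e) = 0"
proof -
  obtain g where g: "inj_on g S" "g ` S \<subseteq> T"
    using card_le_inj [OF S T] card by auto
  have "g ` S \<noteq> T"
    using card g(1) card_image by fastforce
  then obtain i where i: "i \<in> T" "i \<notin> g ` S" using g by blast
  define M where "M = (\<lambda>k j. if k \<in> g ` S then A (inv_into S g k) j else 0)"
  let ?v = "\<lambda>k. if k = i then 1 else 0 :: 'r"
  have "(\<Sum>j\<in>T. M j k * ?v j) = 0" for k
    using i by (intro sum.neutral) (auto simp: M_def)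
  moreover have "\<exists>k\<in>T. ?v k \<noteq> 0"
    using i by (intro bexI [of _ i]) auto
  ultimately have "set_det T (\<lambda>j k. M k j) = 0"
    unfolding set_det_eq_0_iff [OF T] by (intro exI [of _ ?v]) blast
  then have "set_det T M = 0"
    using set_det_transpose [OF T, of M] by simp
  from set_det_eq_0_iff [OF T, THEN iffD1, OF this]
  obtain v where v: "\<exists>e\<in>T. v e \<noteq> 0" "\<forall>k\<in>T. (\<Sum>j\<in>T. M k j * v j) = 0"
    by (elim exE conjE)
  have "(\<Sum>e\<in>T. A f e * v e) = 0" if "f \<in> S" for f
    using v(2) [THEN bspec, of "g f"] g that by (auto simp: M_def)
  then show ?thesis
    using that v(1) by blast
qed

text \<open>Each row is a combination of those in \<open>S\<close>, so a relation among columns need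
  only be tested on \<open>S\<close>.\<close>

lemma vanish_on_max_indep_rows:
  fixes A :: "'a \<Rightarrow> 'b \<Rightarrow> int" and c :: "'b \<Rightarrow> complex"
  assumes S: "max_indep_rows A R C S" and "finite R" and T: "T \<subseteq> C"
    and c: "\<And>f. f \<in> S \<Longrightarrow> (\<Sum>e\<in>T. of_int (A f e) * c e) = 0" and f: "f \<in> R"
  shows "(\<Sum>e\<in>T. of_int (A f e) * c e) = 0"
proof -
  obtain y :: "'a \<Rightarrow> complex" where y: "\<And>e. e \<in> C \<Longrightarrow> of_int (A f e) = (\<Sum>s\<in>S. of_int (A s e) * y s)"
    using max_indep_cols_span [OF S \<open>finite R\<close> f] by blast
  have "(\<Sum>e\<in>T. of_int (A f e) * c e) = (\<Sum>e\<in>T. \<Sum>s\<in>S. y s * (of_int (A s e) * c e))"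
    using T by (intro sum.cong refl) (simp add: y subset_iff sum_distrib_left sum_distrib_right mult_ac)
  also have "\<dots> = (\<Sum>s\<in>S. y s * (\<Sum>e\<in>T. of_int (A s e) * c e))"
    by (subst sum.swap) (simp add: sum_distrib_left)
  also have "\<dots> = 0"
    by (simp add: c)
  finally show ?thesis .
qed

lemma card_indep_le:
  fixes A :: "'a \<Rightarrow> 'b \<Rightarrow> int"
  assumes S: "max_indep_rows A R C S" and fin: "finite R" "finite C" and T: "T \<subseteq> C" "indep_cols A R T"
  shows "card T \<le> card S"
proof (rule ccontr)
  assume "\<not> card T \<le> card S"
  moreover have "finite S" "finite T"
    using S T fin finite_subset by (auto simp: max_indep_cols_def)
  ultimately obtain c :: "'b \<Rightarrow> complex" where c: "\<exists>e\<in>T. c e \<noteq> 0" "\<And>f. f \<in> S \<Longrightarrow> (\<Sum>e\<in>T. of_int (A f e) * c e) = 0"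
    using homogeneous_system_nontrivial [of S T "\<lambda>f e. of_int (A f e)"] by (metis not_le)
  then have "(\<Sum>e\<in>T. of_int (A f e) * c e) = 0" if "f \<in> R" for f
    using vanish_on_max_indep_rows [OF S fin(1) T(1) _ that] by blast
  then show False
    using indep_colsD [OF T(2)] c(1) by blast
qed

text \<open>Row rank equals column rank: the two inequalities are one bound, applied to the matrix
  and to its transpose.\<close>

lemma card_max_indep_eq:
  fixes A :: "'a \<Rightarrow> 'b \<Rightarrow> int"
  assumes S: "max_indep_rows A R C S" and T: "max_indep_cols A R C T" and fin: "finite R" "finite C"
  shows "card T = card S"
proof (rule antisym)
  show "card T \<le> card S"
    using card_indep_le [OF S fin] T by (auto simp: max_indep_cols_def)
  show "card S \<le> card T"
    using card_indep_le [where A = "\<lambda>e f. A f e" and R = C and C = R and S = T and T = S] S T fin by (auto simp: max_indep_cols_def)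
qed

lemma of_int_set_det: "of_int (set_det S M) = set_det S (\<lambda>i j. of_int (M i j))"
  by (simp add: set_det_def)

text \<open>A kernel vector of the square minor extends to a relation among full columns, since the
  rows in \<open>S\<close> span the others. Maximality of \<open>T\<close> follows from its size,
  which is already the largest possible.\<close>

lemma set_det_nonzero_iff_max_indep:
  fixes A :: "'a \<Rightarrow> 'b \<Rightarrow> int"
  assumes S: "max_indep_rows A R C S" and fin: "finite R" "finite C" and T: "T \<subseteq> C" and \<phi>: "bij_betw \<phi> S T"
  shows "set_det S (\<lambda>i j. A i (\<phi> j)) \<noteq> 0 \<longleftrightarrow> max_indep_cols A R C T"
proof -
  have SR: "S \<subseteq> R" and finS: "finite S"
    using S fin finite_subset by (auto simp: max_indep_cols_def)
  have re: "(\<Sum>j\<in>S. of_int (A i (\<phi> j)) * c (\<phi> j)) = (\<Sum>e\<in>T. of_int (A i e) * c e)" for i and c :: "'b \<Rightarrow> complex"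
    by (rule sum.reindex_bij_betw [OF \<phi>])
  let ?D = "set_det S (\<lambda>i j. of_int (A i (\<phi> j))) :: complex"
  have "set_det S (\<lambda>i j. A i (\<phi> j)) = 0 \<longleftrightarrow> ?D = 0"
    unfolding of_int_set_det [symmetric] by (simp only: of_int_eq_0_iff)
  moreover have "?D \<noteq> 0 \<longleftrightarrow> max_indep_cols A R C T"
  proof
    assume D: "?D \<noteq> 0"
    have "indep_cols A R T"
      unfolding indep_cols_def
    proof (intro allI impI ballI)
      fix c :: "'b \<Rightarrow> complex" and e
      assume c: "\<forall>f\<in>R. (\<Sum>e\<in>T. of_int (A f e) * c e) = 0" and e: "e \<in> T"
      have "(\<Sum>j\<in>S. of_int (A i (\<phi> j)) * c (\<phi> j)) = 0" if "i \<in> S" for i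
        unfolding re using c that SR by blast
      then have *: "\<forall>i\<in>S. (\<Sum>j\<in>S. of_int (A i (\<phi> j)) * c (\<phi> j)) = 0"
        by (rule ballI)
      obtain j where j: "j \<in> S" "e = \<phi> j"
        using bij_betw_imp_surj_on [OF \<phi>] e by blast
      show "c e = 0"
      proof (rule ccontr)
        assume "c e \<noteq> 0"
        then have "\<exists>j\<in>S. c (\<phi> j) \<noteq> 0"
          using j by (intro bexI [of _ j]) simp_all
        then have "?D = 0"
          using * by (intro set_det_eq_0_iff [OF finS, THEN iffD2] exI [of _ "\<lambda>j. c (\<phi> j)"] conjI)
        then show False using D by simp
      qed
    qed
    moreover have "T' = T" if "T' \<subseteq> C" "indep_cols A R T'" "T \<subseteq> T'" for T'
    proof -
      have "card T' \<le> card T"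
        using card_indep_le [OF S fin that(1,2)] bij_betw_same_card [OF \<phi>] by simp
      moreover have "finite T'" using that(1) fin finite_subset by blast
      ultimately show ?thesis
        using that(3) card_seteq by blast
    qed
    ultimately show "max_indep_cols A R C T"
      using T by (simp add: max_indep_cols_def)
  next
    assume max: "max_indep_cols A R C T"
    show "?D \<noteq> 0"
    proof
      assume "?D = 0"
      from set_det_eq_0_iff [OF finS, THEN iffD1, OF this]
      obtain v :: "'a \<Rightarrow> complex" and i where v: "i \<in> S" "v i \<noteq> 0" "\<forall>i\<in>S. (\<Sum>j\<in>S. of_int (A i (\<phi> j)) * v j) = 0"
        by (elim exE conjE bexE)
      define c where "c = (\<lambda>e. v (inv_into S \<phi> e))"
      have c: "c (\<phi> j) = v j" if "j \<in> S" for j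
        using bij_betw_inv_into_left [OF \<phi> that] by (simp add: c_def)
      have "(\<Sum>e\<in>T. of_int (A f e) * c e) = 0" if "f \<in> S" for f
        unfolding re [symmetric] using v(3) [THEN bspec, OF that] by (simp add: c)
      then have "(\<Sum>e\<in>T. of_int (A f e) * c e) = 0" if "f \<in> R" for f
        using vanish_on_max_indep_rows [OF S fin(1) T _ that] by blast
      moreover have "\<phi> i \<in> T" using \<phi> v(1) bij_betwE by blast
      moreover have "indep_cols A R T"
        using max by (simp add: max_indep_cols_def)
      ultimately have "c (\<phi> i) = 0"
        using indep_colsD [of A R T c "\<phi> i"] by simp
      then show False using v c by simp
    qed
  qed
  ultimately show ?thesis by blast
qed

lemma set_det_dependent_rows:
  fixes A :: "'a \<Rightarrow> 'b \<Rightarrow> int"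
  assumes fin: "finite U" and U: "\<not> indep_cols (\<lambda>e f. A f e) C U" and g: "g ` U \<subseteq> C"
  shows "set_det U (\<lambda>i j. of_int (A i (g j)) :: complex) = 0"
proof -
  obtain y :: "'a \<Rightarrow> complex" and u where "u \<in> U" "y u \<noteq> 0" "\<And>e. e \<in> C \<Longrightarrow> (\<Sum>f\<in>U. of_int (A f e) * y f) = 0"
    using U unfolding indep_cols_def by blast
  then have "set_det U (\<lambda>i j. of_int (A j (g i)) :: complex) = 0"
    unfolding set_det_eq_0_iff [OF fin] using g by (intro exI [of _ y]) blast
  then show ?thesis
    using set_det_transpose [OF fin, of "\<lambda>i j. of_int (A j (g i)) :: complex"] by simp
qed

text \<open>Another bijection from \<open>S\<close> to \<open>T\<close> permutes the columns of the
  minor and changes its sign at most, so the absolute value depends on the two sets alone.\<close>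

definition minor_abs :: "('a \<Rightarrow> 'b \<Rightarrow> int) \<Rightarrow> 'a set \<Rightarrow> 'b set \<Rightarrow> nat" where
  "minor_abs A S T = nat \<bar>set_det S (\<lambda>i j. A i ((SOME \<phi>. bij_betw \<phi> S T) j))\<bar>"

abbreviation gram :: "('a \<Rightarrow> 'b \<Rightarrow> int) \<Rightarrow> 'b set \<Rightarrow> 'a \<Rightarrow> 'a \<Rightarrow> complex" where
  "gram A C \<equiv> \<lambda>i j. \<Sum>k\<in>C. of_int (A i k) * of_int (A j k)"

lemma gram_det:
  fixes A :: "'a \<Rightarrow> 'b \<Rightarrow> int"
  assumes S: "S \<subseteq> R" and fin: "finite R" "finite C"
  shows "set_det S (gram A C)
     = of_nat (\<Sum>T | T \<subseteq> C \<and> card T = card S. (minor_abs A S T)\<^sup>2)"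
proof -
  have finS: "finite S" using S fin finite_subset by blast
  define \<phi> where "\<phi> T = (SOME \<phi>. bij_betw \<phi> S T)" for T :: "'b set"
  have \<phi>: "bij_betw (\<phi> T) S T" if "T \<subseteq> C" "card T = card S" for T
  proof -
    have "finite T" using that fin finite_subset by blast
    then have "\<exists>\<phi>. bij_betw \<phi> S T"
      using finS that(2) by (metis finite_same_card_bij)
    then show ?thesis unfolding \<phi>_def by (rule someI_ex)
  qed
  have m: "of_nat ((minor_abs A S T)\<^sup>2) = (set_det S (\<lambda>i j. of_int (A i (\<phi> T j))) :: complex)\<^sup>2" for T
  proof -
    let ?d = "set_det S (\<lambda>i j. A i (\<phi> T j))"
    have "int ((minor_abs A S T)\<^sup>2) = ?d\<^sup>2"
      by (simp add: minor_abs_def \<phi>_def)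
    then have "of_int (int ((minor_abs A S T)\<^sup>2)) = (of_int (?d\<^sup>2) :: complex)"
      by (simp only:)
    then show ?thesis
      by (simp only: of_int_of_nat_eq of_int_power of_int_set_det)
  qed
  show ?thesis
    using cauchy_binet [OF finS fin(2) \<phi>, of "\<lambda>i k. of_int (A i k) :: complex" "\<lambda>i k. of_int (A i k)"]
    unfolding of_nat_sum m by (simp add: power2_eq_square)
qed

lemma minor_abs_nonzero_iff:
  fixes A :: "'a \<Rightarrow> 'b \<Rightarrow> int"
  assumes S: "max_indep_rows A R C S" and fin: "finite R" "finite C" and T: "T \<subseteq> C" "card T = card S"
  shows "minor_abs A S T \<noteq> 0 \<longleftrightarrow> max_indep_cols A R C T"
proof -
  have "finite S" "finite T" using S T fin finite_subset by (auto simp: max_indep_cols_def)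
  then have "\<exists>\<phi>. bij_betw \<phi> S T"
    using T(2) by (metis finite_same_card_bij)
  then have "bij_betw (SOME \<phi>. bij_betw \<phi> S T) S T" by (rule someI_ex)
  then show ?thesis
    using set_det_nonzero_iff_max_indep [OF S fin T(1)] by (simp add: minor_abs_def)
qed

text \<open>All bases have the size of \<open>S\<close>, and a column set of this size that is not a
  base has zero minor and drops out of the Cauchy-Binet sum.\<close>

lemma gram_det_max:
  fixes A :: "'a \<Rightarrow> 'b \<Rightarrow> int"
  assumes S: "max_indep_rows A R C S" and fin: "finite R" "finite C"
  shows "set_det S (gram A C)
     = of_nat (\<Sum>T | max_indep_cols A R C T. (minor_abs A S T)\<^sup>2)"
proof -
  have S': "S \<subseteq> R" using S by (simp add: max_indep_cols_def)
  have "(\<Sum>T | T \<subseteq> C \<and> card T = card S. (minor_abs A S T)\<^sup>2) = (\<Sum>T | max_indep_cols A R C T. (minor_abs A S T)\<^sup>2)"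
  proof (rule sum.mono_neutral_right)
    show "finite {T. T \<subseteq> C \<and> card T = card S}" using fin by simp
    show "{T. max_indep_cols A R C T} \<subseteq> {T. T \<subseteq> C \<and> card T = card S}"
      using card_max_indep_eq [OF S _ fin] by (auto simp: max_indep_cols_def)
    show "\<forall>T\<in>{T. T \<subseteq> C \<and> card T = card S} - {T. max_indep_cols A R C T}. (minor_abs A S T)\<^sup>2 = 0"
      using minor_abs_nonzero_iff [OF S fin] by auto
  qed
  then show ?thesis
    using gram_det [OF S' fin, of A] by simp
qed

lemma gram_det_dependent:
  fixes A :: "'a \<Rightarrow> 'b \<Rightarrow> int"
  assumes S: "S \<subseteq> R" and fin: "finite R" "finite C" and dep: "\<not> indep_cols (\<lambda>e f. A f e) C S"
  shows "set_det S (gram A C) = 0"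
proof -
  have finS: "finite S" using S fin finite_subset by blast
  define \<phi> where "\<phi> T = (SOME \<phi>. bij_betw \<phi> S T)" for T :: "'b set"
  have \<phi>: "bij_betw (\<phi> T) S T" if "T \<subseteq> C" "card T = card S" for T
  proof -
    have "finite T" using that fin finite_subset by blast
    then have "\<exists>\<phi>. bij_betw \<phi> S T"
      using finS that(2) by (metis finite_same_card_bij)
    then show ?thesis unfolding \<phi>_def by (rule someI_ex)
  qed
  have "set_det S (\<lambda>i j. of_int (A i (\<phi> T j)) :: complex) = 0" if "T \<subseteq> C" "card T = card S" for T
    using \<phi> [OF that] that by (intro set_det_dependent_rows [OF finS dep]) (auto simp: bij_betw_def)
  then show ?thesis
    using cauchy_binet [OF finS fin(2) \<phi>, of "\<lambda>i k. of_int (A i k) :: complex" "\<lambda>i k. of_int (A i k)"]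
    by simp
qed

text \<open>The rank is the common size of the maximal independent row sets. Larger principal minors
  vanish by dependence, and at the rank only those of maximal independent row sets survive.\<close>

lemma prod_nonzero_eigenvalues_gram:
  fixes A :: "'a \<Rightarrow> 'b \<Rightarrow> int"
  assumes fin: "finite R" "finite C" and rs: "distinct rs" "set rs = R"
  shows "prod_nonzero_eigenvalues (Matrix.mat (length rs) (length rs)
       (\<lambda>(i, j). gram A C (rs ! i) (rs ! j)))
     = (\<Sum>S | max_indep_rows A R C S. set_det S (gram A C))"
proof -
  let ?G = "gram A C"
  let ?n = "length rs" and ?a = "\<lambda>i j. ?G (rs ! i) (rs ! j)"
  have bij: "bij_betw ((!) rs) {..<?n} R"
    using rs by (auto simp: bij_betw_nth)
  have card: "card R = ?n" using rs distinct_card by blast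
  have sum_eq: "(\<Sum>U | U \<subseteq> {..<?n} \<and> card U = s. set_det U ?a) = (\<Sum>V | V \<subseteq> R \<and> card V = s. set_det V ?G)" for s
  proof (rule sum.reindex_bij_witness [where i = "\<lambda>V. inv_into {..<?n} ((!) rs) ` V" and j = "\<lambda>U. (!) rs ` U"])
    fix U assume "U \<in> {U. U \<subseteq> {..<?n} \<and> card U = s}"
    then have U: "U \<subseteq> {..<?n}" "card U = s" by auto
    have inj: "inj_on ((!) rs) U"
      using bij U(1) inj_on_subset by (auto simp: bij_betw_def)
    show "inv_into {..<?n} ((!) rs) ` (!) rs ` U = U"
      using bij U(1) by (simp add: inv_into_image_cancel bij_betw_def)
    show "(!) rs ` U \<in> {V. V \<subseteq> R \<and> card V = s}"
      using bij U inj by (auto simp: bij_betw_def card_image)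
    have "bij_betw ((!) rs) U ((!) rs ` U)" using inj by (simp add: bij_betw_def)
    then show "set_det ((!) rs ` U) ?G = set_det U ?a"
      using U(1) finite_subset by (intro set_det_reindex) auto
  next
    fix V assume "V \<in> {V. V \<subseteq> R \<and> card V = s}"
    then have V: "V \<subseteq> R" "card V = s" by auto
    show "(!) rs ` inv_into {..<?n} ((!) rs) ` V = V"
      using bij V(1) by (intro image_inv_into_cancel) (auto simp: bij_betw_def)
    have "inj_on (inv_into {..<?n} ((!) rs)) V"
      using bij V(1) by (intro inj_on_inv_into) (auto simp: bij_betw_def)
    moreover have "inv_into {..<?n} ((!) rs) ` V \<subseteq> {..<?n}"
      using bij V(1) inv_into_into [of _ "(!) rs" "{..<?n}"] by (fastforce simp: bij_betw_def)
    ultimately show "inv_into {..<?n} ((!) rs) ` V \<in> {U. U \<subseteq> {..<?n} \<and> card U = s}"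
      using V(2) by (simp add: card_image)
  qed
  obtain S0 where S0: "max_indep_rows A R C S0"
    using ex_max_indep_cols [OF fin(1)] by blast
  obtain T0 where T0: "max_indep_cols A R C T0"
    using ex_max_indep_cols [OF fin(2)] by blast
  have S0R: "S0 \<subseteq> R" using S0 by (simp add: max_indep_cols_def)
  have card_rows: "card S = card S0" if "max_indep_rows A R C S" for S
    using card_max_indep_eq [OF that T0 fin] card_max_indep_eq [OF S0 T0 fin] by simp
  have le: "card V \<le> card S0" if "V \<subseteq> R" "indep_cols (\<lambda>e f. A f e) C V" for V
    using card_indep_le [where A = "\<lambda>e f. A f e" and R = C and C = R and S = T0 and T = V] T0 fin that card_max_indep_eq [OF S0 T0 fin] by simp
  have max: "max_indep_rows A R C V" if V: "V \<subseteq> R" "indep_cols (\<lambda>e f. A f e) C V" "card V = card S0" for V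
  proof -
    obtain V' where V': "V \<subseteq> V'" "max_indep_rows A R C V'"
      using max_indep_cols_extend [OF V(1,2) fin(1)] by blast
    moreover have "finite V'"
      using V'(2) fin(1) finite_subset by (auto simp: max_indep_cols_def)
    ultimately have "V = V'"
      using card_rows V(3) by (intro card_subset_eq) auto
    then show ?thesis using V' by simp
  qed
  have r: "(\<Sum>V | V \<subseteq> R \<and> card V = card S0. set_det V ?G) = (\<Sum>S | max_indep_rows A R C S. set_det S ?G)"
  proof (rule sum.mono_neutral_right)
    show "finite {V. V \<subseteq> R \<and> card V = card S0}" using fin by simp
    show "{S. max_indep_rows A R C S} \<subseteq> {V. V \<subseteq> R \<and> card V = card S0}"
      using card_rows by (auto simp: max_indep_cols_def)
    show "\<forall>V\<in>{V. V \<subseteq> R \<and> card V = card S0} - {S. max_indep_rows A R C S}. set_det V ?G = 0"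
      using gram_det_dependent [OF _ fin] max by blast
  qed
  have s: "(\<Sum>V | V \<subseteq> R \<and> card V = s. set_det V ?G) = 0" if "card S0 < s" for s
  proof (intro sum.neutral ballI)
    fix V assume V: "V \<in> {V. V \<subseteq> R \<and> card V = s}"
    then have "\<not> indep_cols (\<lambda>e f. A f e) C V"
      using le [of V] that by auto
    then show "set_det V ?G = 0"
      using gram_det_dependent [OF _ fin] V by blast
  qed
  \<comment> \<open>By Cauchy-Binet every summand is a sum of integer squares, so nothing cancels,
    and one base with one cobase gives a positive term.\<close>
  have nz: "(\<Sum>S | max_indep_rows A R C S. set_det S ?G) \<noteq> 0"
  proof -
    have "(\<Sum>S | max_indep_rows A R C S. set_det S ?G)
      = (\<Sum>S | max_indep_rows A R C S. of_nat (\<Sum>T | max_indep_cols A R C T. (minor_abs A S T)\<^sup>2))"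
      by (intro sum.cong refl gram_det_max fin) simp
    also have "\<dots> = of_nat (\<Sum>S | max_indep_rows A R C S. \<Sum>T | max_indep_cols A R C T. (minor_abs A S T)\<^sup>2)"
      by (rule of_nat_sum [symmetric])
    finally have "(\<Sum>S | max_indep_rows A R C S. set_det S ?G)
      = of_nat (\<Sum>S | max_indep_rows A R C S. \<Sum>T | max_indep_cols A R C T. (minor_abs A S T)\<^sup>2)" .
    moreover have "0 < (\<Sum>S | max_indep_rows A R C S. \<Sum>T | max_indep_cols A R C T. (minor_abs A S T)\<^sup>2)"
    proof (rule sum_pos2)
      show "finite {S. max_indep_rows A R C S}"
        by (rule finite_subset [of _ "Pow R"]) (auto simp: max_indep_cols_def fin)
      have "finite {T. max_indep_cols A R C T}"
        by (rule finite_subset [of _ "Pow C"]) (auto simp: max_indep_cols_def fin)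
      then show "0 < (\<Sum>T | max_indep_cols A R C T. (minor_abs A S0 T)\<^sup>2)"
        using T0 minor_abs_nonzero_iff [OF S0 fin, of T0] card_max_indep_eq [OF S0 T0 fin]
        by (intro sum_pos2 [of _ T0]) (auto simp: max_indep_cols_def)
    qed (use S0 in auto)
    ultimately show ?thesis
      by (simp only: of_nat_eq_0_iff)
  qed
  have "card S0 \<le> ?n"
    using card_mono [OF fin(1) S0R] card by simp
  then show ?thesis
    using prod_nonzero_eigenvalues_eq [of "card S0" ?n ?a] nz s unfolding sum_eq r by simp
qed

section \<open>Lattices of boundaries and cycles\<close>

definition restrict_supp :: "'a set \<Rightarrow> ('a \<Rightarrow> int) \<Rightarrow> 'a \<Rightarrow> int" where
  "restrict_supp S v = (\<lambda>x. if x \<in> S then v x else 0)"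

text \<open>The integral vectors in the rational span of \<open>L\<close>. When \<open>L\<close> is
  the lattice of boundaries, its cosets in the saturation are the torsion classes of
  homology.\<close>

definition saturation :: "'a set \<Rightarrow> ('a \<Rightarrow> int) set \<Rightarrow> ('a \<Rightarrow> int) set" where
  "saturation R L = {z \<in> supported_on R. \<exists>n>0. (\<lambda>x. int n * z x) \<in> L}"

lemma is_subgroup_nat_mult:
  fixes z :: "'a \<Rightarrow> int"
  assumes "is_subgroup A" "z \<in> A"
  shows "(\<lambda>x. int n * z x) \<in> A"
proof (induction n)
  case 0
  then show ?case using is_subgroup_zero [OF assms(1)] by (simp add: zero_fun_def)
next
  case (Suc n)
  have "(\<lambda>x. int (Suc n) * z x) = z + (\<lambda>x. int n * z x)" by (simp add: fun_eq_iff algebra_simps)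
  then show ?case using is_subgroup_add [OF assms Suc] by simp
qed

lemma is_subgroup_saturation:
  assumes L: "is_subgroup L"
  shows "is_subgroup (saturation R L)"
  unfolding is_subgroup_def
proof (intro conjI ballI)
  have "(\<lambda>x. int 1 * (0 :: 'a \<Rightarrow> int) x) = 0" by (simp add: fun_eq_iff)
  then show "0 \<in> saturation R L"
    using is_subgroup_zero [OF L] unfolding saturation_def
    by (intro CollectI conjI exI [of _ "1::nat"]) (simp_all add: supported_on_def)
  fix y z assume "y \<in> saturation R L" "z \<in> saturation R L"
  then obtain m n where y: "y \<in> supported_on R" "m > 0" "(\<lambda>x. int m * y x) \<in> L"
    and z: "z \<in> supported_on R" "n > 0" "(\<lambda>x. int n * z x) \<in> L"
    by (auto simp: saturation_def)
  have "(\<lambda>x. int (m * n) * (y - z) x) = (\<lambda>x. int n * (int m * y x)) - (\<lambda>x. int m * (int n * z x))"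
    by (simp add: fun_eq_iff algebra_simps)
  also have "\<dots> \<in> L"
    by (rule is_subgroup_diff [OF L is_subgroup_nat_mult [OF L y(3)] is_subgroup_nat_mult [OF L z(3)]])
  finally show "y - z \<in> saturation R L"
    using y z is_subgroup_diff [OF is_subgroup_supported_on, of y R z] unfolding saturation_def
    by (intro CollectI conjI exI [of _ "m * n"]) simp_all
qed

lemma subset_saturation: "L \<subseteq> supported_on R \<Longrightarrow> L \<subseteq> saturation R L"
  unfolding saturation_def by (auto intro!: exI [of _ "1::nat"])

lemma saturation_eq_of_finite_index:
  assumes L: "is_subgroup L" and M: "is_subgroup M" "M \<subseteq> L" and i: "index L M \<noteq> 0"
  shows "saturation R M = saturation R L"
proof
  show "saturation R M \<subseteq> saturation R L"
    using M(2) by (auto simp: saturation_def)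
  show "saturation R L \<subseteq> saturation R M"
  proof
    fix z assume "z \<in> saturation R L"
    then obtain n where z: "z \<in> supported_on R" "n > 0" "(\<lambda>x. int n * z x) \<in> L"
      by (auto simp: saturation_def)
    obtain m where m: "m > 0" "(\<lambda>x. int m * (int n * z x)) \<in> M"
      using index_nonzero_multiple [OF L M(1) i z(3)] by blast
    have "(\<lambda>x. int (m * n) * z x) = (\<lambda>x. int m * (int n * z x))"
      by (simp add: mult.assoc)
    then show "z \<in> saturation R M"
      using z m unfolding saturation_def by (intro CollectI conjI exI [of _ "m * n"]) simp_all
  qed
qed

lemma restrict_supp_diff: "restrict_supp S (v - w) = restrict_supp S v - restrict_supp S w"
  by (simp add: restrict_supp_def fun_eq_iff)

lemma restrict_supp_in: "restrict_supp S v \<in> supported_on S"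
  by (simp add: restrict_supp_def supported_on_def)

lemma restrict_supp_image: "S \<subseteq> R \<Longrightarrow> restrict_supp S ` supported_on R = supported_on S"
proof
  show "restrict_supp S ` supported_on R \<subseteq> supported_on S"
    using restrict_supp_in by blast
  assume "S \<subseteq> R"
  have "v = restrict_supp S v" "v \<in> supported_on R" if "v \<in> supported_on S" for v
    using that \<open>S \<subseteq> R\<close> by (auto simp: restrict_supp_def supported_on_def fun_eq_iff)
  then show "supported_on S \<subseteq> restrict_supp S ` supported_on R"
    by blast
qed

lemma restrict_supp_mat_apply: "S \<subseteq> R \<Longrightarrow> restrict_supp S (mat_apply R C A x) = mat_apply S C A x"
  by (auto simp: restrict_supp_def mat_apply_def fun_eq_iff)

lemma restrict_supp_eq_0_iff: "restrict_supp S v = 0 \<longleftrightarrow> (\<forall>x\<in>S. v x = 0)"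
  by (auto simp: restrict_supp_def fun_eq_iff)

lemma range_mat_apply_subset:
  assumes "T \<subseteq> C" "finite C"
  shows "range (mat_apply R T A) \<subseteq> range (mat_apply R C A)"
proof (rule image_subsetI)
  fix x
  have "(\<Sum>e\<in>C. A f e * (if e \<in> T then x e else 0)) = (\<Sum>e\<in>T. A f e * x e)" for f
    using assms by (intro sum.mono_neutral_cong_right) auto
  then have "mat_apply R T A x = mat_apply R C A (\<lambda>e. if e \<in> T then x e else 0)"
    by (simp add: mat_apply_def fun_eq_iff)
  then show "mat_apply R T A x \<in> range (mat_apply R C A)"
    by (simp only: rangeI)
qed

lemma range_mat_apply_eq_image:
  fixes A :: "'a \<Rightarrow> 'b \<Rightarrow> int"
  shows "range (mat_apply R C A) = mat_apply R C A ` supported_on C"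
proof
  show "range (mat_apply R C A) \<subseteq> mat_apply R C A ` supported_on C"
  proof (rule image_subsetI)
    fix x
    have "mat_apply R C A x = mat_apply R C A (restrict_supp C x)"
      by (auto simp: mat_apply_def fun_eq_iff restrict_supp_def)
    then show "mat_apply R C A x \<in> mat_apply R C A ` supported_on C"
      using restrict_supp_in by (rule image_eqI)
  qed
qed auto

text \<open>The determinant formula is carried over from initial segments of the naturals:
  \<open>F\<close> relabels coordinates along an enumeration of \<open>S\<close>, and
  \<open>\<phi>\<close> labels the columns accordingly.\<close>

lemma index_range_mat_apply_bij:
  fixes A :: "'a \<Rightarrow> 'b \<Rightarrow> int"
  assumes S: "finite S" and \<phi>: "bij_betw \<phi> S T"
  shows "index (supported_on S) (range (mat_apply S T A)) = nat \<bar>set_det S (\<lambda>i j. A i (\<phi> j))\<bar>"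
proof -
  let ?n = "card S"
  obtain s where s: "bij_betw s {..<?n} S"
    using ex_bij_betw_nat_finite [OF S] by (auto simp: atLeast0LessThan)
  define s' where "s' = inv_into {..<?n} s"
  have ss': "s (s' x) = x" "s' x < ?n" if "x \<in> S" for x
    using bij_betw_inv_into_right [OF s that] bij_betwE [OF bij_betw_inv_into [OF s]] that by (auto simp: s'_def)
  have s's: "s' (s i) = i" "s i \<in> S" if "i < ?n" for i
    using that bij_betw_inv_into_left [OF s] bij_betwE [OF s] by (auto simp: s'_def)
  define N where "N = (\<lambda>i j. A (s i) (\<phi> (s j)))"
  define F where "F = (\<lambda>v x. if x \<in> S then v (s' x) else 0 :: int)"
  have Fdiff: "F (v - w) = F v - F w" for v w
    by (simp add: F_def fun_eq_iff)
  have img: "F ` supported_on {..<?n} = supported_on S"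
  proof
    show "F ` supported_on {..<?n} \<subseteq> supported_on S"
      by (auto simp: F_def supported_on_def)
    show "supported_on S \<subseteq> F ` supported_on {..<?n}"
    proof
      fix w :: "'a \<Rightarrow> int" assume w: "w \<in> supported_on S"
      show "w \<in> F ` supported_on {..<?n}"
      proof (rule image_eqI)
        show "w = F (\<lambda>i. if i < ?n then w (s i) else 0)"
          using w by (simp add: F_def fun_eq_iff supported_on_def ss')
        show "(\<lambda>i. if i < ?n then w (s i) else 0) \<in> supported_on {..<?n}"
          by (simp add: supported_on_def)
      qed
    qed
  qed
  have bij: "bij_betw (\<phi> \<circ> s) {..<?n} T"
    by (rule bij_betw_trans [OF s \<phi>])
  have FN: "F (sq_apply ?n N (\<lambda>j. x (\<phi> (s j)))) = mat_apply S T A x" for x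
  proof -
    have "(\<Sum>j<?n. A f (\<phi> (s j)) * x (\<phi> (s j))) = (\<Sum>e\<in>T. A f e * x e)" for f
      using sum.reindex_bij_betw [OF bij, of "\<lambda>e. A f e * x e"] by simp
    then show ?thesis
      by (simp add: F_def mat_apply_def fun_eq_iff N_def ss')
  qed
  have img2: "F ` range (sq_apply ?n N) = range (mat_apply S T A)"
  proof
    show "F ` range (sq_apply ?n N) \<subseteq> range (mat_apply S T A)"
    proof clarify
      fix x :: "nat \<Rightarrow> int"
      define y where "y = (\<lambda>e. x (inv_into {..<?n} (\<phi> \<circ> s) e))"
      have y: "y (\<phi> (s j)) = x j" if "j < ?n" for j
        using bij_betw_inv_into_left [OF bij, of j] that by (simp add: y_def)
      have "sq_apply ?n N x = sq_apply ?n N (\<lambda>j. y (\<phi> (s j)))"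
        by (simp add: mat_apply_def fun_eq_iff y)
      then show "F (sq_apply ?n N x) \<in> range (mat_apply S T A)"
        by (simp only: FN rangeI)
    qed
    show "range (mat_apply S T A) \<subseteq> F ` range (sq_apply ?n N)"
    proof (rule image_subsetI)
      fix x
      show "mat_apply S T A x \<in> F ` range (sq_apply ?n N)"
        unfolding FN [symmetric] by (intro imageI rangeI)
    qed
  qed
  have "index (F ` supported_on {..<?n}) (F ` range (sq_apply ?n N))
     = index (supported_on {..<?n}) (range (sq_apply ?n N))"
  proof (rule index_image [OF is_subgroup_supported_on is_subgroup_range_mat_apply])
    show "range (sq_apply ?n N) \<subseteq> supported_on {..<?n}"
      by (rule image_subsetI) (rule mat_apply_in_supported_on)
    fix v assume v: "v \<in> supported_on {..<?n}" "F v = 0"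
    have "v i = 0" for i
    proof (cases "i < ?n")
      case True
      then show ?thesis
        using fun_cong [OF v(2), of "s i"] s's [OF True] by (simp add: F_def)
    qed (use v in \<open>simp add: supported_on_def\<close>)
    then have "v = 0" by (simp add: fun_eq_iff)
    then show "v \<in> range (sq_apply ?n N)"
      using is_subgroup_zero [OF is_subgroup_range_mat_apply] by simp
  qed (rule Fdiff)
  also have "\<dots> = nat \<bar>set_det {..<?n} N\<bar>"
    by (simp only: index_range_mat_apply nat_det_eq_set_det)
  also have "set_det {..<?n} N = set_det S (\<lambda>i j. A i (\<phi> j))"
    unfolding N_def by (rule set_det_reindex [OF s finite_lessThan, symmetric])
  finally show ?thesis
    by (simp only: img img2)
qed

text \<open>The target of \<open>A'\<close> is torsion-free, so a vector with a positive multiple in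
  the kernel lies in the kernel.\<close>

lemma saturation_subset_kernel:
  fixes A :: "'a \<Rightarrow> 'b \<Rightarrow> int" and A' :: "'q \<Rightarrow> 'a \<Rightarrow> int"
  assumes "\<And>q e. q \<in> Q \<Longrightarrow> e \<in> C \<Longrightarrow> (\<Sum>f\<in>R. A' q f * A f e) = 0"
  shows "saturation R (range (mat_apply R C A)) \<subseteq> {v \<in> supported_on R. mat_apply Q R A' v = 0}"
proof
  fix z assume "z \<in> saturation R (range (mat_apply R C A))"
  then obtain n c where n: "n > 0" "(\<lambda>x. int n * z x) = mat_apply R C A c" and zR: "z \<in> supported_on R"
    by (auto simp: saturation_def)
  have nz: "int n * z f = (\<Sum>e\<in>C. A f e * c e)" if "f \<in> R" for f
    using fun_cong [OF n(2), of f] that by (simp add: mat_apply_def)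
  have "(\<Sum>f\<in>R. A' q f * z f) = 0" if q: "q \<in> Q" for q
  proof -
    have "int n * (\<Sum>f\<in>R. A' q f * z f) = (\<Sum>f\<in>R. A' q f * (int n * z f))"
      by (simp add: sum_distrib_left mult.left_commute)
    also have "\<dots> = (\<Sum>f\<in>R. \<Sum>e\<in>C. c e * (A' q f * A f e))"
      by (intro sum.cong refl) (simp add: nz sum_distrib_left mult_ac)
    also have "\<dots> = (\<Sum>e\<in>C. c e * (\<Sum>f\<in>R. A' q f * A f e))"
      by (subst sum.swap) (simp add: sum_distrib_left)
    also have "\<dots> = 0"
      by (simp add: assms [OF q])
    finally show ?thesis using n(1) by simp
  qed
  then show "z \<in> {v \<in> supported_on R. mat_apply Q R A' v = 0}"
    using zR by (simp add: mat_apply_def fun_eq_iff)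
qed

locale base_cobase =
  fixes A :: "'a \<Rightarrow> 'b \<Rightarrow> int" and R :: "'a set" and C :: "'b set" and S :: "'a set" and T :: "'b set"
  assumes fin: "finite R" "finite C"
    and S: "max_indep_rows A R C S" and T: "max_indep_cols A R C T"
begin

lemma SR: "S \<subseteq> R" and TC: "T \<subseteq> C"
  using S T by (auto simp: max_indep_cols_def)

abbreviation "B \<equiv> range (mat_apply R C A)"
abbreviation "B_T \<equiv> range (mat_apply R T A)"

lemma subgroups: "is_subgroup B" "is_subgroup B_T" "is_subgroup (saturation R B)"
  by (intro is_subgroup_saturation is_subgroup_range_mat_apply)+

lemma B_subset: "B_T \<subseteq> B" "B \<subseteq> saturation R B" "saturation R B \<subseteq> supported_on R"
proof -
  show "B_T \<subseteq> B" by (rule range_mat_apply_subset [OF TC fin(2)])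
  show "B \<subseteq> saturation R B"
    by (intro subset_saturation image_subsetI mat_apply_in_supported_on)
  show "saturation R B \<subseteq> supported_on R" by (auto simp: saturation_def)
qed

text \<open>A positive multiple of \<open>z\<close> is a combination of columns of \<open>A\<close>.
  Vanishing on the rows in \<open>S\<close>, it vanishes on all rows, which are combinations of
  these.\<close>

lemma restrict_injective:
  assumes z: "z \<in> saturation R B" and 0: "restrict_supp S z = 0"
  shows "z = 0"
proof -
  obtain n c where n: "n > 0" "(\<lambda>x. int n * z x) = mat_apply R C A c" and zR: "z \<in> supported_on R"
    using z by (auto simp: saturation_def)
  have nz: "int n * z f = (\<Sum>e\<in>C. A f e * c e)" if "f \<in> R" for f
    using fun_cong [OF n(2), of f] that by (simp add: mat_apply_def)
  have zS: "z f = 0" if "f \<in> S" for f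
    using 0 that by (simp add: restrict_supp_eq_0_iff)
  have "(\<Sum>e\<in>C. of_int (A f e) * of_int (c e)) = (0::complex)" if "f \<in> S" for f
  proof -
    have "(\<Sum>e\<in>C. A f e * c e) = 0"
      using nz [of f] zS [OF that] that SR by auto
    then have "of_int (\<Sum>e\<in>C. A f e * c e) = (0::complex)"
      by (simp only: of_int_0)
    then show ?thesis by simp
  qed
  then have "(\<Sum>e\<in>C. of_int (A f e) * of_int (c e)) = (0::complex)" if "f \<in> R" for f
    by (rule vanish_on_max_indep_rows [OF S fin(1) order_refl _ that])
  then have "of_int (\<Sum>e\<in>C. A f e * c e) = (0::complex)" if "f \<in> R" for f
    using that by simp
  then have "z f = 0" if "f \<in> R" for f
    using nz [OF that] n(1) that by (simp only: of_int_eq_0_iff) simp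
  then show ?thesis
    using zR by (auto simp: supported_on_def fun_eq_iff)
qed

lemma index_restrict_BT: "index (supported_on S) (restrict_supp S ` B_T) = minor_abs A S T"
  and minor_nonzero: "minor_abs A S T \<noteq> 0"
proof -
  have card: "card T = card S"
    by (rule card_max_indep_eq [OF S T fin])
  have "finite S" "finite T" using SR TC fin finite_subset by blast+
  then have "\<exists>\<phi>. bij_betw \<phi> S T"
    using card by (metis finite_same_card_bij)
  then have \<phi>: "bij_betw (SOME \<phi>. bij_betw \<phi> S T) S T" by (rule someI_ex)
  have "restrict_supp S ` B_T = range (mat_apply S T A)"
    by (simp add: image_image restrict_supp_mat_apply [OF SR])
  then show "index (supported_on S) (restrict_supp S ` B_T) = minor_abs A S T"
    using index_range_mat_apply_bij [OF \<open>finite S\<close> \<phi>, of A] by (simp add: minor_abs_def)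
  show "minor_abs A S T \<noteq> 0"
    using minor_abs_nonzero_iff [OF S fin TC card] T by blast
qed

text \<open>The projected saturation is inserted between the full lattice on \<open>S\<close> and
  the projection of \<open>B_T\<close>; injectivity of the projection on the saturation moves the
  lower step back upstairs.\<close>

lemma index_split:
  "minor_abs A S T = index (supported_on S) (restrict_supp S ` saturation R B) * index (saturation R B) B_T"
proof -
  have sub: "restrict_supp S ` saturation R B \<subseteq> supported_on S"
    using restrict_supp_in by blast
  have "index (supported_on S) (restrict_supp S ` B_T)
     = index (supported_on S) (restrict_supp S ` saturation R B) * index (restrict_supp S ` saturation R B) (restrict_supp S ` B_T)"
    using sub B_subset
    by (intro index_tower is_subgroup_supported_on is_subgroup_image subgroups restrict_supp_diff image_mono) auto
  also have "index (restrict_supp S ` saturation R B) (restrict_supp S ` B_T) = index (saturation R B) B_T"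
  proof (rule index_image [OF subgroups(3) subgroups(2)])
    show "B_T \<subseteq> saturation R B" using B_subset by blast
    fix z assume "z \<in> saturation R B" "restrict_supp S z = 0"
    then have "z = 0" by (rule restrict_injective)
    then show "z \<in> B_T" using is_subgroup_zero [OF subgroups(2)] by simp
  qed (rule restrict_supp_diff)
  finally show ?thesis
    by (simp only: index_restrict_BT)
qed

text \<open>The index of \<open>B_T\<close> in \<open>B\<close> is a factor of the non-zero minor,
  hence finite. So the torsion belonging to a base can be measured in the saturation of all
  boundaries.\<close>

lemma saturation_BT: "saturation R B_T = saturation R B"
proof -
  have "index (saturation R B) B_T = index (saturation R B) B * index B B_T"
    using B_subset by (intro index_tower subgroups)
  then have "index B B_T \<noteq> 0"
    using index_split minor_nonzero by auto
  then show ?thesis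
    using B_subset by (intro saturation_eq_of_finite_index subgroups)
qed

lemma index_saturation_nonzero: "index (saturation R B) B \<noteq> 0"
proof -
  have "index (saturation R B) B_T = index (saturation R B) B * index B B_T"
    using B_subset by (intro index_tower subgroups)
  then show ?thesis
    using index_split minor_nonzero by auto
qed

end

text \<open>Any base and cobase will do: their minor is non-zero and the index divides it.\<close>

lemma index_saturation_range_nonzero:
  assumes "finite R" "finite C"
  shows "index (saturation R (range (mat_apply R C A))) (range (mat_apply R C A)) \<noteq> 0"
proof -
  obtain S where "max_indep_rows A R C S" using ex_max_indep_cols [OF assms(1)] by blast
  moreover obtain T where "max_indep_cols A R C T" using ex_max_indep_cols [OF assms(2)] by blast
  ultimately interpret base_cobase A R C S T
    using assms by unfold_locales
  show ?thesis by (rule index_saturation_nonzero)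
qed

text \<open>\<open>A\<close> and \<open>A'\<close> stand for two consecutive boundary maps: the rows
  of \<open>A\<close> index the columns of \<open>A'\<close>, and the composite vanishes.\<close>

locale base_cobase_complex = base_cobase +
  fixes A' :: "'q \<Rightarrow> 'a \<Rightarrow> int" and Q :: "'q set"
  assumes finQ: "finite Q"
    and compose: "\<And>q e. q \<in> Q \<Longrightarrow> e \<in> C \<Longrightarrow> (\<Sum>f\<in>R. A' q f * A f e) = 0"
begin

definition "Z = {v \<in> supported_on R. mat_apply Q R A' v = 0}"
definition "Z_S = {v \<in> supported_on (R - S). mat_apply Q (R - S) A' v = 0}"
abbreviation "B' \<equiv> range (mat_apply Q R A')"
abbreviation "B'_S \<equiv> range (mat_apply Q (R - S) A')"

lemma Z_subgroup: "is_subgroup Z"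
  unfolding is_subgroup_def Z_def
  using is_subgroup_zero [OF is_subgroup_supported_on] is_subgroup_diff [OF is_subgroup_supported_on]
  by (auto simp: mat_apply_diff) (simp add: mat_apply_def fun_eq_iff)

lemma mat_apply_restrict:
  assumes "v \<in> supported_on (R - S)"
  shows "mat_apply Q (R - S) A' v = mat_apply Q R A' v"
proof -
  have "(\<Sum>f\<in>R - S. A' q f * v f) = (\<Sum>f\<in>R. A' q f * v f)" for q
    using assms fin(1) by (intro sum.mono_neutral_left) (auto simp: supported_on_def)
  then show ?thesis
    unfolding mat_apply_def by (intro ext) (simp only:)
qed

lemma supported_on_Diff: "supported_on (R - S) = {v \<in> supported_on R. restrict_supp S v = (0 :: 'a \<Rightarrow> int)}"
  by (auto simp: supported_on_def restrict_supp_eq_0_iff)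

lemma Z_S_eq: "Z_S = {v \<in> Z. restrict_supp S v = 0}"
  using mat_apply_restrict by (auto simp: Z_S_def Z_def supported_on_Diff)

lemma Z_S_subgroup: "is_subgroup Z_S"
  using Z_subgroup unfolding is_subgroup_def Z_S_eq
  by (auto simp: restrict_supp_diff) (simp add: restrict_supp_eq_0_iff)

lemma saturation_subset_Z: "saturation R B \<subseteq> Z"
  unfolding Z_def by (rule saturation_subset_kernel) (rule compose)

abbreviation "ZB \<equiv> {a + b | a b. a \<in> saturation R B \<and> b \<in> Z_S}"

text \<open>The index of the projected saturation is split at the projected cycles. The lower factor
  is \<open>index Z ZB\<close>, because \<open>Z_S\<close> is the kernel of the projection on
  cycles. The upper factor is pulled back to all chains and pushed forward by \<open>A'\<close>,
  where it becomes \<open>index B' B'_S\<close>; a last tower expresses this through the two torsion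
  indices.\<close>

theorem index_identity:
  "minor_abs A S T * index (saturation Q B') B' =
     index (saturation R B) B_T * index Z ZB * index (saturation Q B'_S) B'_S"
  and index_nonzero: "index Z ZB \<noteq> 0" "index (saturation Q B'_S) B'_S \<noteq> 0"
proof -
  let ?r = "restrict_supp S" and ?V = "supported_on R :: ('a \<Rightarrow> int) set"
  let ?K = "supported_on (R - S) :: ('a \<Rightarrow> int) set"
  let ?ZK = "{a + b | a b. a \<in> Z \<and> b \<in> ?K}"
  have sgK: "is_subgroup ?K" and sgV: "is_subgroup ?V" by (rule is_subgroup_supported_on)+
  have add: "?r (v + w) = ?r v + ?r w" for v w
    by (simp add: restrict_supp_def fun_eq_iff)
  have addA: "mat_apply Q R A' (v + w) = mat_apply Q R A' v + mat_apply Q R A' w" for v w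
    by (auto simp: mat_apply_def fun_eq_iff algebra_simps sum.distrib)
  have sgZB: "is_subgroup ZB" by (rule is_subgroup_set_plus [OF subgroups(3) Z_S_subgroup])
  have sgZK: "is_subgroup ?ZK" by (rule is_subgroup_set_plus [OF Z_subgroup sgK])
  have ZV: "Z \<subseteq> ?V" by (auto simp: Z_def)
  have KV: "?K \<subseteq> ?V" by (auto simp: supported_on_def)
  have ZBZ: "ZB \<subseteq> Z"
    using saturation_subset_Z Z_S_eq is_subgroup_add [OF Z_subgroup] by blast
  have ZKV: "?ZK \<subseteq> ?V"
    using ZV KV is_subgroup_add [OF sgV] by blast
  have 0: "0 \<in> saturation R B" "0 \<in> Z" "0 \<in> Z_S" "0 \<in> ?K"
    using subgroups Z_subgroup Z_S_subgroup sgK is_subgroup_zero by blast+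
  have mem: "x \<in> X \<Longrightarrow> y \<in> Y \<Longrightarrow> z = x + y \<Longrightarrow> z \<in> {a + b | a b. a \<in> X \<and> b \<in> Y}" for x y z :: "'a \<Rightarrow> int" and X Y
    by blast
  have rZB: "?r ` ZB = ?r ` saturation R B"
  proof
    show "?r ` ZB \<subseteq> ?r ` saturation R B"
    proof (rule image_subsetI)
      fix z assume "z \<in> ZB"
      then obtain a b where ab: "z = a + b" "a \<in> saturation R B" "b \<in> Z_S" by blast
      then have "?r z = ?r a" by (simp add: add Z_S_eq)
      then show "?r z \<in> ?r ` saturation R B" using ab(2) by (rule image_eqI)
    qed
    show "?r ` saturation R B \<subseteq> ?r ` ZB"
    proof (rule image_mono, rule subsetI)
      fix a assume "a \<in> saturation R B"
      then show "a \<in> ZB" using 0(3) by (rule mem) simp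
    qed
  qed
  have rZK: "?r ` ?ZK = ?r ` Z"
  proof
    show "?r ` ?ZK \<subseteq> ?r ` Z"
    proof (rule image_subsetI)
      fix z assume "z \<in> ?ZK"
      then obtain a b where ab: "z = a + b" "a \<in> Z" "b \<in> ?K" by blast
      then have "?r z = ?r a" by (simp add: add supported_on_Diff)
      then show "?r z \<in> ?r ` Z" using ab(2) by (rule image_eqI)
    qed
    show "?r ` Z \<subseteq> ?r ` ?ZK"
    proof (rule image_mono, rule subsetI)
      fix a assume "a \<in> Z"
      then show "a \<in> ?ZK" using 0(4) by (rule mem) simp
    qed
  qed
  have 1: "index (?r ` Z) (?r ` saturation R B) = index Z ZB"
    unfolding rZB [symmetric]
  proof (rule index_image [OF Z_subgroup sgZB ZBZ])
    fix z assume "z \<in> Z" "?r z = 0"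
    then have "z \<in> Z_S" by (simp add: Z_S_eq)
    with 0(1) show "z \<in> ZB" by (rule mem) simp
  qed (rule restrict_supp_diff)
  have 2: "index (supported_on S) (?r ` Z) = index ?V ?ZK"
    unfolding rZK [symmetric] restrict_supp_image [OF SR, symmetric]
  proof (rule index_image [OF sgV sgZK ZKV])
    fix z assume "z \<in> ?V" "?r z = 0"
    then have "z \<in> ?K" by (simp add: supported_on_Diff)
    with 0(2) show "z \<in> ?ZK" by (rule mem) simp
  qed (rule restrict_supp_diff)
  have AZK: "mat_apply Q R A' ` ?ZK = B'_S"
  proof -
    have "mat_apply Q R A' ` ?ZK = mat_apply Q R A' ` ?K"
    proof
      show "mat_apply Q R A' ` ?ZK \<subseteq> mat_apply Q R A' ` ?K"
      proof (rule image_subsetI)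
        fix z assume "z \<in> ?ZK"
        then obtain a b where ab: "z = a + b" "a \<in> Z" "b \<in> ?K" by blast
        then have "mat_apply Q R A' z = mat_apply Q R A' b" by (simp add: addA Z_def)
        then show "mat_apply Q R A' z \<in> mat_apply Q R A' ` ?K" using ab(3) by (rule image_eqI)
      qed
      show "mat_apply Q R A' ` ?K \<subseteq> mat_apply Q R A' ` ?ZK"
      proof (rule image_mono, rule subsetI)
        fix a assume "a \<in> ?K"
        with 0(2) show "a \<in> ?ZK" by (rule mem) simp
      qed
    qed
    also have "\<dots> = mat_apply Q (R - S) A' ` ?K"
      by (intro image_cong refl) (simp add: mat_apply_restrict)
    finally show ?thesis
      by (simp only: range_mat_apply_eq_image)
  qed
  \<comment> \<open>\<open>?ZK\<close> contains the kernels of both the projection to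
    \<open>S\<close> and \<open>A'\<close>, so its index among all chains can be read off after
    either map.\<close>
  have 3: "index ?V ?ZK = index B' B'_S"
    unfolding AZK [symmetric] range_mat_apply_eq_image [of Q R A']
  proof (rule index_image [OF sgV sgZK ZKV, symmetric])
    fix z assume "z \<in> ?V" "mat_apply Q R A' z = 0"
    then have "z \<in> Z" by (simp add: Z_def)
    then show "z \<in> ?ZK" using 0(4) by (rule mem) simp
  qed (rule mat_apply_diff)
  have "index (supported_on S) (?r ` saturation R B) = index (supported_on S) (?r ` Z) * index (?r ` Z) (?r ` saturation R B)"
    using saturation_subset_Z restrict_supp_in
    by (intro index_tower is_subgroup_supported_on is_subgroup_image Z_subgroup subgroups restrict_supp_diff image_mono) auto
  then have 4: "index (supported_on S) (?r ` saturation R B) = index B' B'_S * index Z ZB"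
    by (simp only: 1 2 3)
  have nz: "index B' B'_S \<noteq> 0" "index Z ZB \<noteq> 0"
    using minor_nonzero index_split 4 by auto
  then show "index Z ZB \<noteq> 0" by simp
  have B'S: "B'_S \<subseteq> B'"
    using fin(1) by (intro range_mat_apply_subset) auto
  \<comment> \<open>Finite index gives both lattices the same rational span, so that both torsion
    indices refer to one saturation.\<close>
  have sat: "saturation Q B'_S = saturation Q B'"
    using B'S nz by (intro saturation_eq_of_finite_index is_subgroup_range_mat_apply)
  have B'sat: "B' \<subseteq> saturation Q B'"
    by (intro subset_saturation image_subsetI mat_apply_in_supported_on)
  have 5: "index (saturation Q B'_S) B'_S = index (saturation Q B') B' * index B' B'_S"
    unfolding sat using B'S B'sat
    by (intro index_tower is_subgroup_saturation is_subgroup_range_mat_apply)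
  show "index (saturation Q B'_S) B'_S \<noteq> 0"
    using nz index_saturation_range_nonzero [OF finQ fin(1)] by (simp add: 5)
  show "minor_abs A S T * index (saturation Q B') B' =
     index (saturation R B) B_T * index Z ZB * index (saturation Q B'_S) B'_S"
    by (simp add: index_split 4 5 mult_ac)
qed

end

section \<open>Torsion of cellular homology\<close>

lemma bd_eq:
  fixes c :: "'c \<Rightarrow> 'r::comm_ring_1"
  assumes fin: "finite (cw_cells X)" and c: "c \<in> chains X (Suc k)"
  shows "bd X c = (\<lambda>f. if f \<in> cells X k then \<Sum>e\<in>cells X (Suc k). of_int (incidence X f e) * c e else 0)"
proof
  fix f
  have "(\<Sum>e\<in>cw_cells X. of_int (incidence X f e) * c e) = (\<Sum>e\<in>cells X (Suc k). of_int (incidence X f e) * c e)"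
    using fin c by (intro sum.mono_neutral_right) (auto simp: cells_def chains_def)
  moreover have "incidence X f e = 0" if "e \<in> cells X (Suc k)" "f \<notin> cells X k" for e
    using that by (auto simp: incidence_def cells_def)
  ultimately show "bd X c f = (if f \<in> cells X k then \<Sum>e\<in>cells X (Suc k). of_int (incidence X f e) * c e else 0)"
    by (simp add: bd_def)
qed

lemma chains_int: "(chains X k :: ('c \<Rightarrow> int) set) = supported_on (cells X k)"
  by (simp add: chains_def supported_on_def)

lemma bd_int:
  fixes c :: "'c \<Rightarrow> int"
  assumes "finite (cw_cells X)" "c \<in> supported_on (cells X (Suc k))"
  shows "bd X c = mat_apply (cells X k) (cells X (Suc k)) (incidence X) c"
proof -
  have "c \<in> chains X (Suc k)"
    using assms(2) by (simp only: chains_int)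
  from bd_eq [OF assms(1) this] show ?thesis
    by (intro ext) (simp add: mat_apply_def)
qed

lemma cycles_Suc:
  assumes "finite (cw_cells X)"
  shows "(cycles X (Suc k) :: ('c \<Rightarrow> int) set) = {v \<in> supported_on (cells X (Suc k)). mat_apply (cells X k) (cells X (Suc k)) (incidence X) v = 0}"
  using bd_int [OF assms] by (auto simp: cycles_def chains_int zero_fun_def)

text \<open>A 0-cell is never the higher cell of an incidence pair, so \<open>incidence\<close>
  takes its default value 0 and every 0-chain is a cycle.\<close>

lemma cycles_0: "cycles X 0 = (supported_on (cells X 0) :: ('c \<Rightarrow> int) set)"
proof -
  have "bd X c = (\<lambda>_. 0)" if "c \<in> supported_on (cells X 0)" for c :: "'c \<Rightarrow> int"
  proof
    fix f
    have "of_int (incidence X f e) * c e = 0" if "e \<in> cw_cells X" for e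
      using that \<open>c \<in> supported_on (cells X 0)\<close>
      by (cases "cw_dim X e = 0") (auto simp: incidence_def supported_on_def cells_def)
    then show "bd X c f = 0"
      unfolding bd_def by (intro sum.neutral) blast
  qed
  then show ?thesis
    by (auto simp: cycles_def chains_int)
qed

lemma boundaries_int:
  assumes "finite (cw_cells X)"
  shows "(boundaries X k :: ('c \<Rightarrow> int) set) = range (mat_apply (cells X k) (cells X (Suc k)) (incidence X))"
  unfolding boundaries_def chains_int range_mat_apply_eq_image
  by (intro image_cong refl bd_int assms)

lemma mat_apply_cong:
  assumes "\<And>i j. i \<in> R \<Longrightarrow> j \<in> C \<Longrightarrow> A i j = A' i j"
  shows "mat_apply R C A = mat_apply R C A'"
  unfolding mat_apply_def using assms by (intro ext) (auto intro!: sum.cong)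

lemma is_subgroup_cycles:
  assumes "finite (cw_cells X)"
  shows "is_subgroup (cycles X k :: ('c \<Rightarrow> int) set)"
proof (cases k)
  case 0
  then show ?thesis by (simp add: cycles_0 is_subgroup_supported_on)
next
  case (Suc j)
  have "mat_apply (cells X j) (cells X (Suc j)) (incidence X) 0 = 0"
    by (simp add: mat_apply_def fun_eq_iff)
  then show ?thesis
    using is_subgroup_zero [OF is_subgroup_supported_on] is_subgroup_diff [OF is_subgroup_supported_on]
    unfolding Suc cycles_Suc [OF assms] is_subgroup_def by (auto simp: mat_apply_diff)
qed

lemma r_coset_additive_group: "r_coset (additive_group Z) L a = (+) a ` L"
  unfolding r_coset_def additive_group_def by (auto simp: fun_eq_iff plus_fun_def add.commute)

lemma carrier_Mod_additive_group: "carrier (additive_group Z Mod L) = (\<lambda>a. (+) a ` L) ` Z"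
  by (auto simp: FactGroup_def RCOSETS_def r_coset_additive_group) (auto simp: additive_group_def)

lemma comm_group_additive_group:
  assumes "is_subgroup (Z :: ('c \<Rightarrow> int) set)"
  shows "comm_group (additive_group Z)"
proof (rule comm_groupI)
  fix x y z assume "x \<in> carrier (additive_group Z)" "y \<in> carrier (additive_group Z)" "z \<in> carrier (additive_group Z)"
  then have xyz: "x \<in> Z" "y \<in> Z" "z \<in> Z" by (simp_all add: additive_group_def)
  show "x \<otimes>\<^bsub>additive_group Z\<^esub> y \<in> carrier (additive_group Z)"
    using is_subgroup_add [OF assms xyz(1,2)] by (simp add: additive_group_def plus_fun_def)
  show "\<exists>y\<in>carrier (additive_group Z). y \<otimes>\<^bsub>additive_group Z\<^esub> x = \<one>\<^bsub>additive_group Z\<^esub>"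
    using is_subgroup_minus [OF assms xyz(1)] by (intro bexI [of _ "- x"]) (simp_all add: additive_group_def)
qed (use is_subgroup_zero [OF assms] in \<open>auto simp: additive_group_def zero_fun_def algebra_simps\<close>)

lemma pow_Mod_additive_group:
  assumes Z: "is_subgroup (Z :: ('c \<Rightarrow> int) set)" and L: "is_subgroup L" "L \<subseteq> Z" and a: "a \<in> Z"
  shows "((+) a ` L) [^]\<^bsub>additive_group Z Mod L\<^esub> (n::nat) = (+) (\<lambda>x. int n * a x) ` L"
proof -
  interpret G: comm_group "additive_group Z"
    by (rule comm_group_additive_group [OF Z])
  interpret L: comm_group "additive_group L"
    by (rule comm_group_additive_group [OF L(1)])
  have sub: "subgroup L (additive_group Z)"
    by (rule G.group_incl_imp_subgroup) (use L L.group_axioms in \<open>auto simp: additive_group_def\<close>)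
  then interpret N: normal L "additive_group Z"
    by (rule G.normal_iff_subgroup [THEN iffD2])
  interpret Q: group "additive_group Z Mod L"
    by (rule N.factorgroup_is_group)
  show ?thesis
  proof (induction n)
    case 0
    have "(+) (\<lambda>x. 0) ` L = L"
      by (auto simp: plus_fun_def)
    then show ?case
      by (simp add: FactGroup_def nat_pow_def)
  next
    case (Suc n)
    have na: "(\<lambda>x. int n * a x) \<in> Z"
      by (rule is_subgroup_nat_mult [OF Z a])
    have "((+) a ` L) [^]\<^bsub>additive_group Z Mod L\<^esub> Suc n
      = (L #>\<^bsub>additive_group Z\<^esub> (\<lambda>x. int n * a x)) <#>\<^bsub>additive_group Z\<^esub> (L #>\<^bsub>additive_group Z\<^esub> a)"
      unfolding Q.nat_pow_Suc Suc r_coset_additive_group by (simp add: FactGroup_def)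
    also have "\<dots> = L #>\<^bsub>additive_group Z\<^esub> ((\<lambda>x. int n * a x) \<otimes>\<^bsub>additive_group Z\<^esub> a)"
      using na a by (intro N.rcos_sum) (simp_all add: additive_group_def)
    also have "\<dots> = (+) (\<lambda>x. int (Suc n) * a x) ` L"
      unfolding r_coset_additive_group by (simp add: additive_group_def algebra_simps)
    finally show ?case .
  qed
qed

text \<open>A coset is torsion exactly when a positive multiple of its representative is a boundary;
  by \<open>sat\<close> every saturated vector is a cycle and so does represent a class.\<close>

lemma tors_eq_index:
  fixes X :: "('a, 'c) cw_complex"
  assumes fin: "finite (cw_cells X)"
    and sat: "saturation (cells X j) (boundaries X j) \<subseteq> cycles X j"
  shows "tors j X = index (saturation (cells X j) (boundaries X j)) (boundaries X j)"
proof -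
  let ?Z = "cycles X j :: ('c \<Rightarrow> int) set" and ?L = "boundaries X j :: ('c \<Rightarrow> int) set"
  let ?G = "additive_group ?Z Mod ?L"
  have Z: "is_subgroup ?Z" by (rule is_subgroup_cycles [OF fin])
  have L: "is_subgroup ?L" by (simp add: boundaries_int [OF fin] is_subgroup_range_mat_apply)
  have "?L \<subseteq> saturation (cells X j) ?L"
    unfolding boundaries_int [OF fin]
    by (intro subset_saturation image_subsetI mat_apply_in_supported_on)
  then have LZ: "?L \<subseteq> ?Z" using sat by blast
  have ZS: "?Z \<subseteq> supported_on (cells X j)"
    by (auto simp: cycles_def chains_int)
  have pow: "((+) a ` ?L) [^]\<^bsub>?G\<^esub> n = \<one>\<^bsub>?G\<^esub> \<longleftrightarrow> (\<lambda>x. int n * a x) \<in> ?L" if "a \<in> ?Z" for a and n :: nat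
  proof -
    have "\<one>\<^bsub>?G\<^esub> = (+) 0 ` ?L"
      by (simp add: FactGroup_def)
    then show ?thesis
      unfolding pow_Mod_additive_group [OF Z L LZ that] by (simp only: coset_eq_iff [OF L]) simp
  qed
  have "torsion_subgroup ?G = (\<lambda>a. (+) a ` ?L) ` saturation (cells X j) ?L"
  proof
    show "torsion_subgroup ?G \<subseteq> (\<lambda>a. (+) a ` ?L) ` saturation (cells X j) ?L"
    proof
      fix u assume "u \<in> torsion_subgroup ?G"
      then obtain a n where a: "a \<in> ?Z" "u = (+) a ` ?L" and n: "(n::nat) > 0" "u [^]\<^bsub>?G\<^esub> n = \<one>\<^bsub>?G\<^esub>"
        unfolding torsion_subgroup_def carrier_Mod_additive_group by blast
      then have "(\<lambda>x. int n * a x) \<in> ?L" using pow by blast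
      then have "a \<in> saturation (cells X j) ?L"
        using a(1) n(1) ZS unfolding saturation_def by blast
      then show "u \<in> (\<lambda>a. (+) a ` ?L) ` saturation (cells X j) ?L"
        using a(2) by blast
    qed
    show "(\<lambda>a. (+) a ` ?L) ` saturation (cells X j) ?L \<subseteq> torsion_subgroup ?G"
    proof (rule image_subsetI)
      fix a assume a: "a \<in> saturation (cells X j) ?L"
      then obtain n :: nat where n: "n > 0" "(\<lambda>x. int n * a x) \<in> ?L" by (auto simp: saturation_def)
      have "a \<in> ?Z" using a sat by blast
      then show "(+) a ` ?L \<in> torsion_subgroup ?G"
        using n pow unfolding torsion_subgroup_def carrier_Mod_additive_group by blast
    qed
  qed
  then show ?thesis
    by (simp add: tors_def cw_homology_def index_def)
qed

text \<open>One direction clears denominators by the product of all denominators of a rational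
  chain; the other divides an integral chain by the multiplier.\<close>

lemma rat_boundary_iff:
  fixes a :: "'c \<Rightarrow> int"
  assumes fin: "finite (cw_cells X)" and a: "a \<in> supported_on (cells X k)"
  shows "(\<lambda>e. rat_of_int (a e)) \<in> boundaries X k
    \<longleftrightarrow> a \<in> saturation (cells X k) (range (mat_apply (cells X k) (cells X (Suc k)) (incidence X)))"
proof -
  let ?C = "cells X (Suc k)" and ?R = "cells X k"
  have finC: "finite ?C" using fin by (simp add: cells_def)
  show ?thesis
  proof
    assume "(\<lambda>e. rat_of_int (a e)) \<in> boundaries X k"
    then obtain c :: "'c \<Rightarrow> rat" where c: "c \<in> chains X (Suc k)" "(\<lambda>e. rat_of_int (a e)) = bd X c"
      by (auto simp: boundaries_def)
    define n where "n = (\<Prod>e\<in>?C. snd (quotient_of (c e)))"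
    have den: "snd (quotient_of q) > 0" for q by (rule quotient_of_denom_pos')
    have n: "n > 0" unfolding n_def by (intro prod_pos) (simp add: den)
    have "\<exists>y. of_int y = of_int n * c e" if "e \<in> ?C" for e
    proof -
      obtain p q where pq: "quotient_of (c e) = (p, q)" by fastforce
      have "q dvd n"
        unfolding n_def using dvd_prodI [OF finC that, of "\<lambda>e. snd (quotient_of (c e))"] pq by simp
      then obtain r where r: "n = q * r" by blast
      have "c e = of_int p / of_int q" using quotient_of_div [OF pq] .
      moreover have "q \<noteq> 0" using den [of "c e"] pq by simp
      ultimately have "of_int (p * r) = of_int n * c e"
        by (simp add: r)
      then show ?thesis by blast
    qed
    then obtain y where y: "\<And>e. e \<in> ?C \<Longrightarrow> of_int (y e) = of_int n * c e" by metis
    have "(\<lambda>x. n * a x) = mat_apply ?R ?C (incidence X) y"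
    proof
      fix f
      show "n * a f = mat_apply ?R ?C (incidence X) y f"
      proof (cases "f \<in> ?R")
        case True
        have "rat_of_int (a f) = (\<Sum>e\<in>?C. of_int (incidence X f e) * c e)"
          using fun_cong [OF c(2), of f] bd_eq [OF fin c(1)] True by simp
        then have "rat_of_int (n * a f) = (\<Sum>e\<in>?C. of_int (incidence X f e) * (of_int n * c e))"
          by (simp add: sum_distrib_left mult.left_commute)
        also have "\<dots> = (\<Sum>e\<in>?C. of_int (incidence X f e) * of_int (y e))"
          by (intro sum.cong refl) (simp add: y)
        also have "\<dots> = of_int (\<Sum>e\<in>?C. incidence X f e * y e)" by simp
        finally show ?thesis
          unfolding of_int_eq_iff using True by (simp add: mat_apply_def)
      next
        case False
        then show ?thesis using a by (simp add: mat_apply_def supported_on_def)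
      qed
    qed
    then have "(\<lambda>x. int (nat n) * a x) \<in> range (mat_apply ?R ?C (incidence X))"
      using n by simp
    then show "a \<in> saturation ?R (range (mat_apply ?R ?C (incidence X)))"
      using a n unfolding saturation_def by (intro CollectI conjI exI [of _ "nat n"]) simp_all
  next
    assume "a \<in> saturation ?R (range (mat_apply ?R ?C (incidence X)))"
    then obtain n y where n: "(n::nat) > 0" "(\<lambda>x. int n * a x) = mat_apply ?R ?C (incidence X) y"
      by (auto simp: saturation_def)
    let ?c = "\<lambda>e. if e \<in> ?C then of_int (y e) / of_nat n else 0 :: rat"
    have c: "?c \<in> chains X (Suc k)" by (simp add: chains_def)
    have "(\<lambda>e. rat_of_int (a e)) = bd X ?c"
    proof
      fix f
      show "rat_of_int (a f) = bd X ?c f"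
      proof (cases "f \<in> ?R")
        case True
        then have "int n * a f = (\<Sum>e\<in>?C. incidence X f e * y e)"
          using fun_cong [OF n(2), of f] by (simp add: mat_apply_def)
        then have "rat_of_int (int n * a f) = rat_of_int (\<Sum>e\<in>?C. incidence X f e * y e)"
          by (simp only:)
        then have "of_nat n * rat_of_int (a f) = (\<Sum>e\<in>?C. of_int (incidence X f e) * of_int (y e))"
          by simp
        then have "rat_of_int (a f) = (\<Sum>e\<in>?C. of_int (incidence X f e) * of_int (y e)) / of_nat n"
          using n(1) by (simp add: field_simps)
        also have "\<dots> = (\<Sum>e\<in>?C. of_int (incidence X f e) * ?c e)"
          by (simp add: sum_divide_distrib)
        also have "\<dots> = bd X ?c f"
          unfolding bd_eq [OF fin c] using True by simp
        finally show ?thesis .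
      next
        case False
        then show ?thesis
          unfolding bd_eq [OF fin c] using a by (simp add: supported_on_def)
      qed
    qed
    then show "(\<lambda>e. rat_of_int (a e)) \<in> boundaries X k"
      unfolding boundaries_def using c by (rule image_eqI)
  qed
qed

text \<open>Incidence numbers vanish unless the dimensions are consecutive, so a condition over all
  cells reduces to one over the \<open>k\<close>-cells.\<close>

lemma indep_columns_iff:
  "indep_columns X (Suc k) T \<longleftrightarrow> T \<subseteq> cells X (Suc k) \<and> indep_cols (incidence X) (cells X k) T"
proof -
  have "(\<forall>f\<in>cw_cells X. (\<Sum>e\<in>T. of_int (incidence X f e) * c e) = 0)
    \<longleftrightarrow> (\<forall>f\<in>cells X k. (\<Sum>e\<in>T. of_int (incidence X f e) * c e) = 0)"
    if "T \<subseteq> cells X (Suc k)" for c :: "'b \<Rightarrow> complex"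
  proof -
    have "(\<Sum>e\<in>T. of_int (incidence X f e) * c e) = 0" if "f \<notin> cells X k" for f
    proof -
      have "incidence X f e = 0" if "e \<in> T" for e
        using that \<open>T \<subseteq> cells X (Suc k)\<close> \<open>f \<notin> cells X k\<close> by (auto simp: incidence_def cells_def)
      then show ?thesis by simp
    qed
    then show ?thesis by (auto simp: cells_def)
  qed
  then show ?thesis
    unfolding indep_columns_def indep_cols_def by blast
qed

lemma indep_rows_iff:
  "indep_rows X k S \<longleftrightarrow> S \<subseteq> cells X k \<and> indep_cols (\<lambda>e f. incidence X f e) (cells X (Suc k)) S"
proof -
  have "(\<forall>e\<in>cw_cells X. (\<Sum>f\<in>S. of_int (incidence X f e) * c f) = 0)
    \<longleftrightarrow> (\<forall>e\<in>cells X (Suc k). (\<Sum>f\<in>S. of_int (incidence X f e) * c f) = 0)"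
    if "S \<subseteq> cells X k" for c :: "'b \<Rightarrow> complex"
  proof -
    have "(\<Sum>f\<in>S. of_int (incidence X f e) * c f) = 0" if "e \<notin> cells X (Suc k)" for e
    proof -
      have "incidence X f e = 0" if "f \<in> S" for f
        using that \<open>S \<subseteq> cells X k\<close> \<open>e \<notin> cells X (Suc k)\<close> by (auto simp: incidence_def cells_def)
      then show ?thesis by simp
    qed
    then show ?thesis by (auto simp: cells_def)
  qed
  then show ?thesis
    unfolding indep_rows_def indep_cols_def by blast
qed

lemma is_base_iff: "is_base X (Suc k) T \<longleftrightarrow> max_indep_cols (incidence X) (cells X k) (cells X (Suc k)) T"
  unfolding is_base_def max_indep_cols_def indep_columns_iff by blast

lemma is_cobase_iff: "is_cobase X k S \<longleftrightarrow> max_indep_rows (incidence X) (cells X k) (cells X (Suc k)) S"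
  unfolding is_cobase_def max_indep_cols_def indep_rows_iff by blast

text \<open>Integer entries are their own conjugates, so the adjoint acts as the transpose, and the
  enumeration of the columns only reorders the sum.\<close>

lemma boundary_mat_gram:
  assumes cs: "enumerates cs C"
  shows "boundary_mat X rs cs * mat_adjoint (boundary_mat X rs cs) = Matrix.mat (length rs) (length rs)
     (\<lambda>(i, j). gram (incidence X) C (rs ! i) (rs ! j))"
proof (rule eq_matI)
  let ?M = "boundary_mat X rs cs"
  have M: "?M \<in> carrier_mat (length rs) (length cs)" by (simp add: boundary_mat_def)
  have bij: "bij_betw ((!) cs) {..<length cs} C"
    using cs by (auto simp: enumerates_def bij_betw_nth)
  fix i j assume "i < dim_row (Matrix.mat (length rs) (length rs) (\<lambda>(i, j). gram (incidence X) C (rs ! i) (rs ! j) :: complex))"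
    "j < dim_col (Matrix.mat (length rs) (length rs) (\<lambda>(i, j). gram (incidence X) C (rs ! i) (rs ! j) :: complex))"
  then have ij: "i < length rs" "j < length rs" by simp_all
  have "(?M * mat_adjoint ?M) $$ (i, j) = (\<Sum>k<length cs. ?M $$ (i, k) * cnj (?M $$ (j, k)))"
    using ij M by (simp add: scalar_prod_def mat_adjoint_def mat_of_rows_def atLeast0LessThan)
  also have "\<dots> = (\<Sum>k<length cs. of_int (incidence X (rs ! i) (cs ! k)) * of_int (incidence X (rs ! j) (cs ! k)))"
    using ij by (intro sum.cong refl) (simp add: boundary_mat_def)
  also have "\<dots> = gram (incidence X) C (rs ! i) (rs ! j)"
    by (rule sum.reindex_bij_betw [OF bij])
  finally show "(?M * mat_adjoint ?M) $$ (i, j) = Matrix.mat (length rs) (length rs)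
     (\<lambda>(i, j). gram (incidence X) C (rs ! i) (rs ! j)) $$ (i, j)"
    using ij by simp
qed (simp_all add: boundary_mat_def mat_adjoint_def)

lemma det_boundary_gram:
  assumes rs: "enumerates rs S" and cs: "enumerates cs C"
  shows "Determinant.det (boundary_mat X rs cs * mat_adjoint (boundary_mat X rs cs))
    = set_det S (gram (incidence X) C)"
proof -
  have bij: "bij_betw ((!) rs) {..<length rs} S"
    using rs by (auto simp: enumerates_def bij_betw_nth)
  show ?thesis
    unfolding boundary_mat_gram [OF cs] nat_det_def [symmetric] nat_det_eq_set_det
    by (rule set_det_reindex [OF bij finite_lessThan, symmetric])
qed

section \<open>Torsion orders of a complex and its subcomplexes as lattice indices\<close>

context cw
begin

lemma finite_subcomplex_cells: "T \<subseteq> cells X k \<Longrightarrow> finite (cw_cells (subcomplex X k T))"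
  using finite_cw_cells finite_cells by (auto simp: subcomplex_def intro: finite_subset)

lemma saturation_boundaries_subset_cycles: "saturation (cells X k) (boundaries X k :: ('c \<Rightarrow> int) set) \<subseteq> cycles X k"
proof (cases k)
  case 0
  then show ?thesis by (auto simp: cycles_0 saturation_def)
next
  case (Suc j)
  show ?thesis
    unfolding Suc cycles_Suc [OF finite_cw_cells] boundaries_int [OF finite_cw_cells]
    by (rule saturation_subset_kernel) (rule incidence_compose)
qed

lemma tors_X: "tors k X = index (saturation (cells X k) (range (mat_apply (cells X k) (cells X (Suc k)) (incidence X))))
    (range (mat_apply (cells X k) (cells X (Suc k)) (incidence X)))"
  using tors_eq_index [OF finite_cw_cells saturation_boundaries_subset_cycles]
  unfolding boundaries_int [OF finite_cw_cells] .

lemma cycles_subcomplex: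
  assumes T: "T \<subseteq> cells X k" and "j < k"
  shows "cycles (subcomplex X k T) j = (cycles X j :: ('c \<Rightarrow> int) set)"
proof -
  interpret cw_subcomplex X k T by unfold_locales (rule T)
  show ?thesis
  proof (cases j)
    case 0
    then show ?thesis using assms(2) by (simp add: cycles_0 subcomplex_cells)
  next
    case (Suc i)
    have "mat_apply (cells X i) (cells X (Suc i)) (incidence X') = mat_apply (cells X i) (cells X (Suc i)) (incidence X)"
      using assms(2) Suc by (intro mat_apply_cong) (auto simp: incidence_subcomplex cells_def)
    then show ?thesis
      using assms(2) unfolding Suc cycles_Suc [OF finite_cw_cells] cycles_Suc [OF finite_subcomplex_cells [OF T]]
      by (simp add: subcomplex_cells)
  qed
qed

lemma cycles_subcomplex_top:
  assumes T: "T \<subseteq> cells X (Suc k)"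
  shows "(cycles (subcomplex X (Suc k) T) (Suc k) :: ('c \<Rightarrow> int) set) = {v \<in> supported_on T. mat_apply (cells X k) T (incidence X) v = 0}"
proof -
  interpret cw_subcomplex X "Suc k" T by unfold_locales (rule T)
  have "mat_apply (cells X k) T (incidence X') = mat_apply (cells X k) T (incidence X)"
    by (intro mat_apply_cong) (auto simp: incidence_subcomplex cells_def)
  then show ?thesis
    unfolding cycles_Suc [OF finite_subcomplex_cells [OF T]] by (simp add: subcomplex_cells)
qed

lemma boundaries_subcomplex:
  assumes T: "T \<subseteq> cells X (Suc k)"
  shows "(boundaries (subcomplex X (Suc k) T) k :: ('c \<Rightarrow> int) set) = range (mat_apply (cells X k) T (incidence X))"
proof -
  interpret cw_subcomplex X "Suc k" T by unfold_locales (rule T)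
  have "mat_apply (cells X k) T (incidence X') = mat_apply (cells X k) T (incidence X)"
    by (intro mat_apply_cong) (auto simp: incidence_subcomplex cells_def)
  then show ?thesis
    unfolding boundaries_int [OF finite_subcomplex_cells [OF T]] by (simp add: subcomplex_cells)
qed

text \<open>That saturated boundaries of the subcomplex are cycles is inherited from
  \<open>X\<close>: its boundaries are among those of \<open>X\<close>, and the cycles in dimension
  \<open>k\<close> agree because all cells up to that dimension are kept.\<close>

lemma tors_subcomplex:
  assumes T: "T \<subseteq> cells X (Suc k)"
  shows "tors k (subcomplex X (Suc k) T) = index (saturation (cells X k) (range (mat_apply (cells X k) T (incidence X))))
    (range (mat_apply (cells X k) T (incidence X)))"
proof -
  interpret cw_subcomplex X "Suc k" T by unfold_locales (rule T)
  have cells: "cells X' k = cells X k" by (simp add: subcomplex_cells)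
  have "range (mat_apply (cells X k) T (incidence X)) \<subseteq> boundaries X k"
    unfolding boundaries_int [OF finite_cw_cells] by (rule range_mat_apply_subset [OF T finite_cells])
  then have "saturation (cells X k) (range (mat_apply (cells X k) T (incidence X))) \<subseteq> saturation (cells X k) (boundaries X k)"
    by (auto simp: saturation_def)
  also have "\<dots> \<subseteq> cycles X k" by (rule saturation_boundaries_subset_cycles)
  also have "\<dots> = cycles X' k" by (rule cycles_subcomplex [OF T, symmetric]) simp
  finally show ?thesis
    using tors_eq_index [OF finite_subcomplex_cells [OF T], of k]
    unfolding cells boundaries_subcomplex [OF T] by blast
qed

text \<open>The index identity for two consecutive boundary maps, with the indices of
  \<open>B_T\<close> and \<open>B'_S\<close> read as torsion of subcomplexes and that of
  \<open>ZB\<close> as \<open>tors'\<close>.\<close>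

theorem minor_identity:
  assumes S: "is_cobase X (Suc k) S" and T: "is_base X (Suc (Suc k)) T"
  shows "minor_abs (incidence X) S T * tors k X =
      tors (Suc k) (subcomplex X (Suc (Suc k)) T) * tors' (Suc k) X S * tors k (subcomplex X (Suc k) (cells X (Suc k) - S))"
    and "tors' (Suc k) X S \<noteq> 0" "tors k (subcomplex X (Suc k) (cells X (Suc k) - S)) \<noteq> 0"
proof -
  let ?R = "cells X (Suc k)" and ?C = "cells X (Suc (Suc k))" and ?Q = "cells X k" and ?I = "incidence X"
  interpret base_cobase_complex ?I ?R ?C S T ?I ?Q
    using S T finite_cells incidence_compose unfolding is_base_iff is_cobase_iff
    by unfold_locales auto
  have t1: "tors (Suc k) (subcomplex X (Suc (Suc k)) T) = index (saturation ?R B) B_T"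
    unfolding tors_subcomplex [OF TC] saturation_BT ..
  have t2: "tors k (subcomplex X (Suc k) (?R - S)) = index (saturation ?Q B'_S) B'_S"
    by (rule tors_subcomplex) blast
  have Z: "cycles X (Suc k) = Z"
    unfolding Z_def by (rule cycles_Suc [OF finite_cw_cells])
  have ZS: "cycles (subcomplex X (Suc k) (?R - S)) (Suc k) = Z_S"
    unfolding Z_S_def by (rule cycles_subcomplex_top) blast
  have "{\<lambda>e. a e + b e | a b. a \<in> cycles X (Suc k) \<and> (\<lambda>e. rat_of_int (a e)) \<in> boundaries X (Suc k) \<and>
         b \<in> cycles (subcomplex X (Suc k) (?R - S)) (Suc k)} = ZB"
  proof -
    have "a \<in> cycles X (Suc k) \<and> (\<lambda>e. rat_of_int (a e)) \<in> boundaries X (Suc k) \<longleftrightarrow> a \<in> saturation ?R B" for a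
      using rat_boundary_iff [OF finite_cw_cells, of a "Suc k"] saturation_subset_Z unfolding Z
      by (auto simp: Z_def)
    then have "{\<lambda>e. a e + b e | a b. a \<in> cycles X (Suc k) \<and> (\<lambda>e. rat_of_int (a e)) \<in> boundaries X (Suc k) \<and> b \<in> Z_S}
      = {\<lambda>e. a e + b e | a b. a \<in> saturation ?R B \<and> b \<in> Z_S}"
      by (simp only: conj_assoc [symmetric])
    then show ?thesis
      by (simp only: ZS plus_fun_def)
  qed
  then have t': "tors' (Suc k) X S = index Z ZB"
    unfolding tors'_def Coset.order_def carrier_Mod_additive_group index_def Z by simp
  show "minor_abs ?I S T * tors k X =
      tors (Suc k) (subcomplex X (Suc (Suc k)) T) * tors' (Suc k) X S * tors k (subcomplex X (Suc k) (?R - S))"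
    unfolding t1 t2 t' tors_X by (rule index_identity)
  show "tors' (Suc k) X S \<noteq> 0" "tors k (subcomplex X (Suc k) (?R - S)) \<noteq> 0"
    unfolding t2 t' by (rule index_nonzero)+
qed

text \<open>The minor identity is squared and summed over all bases; the two torsion factors that
  depend on \<open>S\<close> alone come out of the sum.\<close>

lemma gram_identity:
  assumes S: "is_cobase X (Suc k) S"
  shows "set_det S (gram (incidence X) (cells X (Suc (Suc k)))) * of_nat (tors k X) ^ 2
    = of_nat (h X (Suc k)) * (of_nat (tors k (subcomplex X (Suc k) (cells X (Suc k) - S))) ^ 2 * of_nat (tors' (Suc k) X S) ^ 2)"
    and "tors' (Suc k) X S \<noteq> 0" "tors k (subcomplex X (Suc k) (cells X (Suc k) - S)) \<noteq> 0"
proof -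
  let ?R = "cells X (Suc k)" and ?C = "cells X (Suc (Suc k))" and ?I = "incidence X"
  let ?t = "tors k (subcomplex X (Suc k) (?R - S))" and ?t' = "tors' (Suc k) X S"
  \<comment> \<open>The non-vanishing concerns \<open>S\<close> only, but it is deduced from a
    minor, so some base has to be supplied.\<close>
  obtain T0 where "is_base X (Suc (Suc k)) T0"
    unfolding is_base_iff using ex_max_indep_cols [OF finite_cells] by blast
  from minor_identity(2,3) [OF S this] show "?t' \<noteq> 0" "?t \<noteq> 0" .
  have "(\<Sum>T | is_base X (Suc (Suc k)) T. (minor_abs ?I S T)\<^sup>2) * (tors k X)\<^sup>2
     = (\<Sum>T | is_base X (Suc (Suc k)) T. (minor_abs ?I S T * tors k X)\<^sup>2)"
    by (simp add: sum_distrib_right power_mult_distrib)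
  also have "\<dots> = (\<Sum>T | is_base X (Suc (Suc k)) T. (tors (Suc k) (subcomplex X (Suc (Suc k)) T))\<^sup>2 * (?t\<^sup>2 * ?t'\<^sup>2))"
  proof (intro sum.cong refl)
    fix T assume "T \<in> {T. is_base X (Suc (Suc k)) T}"
    then have "minor_abs ?I S T * tors k X = tors (Suc k) (subcomplex X (Suc (Suc k)) T) * ?t' * ?t"
      using minor_identity(1) [OF S] by blast
    then show "(minor_abs ?I S T * tors k X)\<^sup>2 = (tors (Suc k) (subcomplex X (Suc (Suc k)) T))\<^sup>2 * (?t\<^sup>2 * ?t'\<^sup>2)"
      by (simp only: power_mult_distrib mult_ac)
  qed
  also have "\<dots> = h X (Suc k) * (?t\<^sup>2 * ?t'\<^sup>2)"
    by (simp add: h_def sum_distrib_right)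
  finally have "of_nat ((\<Sum>T | is_base X (Suc (Suc k)) T. (minor_abs ?I S T)\<^sup>2) * (tors k X)\<^sup>2)
     = (of_nat (h X (Suc k) * (?t\<^sup>2 * ?t'\<^sup>2)) :: complex)"
    by (simp only:)
  moreover have "set_det S (gram ?I ?C)
     = of_nat (\<Sum>T | is_base X (Suc (Suc k)) T. (minor_abs ?I S T)\<^sup>2)"
    unfolding is_base_iff using S unfolding is_cobase_iff by (intro gram_det_max finite_cells)
  ultimately show "set_det S (gram ?I ?C) * of_nat (tors k X) ^ 2
    = of_nat (h X (Suc k)) * (of_nat ?t ^ 2 * of_nat ?t' ^ 2)"
    by (simp only: of_nat_mult of_nat_power)
qed

lemma tors_nonzero: "tors k X \<noteq> 0"
  unfolding tors_X by (rule index_saturation_range_nonzero [OF finite_cells finite_cells])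

end

theorem corollary6p2:
  fixes X :: "('a, 'c) cw_complex" and d :: nat
  assumes "finite_cw_complex X" and "has_dimension X d" and "d > 1"
  shows "(\<forall>S rs cs.
            is_cobase X (d - 1) S \<and> enumerates rs S \<and> enumerates cs (cells X d) \<longrightarrow>
            of_nat (h X (d - 1)) =
              of_nat (tors (d - 2) X) ^ 2 /
              (of_nat (tors (d - 2) (subcomplex X (d - 1) (cells X (d - 1) - S))) ^ 2 *
               of_nat (tors' (d - 1) X S) ^ 2) *
              Determinant.det (boundary_mat X rs cs * mat_adjoint (boundary_mat X rs cs))) \<and>
         (\<forall>rs cs.
            enumerates rs (cells X (d - 1)) \<and> enumerates cs (cells X d) \<longrightarrow>
            prod_nonzero_eigenvalues (boundary_mat X rs cs * mat_adjoint (boundary_mat X rs cs)) =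
              of_nat (h X (d - 1)) * of_nat (h' X (d - 2)) / of_nat (tors (d - 2) X) ^ 2)"
proof -
  interpret cw X by unfold_locales (rule assms(1))
  \<comment> \<open>As \<open>d > 1\<close>, the truncated differences \<open>d - 1\<close> and
    \<open>d - 2\<close> are genuine and become \<open>Suc k\<close> and \<open>k\<close>.\<close>
  define k where "k = d - 2"
  then have d: "d = Suc (Suc k)"
    using assms(3) by simp
  let ?R = "cells X (Suc k)" and ?C = "cells X (Suc (Suc k))"
  let ?G = "gram (incidence X) ?C"
  let ?t = "\<lambda>S. tors k (subcomplex X (Suc k) (?R - S))" and ?t' = "\<lambda>S. tors' (Suc k) X S"
  have t: "of_nat (tors k X) \<noteq> (0::complex)"
    using tors_nonzero by simp
  show ?thesis
    unfolding d
  proof (intro conjI allI impI)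
    fix S rs cs assume *: "is_cobase X (Suc (Suc k) - 1) S \<and> enumerates rs S \<and> enumerates cs ?C"
    then have S: "is_cobase X (Suc k) S" by simp
    have "set_det S ?G * of_nat (tors k X) ^ 2 = of_nat (h X (Suc k)) * (of_nat (?t S) ^ 2 * of_nat (?t' S) ^ 2)"
      by (rule gram_identity(1) [OF S])
    moreover have "of_nat (?t S) ^ 2 * of_nat (?t' S) ^ 2 \<noteq> (0::complex)"
      using gram_identity(2,3) [OF S] by simp
    ultimately have "of_nat (h X (Suc k)) = of_nat (tors k X) ^ 2 / (of_nat (?t S) ^ 2 * of_nat (?t' S) ^ 2) * set_det S ?G"
      by (simp add: field_simps)
    then show "of_nat (h X (Suc (Suc k) - 1)) =
              of_nat (tors (Suc (Suc k) - 2) X) ^ 2 /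
              (of_nat (tors (Suc (Suc k) - 2) (subcomplex X (Suc (Suc k) - 1) (cells X (Suc (Suc k) - 1) - S))) ^ 2 *
               of_nat (tors' (Suc (Suc k) - 1) X S) ^ 2) *
              Determinant.det (boundary_mat X rs cs * mat_adjoint (boundary_mat X rs cs))"
      using * det_boundary_gram [of rs S cs ?C X] by simp
  next
    fix rs cs assume *: "enumerates rs (cells X (Suc (Suc k) - 1)) \<and> enumerates cs ?C"
    then have rs: "distinct rs" "set rs = ?R" by (simp_all add: enumerates_def)
    have "prod_nonzero_eigenvalues (boundary_mat X rs cs * mat_adjoint (boundary_mat X rs cs))
       = (\<Sum>S | is_cobase X (Suc k) S. set_det S ?G)"
      unfolding is_cobase_iff boundary_mat_gram [OF conjunct2 [OF *]]
      by (rule prod_nonzero_eigenvalues_gram [OF finite_cells finite_cells rs])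
    \<comment> \<open>The first claim is solved for the determinant; what then depends on
      \<open>S\<close> is the summand of \<open>h'\<close>.\<close>
    also have "\<dots> = (\<Sum>S | is_cobase X (Suc k) S. of_nat (h X (Suc k)) * (of_nat (?t S) ^ 2 * of_nat (?t' S) ^ 2) / of_nat (tors k X) ^ 2)"
      using t by (intro sum.cong refl) (simp add: eq_divide_eq gram_identity(1))
    also have "\<dots> = of_nat (h X (Suc k)) * of_nat (h' X k) / of_nat (tors k X) ^ 2"
      by (simp add: h'_def sum_distrib_left sum_divide_distrib)
    finally show "prod_nonzero_eigenvalues (boundary_mat X rs cs * mat_adjoint (boundary_mat X rs cs)) =
              of_nat (h X (Suc (Suc k) - 1)) * of_nat (h' X (Suc (Suc k) - 2)) / of_nat (tors (Suc (Suc k) - 2) X) ^ 2"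
      by simp
  qed
qed

end
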